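(* Let $p\in(1,\infty)$, $s\in(0,1)$, and let $u\in W^{s,p}(\mathbb{R}^n)$ be a weak solution to the problem $\mathcal{L}u=0$ in $\Omega$, $u=g$ in $\mathbb{R}^n\setminus\Omega$. Then $u$ is locally Hölder continuous in $\Omega$ (i.e. has a locally Hölder continuous representative). More precisely, there exist constants $\alpha\in(0,sp/(p-1))$ and $c>0$, depending only on $n,p,s,\lambda,\Lambda$, such that whenever $B_{2r}(x_0)\subset\Omega$, \[ \operatorname*{ess\,osc}_{B_\varrho(x_0)}u\;\le\;c\left(\frac{\varrho}{r}\right)^{\alpha}\left[\mathrm{Tail}(u;x_0,r)+\left(\frac{1}{|B_{2r}(x_0)|}\int_{B_{2r}(x_0)}|u|^p\,dx\right)^{1/p}\right] \] for every $\varrho\in(0,r]$, where $\operatorname{ess\,osc}_B u=\operatorname{ess\,sup}_B u-\operatorname{ess\,inf}_B u$.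
   Context: Fix $n\ge1$, $s\in(0,1)$, $p>1$, and constants $1\le\lambda\le\Lambda$. The kernel $K:\mathbb{R}^n\times\mathbb{R}^n\to[0,\infty)$ is measurable, symmetric, and satisfies $\lambda\le K(x,y)|x-y|^{n+sp}\le\Lambda$ for a.e. $x,y$. $W^{s,p}(\mathbb{R}^n)$ is the usual fractional Sobolev space; $W^{s,p}_0(\Omega)=\{v\in W^{s,p}(\mathbb{R}^n): v=0$ a.e. in $\mathbb{R}^n\setminus\Omega\}$; $\Omega\subset\mathbb{R}^n$ is a bounded open set, $g\in W^{s,p}(\mathbb{R}^n)$, and $\mathcal{K}_g(\Omega)=\{v\in W^{s,p}(\mathbb{R}^n): v-g\in W^{s,p}_0(\Omega)\}$. A weak solution is $u\in\mathcal{K}_g$ with $\int_{\mathbb{R}^n}\int_{\mathbb{R}^n} K(x,y)|u(x)-u(y)|^{p-2}(u(x)-u(y))(\eta(x)-\eta(y))\,dx\,dy=0$ for all $\eta\in W^{s,p}_0(\Omega)$. The nonlocal tail is $\mathrm{Tail}(v;x_0,R)=\big[R^{sp}\int_{\mathbb{R}^n\setminus B_R(x_0)}|v(x)|^{p-1}|x-x_0|^{-n-sp}dx\big]^{1/(p-1)}$. *)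

theory Defs
  imports "HOL-Analysis.Analysis" "HOL-Probability.Essential_Supremum"
begin

definition frac_sobolev :: "real \<Rightarrow> real \<Rightarrow> ('a::euclidean_space \<Rightarrow> real) set" where
  "frac_sobolev s p = {u. u \<in> borel_measurable lebesgue
      \<and> integrable lebesgue (\<lambda>x. \<bar>u x\<bar> powr p)
      \<and> (\<integral>\<^sup>+ z. ennreal (\<bar>u (fst z) - u (snd z)\<bar> powr p
            / norm (fst z - snd z) powr (real DIM('a) + s * p)) \<partial>(lebesgue \<Otimes>\<^sub>M lebesgue)) < \<infinity>}"

definition frac_sobolev0 :: "real \<Rightarrow> real \<Rightarrow> 'a::euclidean_space set \<Rightarrow> ('a \<Rightarrow> real) set" where
  "frac_sobolev0 s p \<Omega> = {v \<in> frac_sobolev s p. AE x in lebesgue. x \<notin> \<Omega> \<longrightarrow> v x = 0}"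

definition admissible_kernel :: "real \<Rightarrow> real \<Rightarrow> real \<Rightarrow> real \<Rightarrow> ('a::euclidean_space \<Rightarrow> 'a \<Rightarrow> real) \<Rightarrow> bool" where
  "admissible_kernel s p lam Lam K \<longleftrightarrow>
     (\<lambda>z. K (fst z) (snd z)) \<in> borel_measurable (lebesgue \<Otimes>\<^sub>M lebesgue)
     \<and> (\<forall>x y. 0 \<le> K x y \<and> K x y = K y x)
     \<and> (AE z in lebesgue \<Otimes>\<^sub>M lebesgue.
          lam \<le> K (fst z) (snd z) * norm (fst z - snd z) powr (real DIM('a) + s * p)
        \<and> K (fst z) (snd z) * norm (fst z - snd z) powr (real DIM('a) + s * p) \<le> Lam)"

definition weak_solution :: "real \<Rightarrow> real \<Rightarrow> ('a::euclidean_space \<Rightarrow> 'a \<Rightarrow> real) \<Rightarrow> 'a set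
    \<Rightarrow> ('a \<Rightarrow> real) \<Rightarrow> ('a \<Rightarrow> real) \<Rightarrow> bool" where
  "weak_solution s p K \<Omega> g u \<longleftrightarrow>
     u \<in> frac_sobolev s p \<and> (\<lambda>x. u x - g x) \<in> frac_sobolev0 s p \<Omega>
     \<and> (\<forall>\<eta> \<in> frac_sobolev0 s p \<Omega>.
          (\<integral>z. K (fst z) (snd z) * \<bar>u (fst z) - u (snd z)\<bar> powr (p - 2)
               * (u (fst z) - u (snd z)) * (\<eta> (fst z) - \<eta> (snd z)) \<partial>(lebesgue \<Otimes>\<^sub>M lebesgue)) = 0)"

definition tail :: "real \<Rightarrow> real \<Rightarrow> ('a::euclidean_space \<Rightarrow> real) \<Rightarrow> 'a \<Rightarrow> real \<Rightarrow> real" where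
  "tail s p v x0 R = (R powr (s * p) *
      (\<integral>x\<in>(UNIV - ball x0 R). \<bar>v x\<bar> powr (p - 1) * norm (x - x0) powr (- real DIM('a) - s * p) \<partial>lebesgue))
      powr (1 / (p - 1))"

definition ess_osc :: "('a::euclidean_space \<Rightarrow> real) \<Rightarrow> 'a set \<Rightarrow> ereal" where
  "ess_osc u B = esssup (restrict_space lebesgue B) (\<lambda>x. ereal (u x))
               - (- esssup (restrict_space lebesgue B) (\<lambda>x. - ereal (u x)))"

definition locally_holder_on :: "'a::euclidean_space set \<Rightarrow> real \<Rightarrow> ('a \<Rightarrow> real) \<Rightarrow> bool" where
  "locally_holder_on \<Omega> \<alpha> v \<longleftrightarrow> (\<forall>C. compact C \<and> C \<subseteq> \<Omega> \<longrightarrow>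
      (\<exists>M. \<forall>x\<in>C. \<forall>y\<in>C. \<bar>v x - v y\<bar> \<le> M * norm (x - y) powr \<alpha>))"

end

theory Submission
  imports Defs
begin

text \<open>
  The proof is a De Giorgi iteration in which nonlocality replaces the two hard tools of the local
  theory.  Testing the equation with \<open>v\<^sub>+ \<phi>\<^sup>p\<close> gives a Caccioppoli inequality whose left-hand side contains
  the interaction of \<open>{v > 0}\<close> with \<open>{v \<le> 0}\<close>, and this single term is used twice.

  First, every point interacts with the complement of a set \<open>A\<close> with strength at least a multiple of
  \<open>|A| powr (- s p / n)\<close>, so the term dominates \<open>|{v > 0}| powr (- s p / n)\<close> times the integral of
  \<open>v\<^sub>+ powr p\<close>.  This is the gain that drives the iteration over levels, without a Sobolev embedding and
  without any relation between \<open>s p\<close> and \<open>n\<close>.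

  Second, if \<open>z \<ge> 0\<close> in a ball and \<open>z \<ge> 1\<close> on half of it, then for \<open>v = k - z\<close> the term controls the
  integral of \<open>(k - z)\<^sub>+\<close> itself by a multiple of \<open>k powr p\<close>, a higher power of \<open>k\<close>, so for small \<open>k\<close> the
  smallness hypothesis of the first step holds and \<open>z\<close> is bounded below in a smaller ball.  This replaces
  the logarithmic estimate and yields geometric decay of the oscillation on the balls of radius
  \<open>r / 4 ^ j\<close>; the tail of the rescaled solutions stays small because the decay exponent is chosen small.
\<close>

section \<open>Radial kernels\<close>

text \<open>By Chebyshev the measure in the gain factor is itself bounded by the integral being
  iterated, so the recursion over levels is superlinear with exponent \<open>1 + s * p / n\<close>.
  The higher power of k comes from the size of the jump. For \<open>u = 2 - 2 / k * z\<close>, a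
  multiple of \<open>k - z\<close>, one has \<open>u \<le> 2\<close> in the ball and
  \<open>u \<le> - (1 / k)\<close> where \<open>z \<ge> 1\<close>. Hence
  \<open>(u x - u y) powr (p - 1)\<close> is at least \<open>k powr (1 - p)\<close>, against an
  upper bound for the energy that is free of k. That upper bound contains the tail of u, in which
  the negative part of z is magnified by a multiple of \<open>k powr (1 - p)\<close>; admitting only
  tails of z of size \<open>k powr (p - 1)\<close> cancels this, so the threshold can be fixed
  before k. The same tail condition has to be recovered at every scale. Seen from a small ball, the
  earlier intervals exceed the current one by a factor \<open>t powr \<alpha> - 1\<close>, with t
  the relative distance. This is a small multiple of \<open>t powr \<beta>\<close> when \<alpha> is
  small, and half of the decay of the kernel is spent on integrating that power; this limits
  \<alpha>.\<close>

lemma sigma_finite_lebesgue: "sigma_finite_measure (lebesgue :: 'a::euclidean_space measure)"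
proof
  let ?A = "range (\<lambda>n::nat. ball (0::'a) (real n))"
  have "\<Union>?A = UNIV"
    using reals_Archimedean2 by fastforce
  then have "countable ?A \<and> ?A \<subseteq> sets lebesgue \<and> \<Union>?A = space lebesgue
      \<and> (\<forall>a\<in>?A. emeasure lebesgue a \<noteq> \<infinity>)"
    by (auto simp: emeasure_ball)
  then show "\<exists>A::'a set set. countable A \<and> A \<subseteq> sets lebesgue \<and> \<Union> A = space lebesgue
      \<and> (\<forall>a\<in>A. emeasure lebesgue a \<noteq> \<infinity>)"
    by blast
qed

interpretation lebesgue: sigma_finite_measure "lebesgue :: 'a::euclidean_space measure"
  by (rule sigma_finite_lebesgue)

interpretation lebesgue_pair: pair_sigma_finite "lebesgue :: 'a::euclidean_space measure"
  "lebesgue :: 'b::euclidean_space measure" ..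

lemma measurable_ident_lebesgue [measurable (raw)]: "(\<lambda>x. x) \<in> borel_measurable lebesgue"
  by (rule measurable_completion) simp

lemma sets_lebesgue_ball [measurable]: "ball c r \<in> sets lebesgue"
  by auto

text \<open>The product of two completed measures, as in the definitions, rather than the completion
  of a product; the sigma-finite interpretations above give Fubini for it.\<close>

abbreviation lebesgue2 :: "('a::euclidean_space \<times> 'a) measure" where
  "lebesgue2 \<equiv> lebesgue \<Otimes>\<^sub>M lebesgue"

abbreviation ball_int :: "('a::euclidean_space \<Rightarrow> real) \<Rightarrow> 'a \<Rightarrow> real \<Rightarrow> ennreal" where
  "ball_int f c R \<equiv> \<integral>\<^sup>+ x. ennreal (f x) * indicator (ball c R) x \<partial>lebesgue"

abbreviation far_int :: "('a::euclidean_space \<Rightarrow> real) \<Rightarrow> 'a \<Rightarrow> real \<Rightarrow> ennreal" where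
  "far_int f c R \<equiv> \<integral>\<^sup>+ x. ennreal (f x) * indicator (- ball c R) x \<partial>lebesgue"

lemma nn_integral_on_le:
  assumes int: "(\<integral>\<^sup>+ x. ennreal (g x) * indicator S x \<partial>M) \<le> ennreal t"
    and c: "0 \<le> c" and [measurable]: "g \<in> borel_measurable M" "S \<in> sets M"
    and le: "AE x in M. x \<in> S \<longrightarrow> f x \<le> c * g x"
  shows "(\<integral>\<^sup>+ x. ennreal (f x) * indicator S x \<partial>M) \<le> ennreal (c * t)"
proof -
  have "(\<integral>\<^sup>+ x. ennreal (f x) * indicator S x \<partial>M) \<le> (\<integral>\<^sup>+ x. ennreal c * (ennreal (g x) * indicator S x) \<partial>M)"
    using le by (intro nn_integral_mono_AE)
      (auto elim!: eventually_mono simp: indicator_def ennreal_mult'[OF c, symmetric] intro!: ennreal_leI)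
  also have "\<dots> = ennreal c * (\<integral>\<^sup>+ x. ennreal (g x) * indicator S x \<partial>M)"
    by (rule nn_integral_cmult) measurable
  also have "\<dots> \<le> ennreal c * ennreal t" by (intro mult_left_mono int) simp
  finally show ?thesis by (simp add: ennreal_mult'[OF c])
qed

text \<open>For \<open>a = s * p\<close> this is the model kernel to which every admissible kernel
  is comparable. The order is a parameter because \<open>s * p / 2\<close> and the negative order
  \<open>-(p - s * p)\<close> also occur. At the origin \<open>powr\<close> returns 0 instead of
  blowing up, so lower bounds must avoid that point.\<close>

definition rker :: "real \<Rightarrow> 'a::euclidean_space \<Rightarrow> real" where
  "rker a z = norm z powr (- (real DIM('a) + a))"

lemma rker_nonneg [simp]: "0 \<le> rker a z"
  by (simp add: rker_def)

lemma rker_minus_commute: "rker a (x - y) = rker a (y - x)"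
  by (simp add: rker_def norm_minus_commute)

lemma rker_measurable [measurable]: "rker a \<in> borel_measurable borel"
  unfolding rker_def by measurable

lemma rker_antimono:
  assumes "0 < t" "t \<le> norm z" "0 \<le> a"
  shows "rker a (z::'a::euclidean_space) \<le> t powr (- (real DIM('a) + a))"
  unfolding rker_def using assms by (intro powr_mono2') auto

lemma rker_mono_lower:
  assumes "0 < norm z" "norm z \<le> t" "0 \<le> a"
  shows "t powr (- (real DIM('a) + a)) \<le> rker a (z::'a::euclidean_space)"
  unfolding rker_def using assms by (intro powr_mono2') auto

lemma dyadic_above:
  fixes t :: real
  assumes "1 \<le> t"
  obtains j :: nat where "2 ^ j \<le> t" "t < 2 ^ (j + 1)"
proof -
  define j where "j = nat \<lfloor>log 2 t\<rfloor>"
  have l: "0 \<le> log 2 t" using assms by simp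
  then have "real j \<le> log 2 t" "log 2 t < real j + 1"
    unfolding j_def by linarith+
  then have "2 powr real j \<le> t" "t < 2 powr (real j + 1)"
    using assms by (simp_all add: le_log_iff log_less_iff)
  then show ?thesis
    by (intro that[of j]) (simp_all add: powr_realpow powr_add)
qed

text \<open>Every point of the support only has to lie in one ball with a suitable height. Adding up
  all balls overcounts, but height times volume is geometric with ratio \<open>q\<close>, so the
  loss is harmless and the shells need not be disjoint.\<close>

lemma nn_integral_dyadic_bound:
  fixes f :: "'a::euclidean_space \<Rightarrow> ennreal" and q c :: real
  assumes cover: "\<And>y. f y \<noteq> 0 \<Longrightarrow> \<exists>j. y \<in> ball z (R j) \<and> f y \<le> ennreal (h j)"
    and R: "\<And>j. 0 \<le> R j" and h: "\<And>j. 0 \<le> h j"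
    and geo: "\<And>j. h j * R j ^ DIM('a) = c * q ^ j" and q: "0 < q" "q < 1" and c: "0 \<le> c"
  shows "(\<integral>\<^sup>+ y. f y \<partial>lebesgue) \<le> ennreal (unit_ball_vol (real DIM('a)) * c / (1 - q))"
proof -
  let ?w = "unit_ball_vol (real DIM('a))"
  have "(\<integral>\<^sup>+ y. f y \<partial>lebesgue) \<le> (\<integral>\<^sup>+ y. (\<Sum>j. ennreal (h j) * indicator (ball z (R j)) y) \<partial>lebesgue)"
  proof (rule nn_integral_mono)
    fix y
    show "f y \<le> (\<Sum>j. ennreal (h j) * indicator (ball z (R j)) y)"
    proof (cases "f y = 0")
      case False
      then obtain j where j: "y \<in> ball z (R j)" "f y \<le> ennreal (h j)"
        using cover by blast
      have "f y \<le> (\<Sum>i\<in>{j}. ennreal (h i) * indicator (ball z (R i)) y)"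
        using j by simp
      also have "\<dots> \<le> (\<Sum>j. ennreal (h j) * indicator (ball z (R j)) y)"
        by (intro sum_le_suminf) auto
      finally show ?thesis .
    qed simp
  qed
  also have "\<dots> = (\<Sum>j. ennreal (h j) * emeasure lebesgue (ball z (R j)))"
    by (subst nn_integral_suminf) (simp_all add: nn_integral_cmult_indicator)
  also have "\<dots> = (\<Sum>j. ennreal (?w * c * q ^ j))"
  proof (rule suminf_cong)
    fix j
    show "ennreal (h j) * emeasure lebesgue (ball z (R j)) = ennreal (?w * c * q ^ j)"
      using geo[of j] R[of j] h[of j]
      by (simp add: emeasure_ball ennreal_mult'[symmetric] mult.assoc mult.left_commute[of "h j"])
  qed
  also have "\<dots> = ennreal (\<Sum>j. ?w * c * q ^ j)"
    using q c by (intro suminf_ennreal2 summable_mult summable_geometric) auto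
  also have "(\<Sum>j. ?w * c * q ^ j) = ?w * c / (1 - q)"
    using q by (subst suminf_mult) (auto simp: suminf_geometric summable_geometric)
  finally show ?thesis .
qed

text \<open>Doubling the radius multiplies the volume by \<open>2 ^ n\<close> and the kernel by
  \<open>2 powr (-(n + a))\<close>, which leaves the ratio \<open>2 powr (-a)\<close> per shell. The
  constant is chosen before the centre and the radius, and all later constants inherit this
  uniformity.\<close>

lemma rker_integral_far:
  fixes a :: real
  assumes a: "0 < a"
  shows "\<exists>C>0. \<forall>(x0::'a::euclidean_space) r. 0 < r \<longrightarrow>
    far_int (\<lambda>y. rker a (y - x0)) x0 r \<le> ennreal (C * r powr (-a))"
proof -
  let ?n = "DIM('a)"
  let ?C = "unit_ball_vol (real ?n) * 2 ^ ?n / (1 - 2 powr (-a))"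
  have q: "0 < 2 powr (-a)" "2 powr (-a) < (1::real)" using a by (simp_all add: powr_less_one)
  have "far_int (\<lambda>y. rker a (y - x0)) x0 r \<le> ennreal (?C * r powr (-a))"
    if r: "0 < r" for x0 :: 'a and r
  proof -
    have "far_int (\<lambda>y. rker a (y - x0)) x0 r
      \<le> ennreal (unit_ball_vol (real ?n) * (2 ^ ?n * r powr (-a)) / (1 - 2 powr (-a)))"
    proof (rule nn_integral_dyadic_bound[where R = "\<lambda>j. 2 ^ (j+1) * r" and z = x0
          and h = "\<lambda>j. (2 ^ j * r) powr (- (real ?n + a))"])
      fix y assume "ennreal (rker a (y - x0)) * indicator (- ball x0 r) y \<noteq> 0"
      then have y: "r \<le> norm (y - x0)"
        by (auto simp: indicator_def dist_norm norm_minus_commute split: if_splits)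
      then have "1 \<le> norm (y - x0) / r" using r by simp
      then obtain j where j: "2 ^ j \<le> norm (y - x0) / r" "norm (y - x0) / r < 2 ^ (j + 1)"
        using dyadic_above by blast
      have "y \<in> ball x0 (2 ^ (j+1) * r)"
        using j(2) r by (simp add: dist_norm norm_minus_commute field_simps)
      moreover have "rker a (y - x0) \<le> (2 ^ j * r) powr (- (real ?n + a))"
        using j r a by (intro rker_antimono) (auto simp: field_simps)
      ultimately show "\<exists>j. y \<in> ball x0 (2 ^ (j+1) * r) \<and> ennreal (rker a (y - x0)) * indicator (- ball x0 r) y
          \<le> ennreal ((2 ^ j * r) powr (- (real ?n + a)))"
        by (intro exI[of _ j]) (auto simp: indicator_def intro: ennreal_leI)
    next
      fix j
      have "(2 ^ j * r) powr (- (real ?n + a)) * (2 ^ (j + 1) * r) ^ ?n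
         = (2 powr j * r) powr (- (real ?n + a)) * (2 * (2 powr j * r)) powr ?n"
        using r by (simp add: powr_realpow mult.assoc)
      also have "\<dots> = 2 powr ?n * ((2 powr j * r) powr (- (real ?n + a)) * (2 powr j * r) powr ?n)"
        using r by (subst powr_mult) (auto)
      also have "(2 powr j * r) powr (- (real ?n + a)) * (2 powr j * r) powr ?n = (2 powr j * r) powr (-a)"
        by (subst powr_add[symmetric]) simp
      also have "\<dots> = r powr (-a) * (2 powr (-a)) ^ j"
        using r by (subst powr_mult) (auto simp: powr_powr powr_power mult.commute)
      finally show "(2 ^ j * r) powr (- (real ?n + a)) * (2 ^ (j + 1) * r) ^ ?n
         = 2 ^ ?n * r powr (-a) * (2 powr (-a)) ^ j"
        by (simp add: powr_realpow)
    qed (use r q in auto)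
    then show ?thesis by (simp add: algebra_simps)
  qed
  moreover have "0 < ?C" using q by simp
  ultimately show ?thesis by blast
qed

text \<open>The shells shrink towards the singularity and contribute with ratio
  \<open>2 powr (-b)\<close>; positivity of \<open>b\<close> is exactly integrability at the
  origin.\<close>

lemma rker_integral_near:
  fixes b :: real
  assumes b: "0 < b"
  shows "\<exists>C>0. \<forall>(x0::'a::euclidean_space) r. 0 < r \<longrightarrow>
    ball_int (\<lambda>y. rker (-b) (y - x0)) x0 r \<le> ennreal (C * r powr b)"
proof -
  let ?n = "DIM('a)"
  let ?C = "unit_ball_vol (real ?n) * 2 ^ ?n / (1 - 2 powr (-b))"
  have q: "0 < 2 powr (-b)" "2 powr (-b) < (1::real)" using b by (simp_all add: powr_less_one)
  have "ball_int (\<lambda>y. rker (-b) (y - x0)) x0 r \<le> ennreal (?C * r powr b)"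
    if r: "0 < r" for x0 :: 'a and r
  proof -
    have "ball_int (\<lambda>y. rker (-b) (y - x0)) x0 r
      \<le> ennreal (unit_ball_vol (real ?n) * (2 ^ ?n * r powr b) / (1 - 2 powr (-b)))"
    proof (rule nn_integral_dyadic_bound[where R = "\<lambda>j. 2 * (r / 2 ^ (j+1))" and z = x0
          and h = "\<lambda>j. (r / 2 ^ (j+1)) powr (- real ?n) * (r / 2 ^ j) powr b"])
      fix y assume "ennreal (rker (-b) (y - x0)) * indicator (ball x0 r) y \<noteq> 0"
      then have y: "norm (y - x0) < r" "y \<noteq> x0"
        by (auto simp: indicator_def dist_norm norm_minus_commute rker_def split: if_splits)
      then have "1 \<le> r / norm (y - x0)" using r by simp
      then obtain j where j: "2 ^ j \<le> r / norm (y - x0)" "r / norm (y - x0) < 2 ^ (j + 1)"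
        using dyadic_above by blast
      \<comment> \<open>The total exponent \<open>b - n\<close> may have either sign. Splitting it
        allows the two factors to be bounded at opposite ends of the shell.\<close>
      have "rker (-b) (y - x0) = norm (y - x0) powr (- real ?n) * norm (y - x0) powr b"
        by (simp add: rker_def powr_add[symmetric])
      also have "\<dots> \<le> (r / 2 ^ (j+1)) powr (- real ?n) * (r / 2 ^ j) powr b"
        using j r b y by (intro mult_mono powr_mono2 powr_mono2') (auto simp: field_simps)
      finally have 1: "rker (-b) (y - x0) \<le> (r / 2 ^ (j+1)) powr (- real ?n) * (r / 2 ^ j) powr b" .
      show "\<exists>j. y \<in> ball x0 (2 * (r / 2 ^ (j+1))) \<and> ennreal (rker (-b) (y - x0)) * indicator (ball x0 r) y
          \<le> ennreal ((r / 2 ^ (j+1)) powr (- real ?n) * (r / 2 ^ j) powr b)"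
      \<comment> \<open>\<open>dyadic_above\<close> permits equality at the outer radius, whereas
        the covering balls are open. A point on that sphere is moved to the preceding ball, which
        exists because \<open>norm (y - x0) < r\<close> forces \<open>j\<close> to be
        positive.\<close>
      proof (cases "norm (y - x0) = r / 2 ^ j")
        case False
        then have "norm (y - x0) < r / 2 ^ j" using j(1) y r by (auto simp: field_simps)
        then show ?thesis
          using 1 by (intro exI[of _ j]) (auto simp: indicator_def dist_norm norm_minus_commute intro: ennreal_leI)
      next
        case True
        then obtain i where i: "j = Suc i" using y by (cases j) auto
        have "rker (-b) (y - x0) = norm (y - x0) powr (- real ?n) * norm (y - x0) powr b"
          by (simp add: rker_def powr_add[symmetric])
        also have "\<dots> \<le> (r / 2 ^ (i+1)) powr (- real ?n) * (r / 2 ^ i) powr b"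
          using r b unfolding True i Suc_eq_plus1 by (intro mult_left_mono powr_mono2) (auto simp: divide_simps)
        finally have 2: "rker (-b) (y - x0) \<le> (r / 2 ^ (i+1)) powr (- real ?n) * (r / 2 ^ i) powr b" .
        have "norm (y - x0) < 2 * (r / 2 ^ (i+1))" using r unfolding True i by (simp add: divide_simps)
        then have "y \<in> ball x0 (2 * (r / 2 ^ (i+1)))"
          by (simp only: mem_ball dist_norm norm_minus_commute[of x0 y])
        with 2 show ?thesis
          by (intro exI[of _ i] conjI) (auto simp: indicator_def intro: ennreal_leI)
      qed
    next
      fix j
      let ?t = "r / 2 ^ (j+1)"
      have t: "0 < ?t" using r by simp
      have 1: "(2 * ?t) ^ ?n = 2 ^ ?n * ?t powr ?n"
        using t by (simp only: powr_realpow power_mult_distrib)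
      have 2: "?t powr (- real ?n) * ?t powr ?n = 1"
        using r t by (subst powr_add[symmetric]) simp
      have 3: "(r / 2 ^ j) powr b = r powr b * (2 powr (-b)) ^ j"
        using r by (simp add: powr_divide powr_realpow[symmetric] powr_powr powr_power powr_minus field_simps)
      have "?t powr (- real ?n) * (r / 2 ^ j) powr b * (2 * ?t) ^ ?n
         = (?t powr (- real ?n) * ?t powr ?n) * (2 ^ ?n * (r / 2 ^ j) powr b)"
        unfolding 1 by (simp only: ac_simps)
      then show "?t powr (- real ?n) * (r / 2 ^ j) powr b * (2 * ?t) ^ ?n
         = 2 ^ ?n * r powr b * (2 powr (-b)) ^ j"
        unfolding 2 3 by (simp only: mult_1_left mult.assoc)
    qed (use r q in auto)
    then show ?thesis by (simp add: algebra_simps)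
  qed
  moreover have "0 < ?C" using q by simp
  ultimately show ?thesis by blast
qed

text \<open>Within distance \<open>d\<close> the Lipschitz factor turns the kernel into one of order
  \<open>-(p - s * p)\<close>, integrable at the origin because \<open>s < 1\<close>; beyond
  distance \<open>d\<close> the kernel alone is integrable. Both parts scale like
  \<open>d powr (-(s * p))\<close>.\<close>

lemma cutoff_integral:
  fixes s p :: real
  assumes "0 < s" "s < 1" "1 < p"
  shows "\<exists>C>0. \<forall>(x::'a::euclidean_space) d. 0 < d \<longrightarrow>
    (\<integral>\<^sup>+ y. ennreal (min 1 (norm (x - y) / d) powr p * rker (s * p) (x - y)) \<partial>lebesgue)
      \<le> ennreal (C * d powr (- (s * p)))"
proof -
  have sp: "0 < s * p" using assms by simp
  have b: "0 < p - s * p" using assms by simp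
  obtain C1 where C1: "C1 > 0" "\<And>(x0::'a) r. 0 < r \<Longrightarrow>
    far_int (\<lambda>y. rker (s * p) (y - x0)) x0 r \<le> ennreal (C1 * r powr (-(s * p)))"
    using rker_integral_far[OF sp] by blast
  obtain C2 where C2: "C2 > 0" "\<And>(x0::'a) r. 0 < r \<Longrightarrow>
    ball_int (\<lambda>y. rker (-(p - s*p)) (y - x0)) x0 r \<le> ennreal (C2 * r powr (p - s * p))"
    using rker_integral_near[OF b] by blast
  have "(\<integral>\<^sup>+ y. ennreal (min 1 (norm (x - y) / d) powr p * rker (s * p) (x - y)) \<partial>lebesgue)
      \<le> ennreal ((C1 + C2) * d powr (- (s * p)))" if d: "0 < d" for x :: 'a and d
  proof -
    have "ennreal (min 1 (norm (x - y) / d) powr p * rker (s * p) (x - y)) \<le>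
      ennreal (rker (s * p) (y - x)) * indicator (- ball x d) y
      + ennreal (d powr (-p)) * (ennreal (rker (-(p - s*p)) (y - x)) * indicator (ball x d) y)" for y
    proof (cases "y \<in> ball x d")
      case True
      have "min 1 (norm (x - y) / d) powr p * rker (s * p) (x - y)
         \<le> (norm (x - y) / d) powr p * rker (s * p) (x - y)"
        using d assms by (intro mult_right_mono powr_mono2) auto
      also have "\<dots> = d powr (-p) * rker (-(p - s*p)) (y - x)"
        using d by (simp add: rker_def powr_divide powr_minus_divide[of d] powr_add[symmetric] norm_minus_commute)
          (simp add: algebra_simps)
      finally show ?thesis using True
        by (simp add: ennreal_mult'[symmetric] ennreal_leI)
    next
      case False
      have "min 1 (norm (x - y) / d) powr p * rker (s * p) (x - y) \<le> 1 * rker (s * p) (y - x)"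
        unfolding rker_minus_commute[of _ x y] using d assms
        by (intro mult_right_mono powr_le1) auto
      then show ?thesis using False by (simp add: ennreal_leI)
    qed
    then have "(\<integral>\<^sup>+ y. ennreal (min 1 (norm (x - y) / d) powr p * rker (s * p) (x - y)) \<partial>lebesgue)
       \<le> (\<integral>\<^sup>+ y. ennreal (rker (s * p) (y - x)) * indicator (- ball x d) y
      + ennreal (d powr (-p)) * (ennreal (rker (-(p - s*p)) (y - x)) * indicator (ball x d) y) \<partial>lebesgue)"
      by (intro nn_integral_mono)
    also have "\<dots> = far_int (\<lambda>y. rker (s * p) (y - x)) x d
      + ennreal (d powr (-p)) * ball_int (\<lambda>y. rker (-(p - s*p)) (y - x)) x d"
      by (subst nn_integral_add) (auto simp: nn_integral_cmult)
    also have "\<dots> \<le> ennreal (C1 * d powr (-(s * p))) + ennreal (d powr (-p)) * ennreal (C2 * d powr (p - s * p))"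
      by (intro add_mono mult_left_mono C1 C2 d) simp
    also have "\<dots> = ennreal (C1 * d powr (-(s * p)) + C2 * (d powr (-p) * d powr (p - s * p)))"
      using C1 C2 by (simp add: ennreal_mult'[symmetric] ennreal_plus[symmetric] mult.left_commute del: ennreal_plus)
    also have "d powr (-p) * d powr (p - s * p) = d powr (-(s * p))"
      by (subst powr_add[symmetric]) simp
    finally show ?thesis by (simp add: algebra_simps)
  qed
  then show ?thesis using C1(1) C2(1) by (intro exI[of _ "C1 + C2"]) auto
qed

section \<open>Pointwise inequalities\<close>

lemma fst_borel_lebesgue [measurable]: "fst \<in> borel_measurable (lebesgue \<Otimes>\<^sub>M M)"
  by (rule measurable_compose[OF measurable_fst measurable_ident_lebesgue])

lemma snd_borel_lebesgue [measurable]: "snd \<in> borel_measurable (M \<Otimes>\<^sub>M lebesgue)"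
  by (rule measurable_compose[OF measurable_snd measurable_ident_lebesgue])

lemma nn_integral_pair_swap:
  fixes f :: "'a::euclidean_space \<times> 'a \<Rightarrow> ennreal"
  assumes [measurable]: "f \<in> borel_measurable lebesgue2"
  shows "(\<integral>\<^sup>+ z. f (snd z, fst z) \<partial>lebesgue2) = (\<integral>\<^sup>+ z. f z \<partial>lebesgue2)"
  by (subst (2) lebesgue_pair.distr_pair_swap, subst nn_integral_distr)
    (auto simp: case_prod_beta)

section \<open>Elementary inequalities for real powers\<close>

lemma powr_add_le:
  fixes a b q :: real
  assumes "0 \<le> a" "0 \<le> b" "0 \<le> q"
  shows "(a + b) powr q \<le> 2 powr q * (a powr q + b powr q)"
proof -
  have "(a + b) powr q \<le> (2 * max a b) powr q" using assms by (intro powr_mono2) auto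
  also have "\<dots> = 2 powr q * max a b powr q" using assms by (simp add: powr_mult)
  also have "\<dots> \<le> 2 powr q * (a powr q + b powr q)" by (intro mult_left_mono) (auto simp: max_def)
  finally show ?thesis .
qed

lemma powr_add3_le:
  fixes a b c q :: real
  assumes "0 \<le> a" "0 \<le> b" "0 \<le> c" "0 \<le> q"
  shows "(a + b + c) powr q \<le> 3 powr q * (a powr q + b powr q + c powr q)"
proof -
  have "(a + b + c) powr q \<le> (3 * max a (max b c)) powr q" using assms by (intro powr_mono2) auto
  also have "\<dots> = 3 powr q * max a (max b c) powr q" using assms by (simp add: powr_mult)
  also have "\<dots> \<le> 3 powr q * (a powr q + b powr q + c powr q)" by (intro mult_left_mono) (auto simp: max_def)
  finally show ?thesis .
qed

lemma powr_diff_le: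
  fixes a b p :: real
  assumes "0 \<le> a" "a \<le> b" "1 < p"
  shows "b powr p - a powr p \<le> p * b powr (p - 1) * (b - a)"
proof (cases "a = b \<or> b = 0")
  case False
  then have ab: "a < b" "0 < b" using assms by auto
  show ?thesis
  \<comment> \<open>The mean value theorem is used with a derivative on the whole closed interval,
    so a left endpoint at 0 is treated directly.\<close>
  proof (cases "a = 0")
    case True
    then show ?thesis using ab assms by (simp add: powr_mult_base mult.assoc mult.commute[of "b powr _"])
  next
    case False
    then have a: "0 < a" using assms by simp
    have "\<exists>z. a < z \<and> z < b \<and> b powr p - a powr p = (b - a) * (p * z powr (p - 1))"
      using a by (intro MVT2[OF ab(1)]) (auto intro!: derivative_eq_intros)
    then obtain z where z: "a < z" "z < b" "b powr p - a powr p = (b - a) * (p * z powr (p - 1))"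
      by blast
    have "(b - a) * (p * z powr (p - 1)) \<le> (b - a) * (p * b powr (p - 1))"
      using z a ab assms by (intro mult_left_mono powr_mono2) auto
    then show ?thesis using z by (simp add: algebra_simps)
  qed
qed (use assms in auto)

lemma powr_diff_abs_le:
  fixes a b p :: real
  assumes "0 \<le> a" "a \<le> 1" "0 \<le> b" "b \<le> 1" "1 < p"
  shows "\<bar>a powr p - b powr p\<bar> \<le> p * \<bar>a - b\<bar>"
proof -
  have *: "\<bar>a powr p - b powr p\<bar> \<le> p * \<bar>a - b\<bar>"
    if "0 \<le> a" "a \<le> b" "b \<le> 1" for a b :: real
  proof -
    have "b powr p - a powr p \<le> p * b powr (p - 1) * (b - a)"
      using that assms by (intro powr_diff_le) auto
    also have "\<dots> \<le> p * 1 * (b - a)"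
      using that assms by (intro mult_right_mono mult_left_mono powr_le1) auto
    moreover have "a powr p \<le> b powr p" using that assms by (intro powr_mono2) auto
    ultimately show ?thesis using that by simp
  qed
  show ?thesis using *[of a b] *[of b a] assms by (cases "a \<le> b") (auto simp: abs_minus_commute)
qed

lemma max_powr_le: "0 \<le> q \<Longrightarrow> max 0 a powr q \<le> \<bar>a::real\<bar> powr q"
  by (intro powr_mono2) auto

text \<open>The pointwise inequalities behind the Caccioppoli estimate; \<open>a\<close>, \<open>b\<close> are the values of the
  solution and \<open>\<phi>\<close>, \<open>\<psi>\<close> those of the cutoff function at the two points.\<close>

lemma caccioppoli_ordered:
  fixes a b p \<phi> \<psi> :: real
  assumes p: "1 < p" and ab: "0 < b" "b \<le> a" and f: "0 \<le> \<phi>" "0 \<le> \<psi>"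
  shows "- ((p * a * \<bar>\<phi> - \<psi>\<bar>) powr p) \<le> (a - b) powr (p - 1) * (a * \<phi> powr p - b * \<psi> powr p)"
proof (cases "\<psi> \<le> \<phi>")
  case True
  then have "b * \<psi> powr p \<le> a * \<phi> powr p"
    using assms by (intro mult_mono powr_mono2) auto
  then have "0 \<le> (a - b) powr (p - 1) * (a * \<phi> powr p - b * \<psi> powr p)" by simp
  moreover have "0 \<le> (p * a * \<bar>\<phi> - \<psi>\<bar>) powr p" by simp
  ultimately show ?thesis by linarith
next
  case False
  \<comment> \<open>\<open>D\<close> carries the jump of the solution and \<open>e\<close> the jump
    of the cutoff. The bracket is at least \<open>\<psi> powr (p - 1) * (D - e)\<close>, and
    \<open>D powr (p - 1) * (D - e)\<close> is negative only for \<open>D < e\<close>, where it is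
    no less than \<open>- (e powr p)\<close>.\<close>
  define e where "e = p * a * (\<psi> - \<phi>)"
  define D where "D = (a - b) * \<psi>"
  have e0: "0 < e" using False assms by (simp add: e_def)
  have D0: "0 \<le> D" using assms by (simp add: D_def)
  have pp: "x powr p = x powr (p - 1) * x" if "0 \<le> x" for x :: real
    using that by (simp add: powr_mult_base mult.commute)
  have "a * \<phi> powr p - b * \<psi> powr p = (a - b) * \<psi> powr p - a * (\<psi> powr p - \<phi> powr p)"
    by (simp add: algebra_simps)
  also have "\<dots> \<ge> (a - b) * \<psi> powr p - a * (p * \<psi> powr (p - 1) * (\<psi> - \<phi>))"
    using False assms by (intro diff_left_mono mult_left_mono powr_diff_le) auto
  also have "(a - b) * \<psi> powr p - a * (p * \<psi> powr (p - 1) * (\<psi> - \<phi>)) = \<psi> powr (p - 1) * (D - e)"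
    using assms by (simp add: pp e_def D_def algebra_simps)
  finally have "(a - b) powr (p - 1) * (\<psi> powr (p - 1) * (D - e))
      \<le> (a - b) powr (p - 1) * (a * \<phi> powr p - b * \<psi> powr p)"
    by (intro mult_left_mono) auto
  moreover have "(a - b) powr (p - 1) * (\<psi> powr (p - 1) * (D - e)) = D powr (p - 1) * (D - e)"
    using assms by (simp add: D_def powr_mult)
  moreover have "- (e powr p) \<le> D powr (p - 1) * (D - e)"
  proof (cases "e \<le> D")
    case True
    then have "0 \<le> D powr (p - 1) * (D - e)" by simp
    moreover have "0 \<le> e powr p" by simp
    ultimately show ?thesis by linarith
  next
    case False
    have "D powr (p - 1) * (e - D) \<le> e powr (p - 1) * e"
      using False D0 p by (intro mult_mono powr_mono2) auto
    then show ?thesis using e0 by (simp add: pp[of e] algebra_simps)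
  qed
  moreover have "p * a * \<bar>\<phi> - \<psi>\<bar> = e" using False by (simp add: e_def)
  ultimately show ?thesis by simp
qed

text \<open>At \<open>t = 0\<close> both sides vanish by the convention for \<open>powr\<close>, so
  the singular range \<open>p < 2\<close> fits the same formula.\<close>

lemma abs_powr_sign: "\<bar>t::real\<bar> powr (p - 2) * t = (if t \<ge> 0 then t powr (p - 1) else - ((- t) powr (p - 1)))"
proof -
  have "t powr (p - 1) = t powr (p - 2) * t" if "t > 0" for t :: real
    using that powr_add[of t "p - 2" 1] by simp
  from this[of t] this[of "-t"] show ?thesis by (cases "t > 0"; cases "t = 0") auto
qed

text \<open>For pairs on which the cutoff may be nonzero at either point. When
  \<open>b \<le> 0 < a\<close> the right-hand side is exactly the interaction; the mirrored sign
  pattern gives a nonnegative quantity that is dropped. Two positive values reduce to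
  \<open>caccioppoli_ordered\<close>, with the points swapped if \<open>a \<le> b\<close>.\<close>

lemma caccioppoli_near:
  fixes a b p \<phi> \<psi> :: real
  assumes p: "1 < p" and f: "0 \<le> \<phi>" "0 \<le> \<psi>"
  shows "(if b \<le> 0 then max 0 a * (a - b) powr (p - 1) * \<phi> powr p else 0)
      - p powr p * (max 0 a powr p + max 0 b powr p) * \<bar>\<phi> - \<psi>\<bar> powr p
     \<le> \<bar>a - b\<bar> powr (p - 2) * (a - b) * (max 0 a * \<phi> powr p - max 0 b * \<psi> powr p)"
proof -
  define E where "E = p powr p * (max 0 a powr p + max 0 b powr p) * \<bar>\<phi> - \<psi>\<bar> powr p"
  have E0: "0 \<le> E" by (simp add: E_def)
  consider "b \<le> 0" "a \<le> 0" | "b \<le> 0" "0 < a" | "0 < b" "a \<le> 0" | "0 < b" "b \<le> a" | "0 < a" "a \<le> b"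
    by linarith
  then have "(if b \<le> 0 then max 0 a * (a - b) powr (p - 1) * \<phi> powr p else 0) - E
     \<le> \<bar>a - b\<bar> powr (p - 2) * (a - b) * (max 0 a * \<phi> powr p - max 0 b * \<psi> powr p)"
  proof cases
    case 1 then show ?thesis using E0 by simp
  next
    case 2 then show ?thesis using E0 unfolding abs_powr_sign[of "a - b"] by simp
  next
    case 3
    have "- E \<le> 0" using E0 by simp
    also have "0 \<le> (b - a) powr (p - 1) * (b * \<psi> powr p)" using 3 by simp
    finally show ?thesis using 3 unfolding abs_powr_sign[of "a - b"] by simp
  next
    case 4
    have "(p * a * \<bar>\<phi> - \<psi>\<bar>) powr p = p powr p * a powr p * \<bar>\<phi> - \<psi>\<bar> powr p"
      using 4 p by (simp add: powr_mult)
    also have "\<dots> \<le> E" unfolding E_def using 4 by (intro mult_right_mono mult_left_mono) auto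
    finally show ?thesis
      using caccioppoli_ordered[OF p 4 f] 4 E0 unfolding abs_powr_sign[of "a - b"] by simp
  next
    case 5
    have "(p * b * \<bar>\<psi> - \<phi>\<bar>) powr p = p powr p * b powr p * \<bar>\<psi> - \<phi>\<bar> powr p"
      using 5 p by (simp add: powr_mult)
    also have "\<dots> \<le> E" unfolding E_def using 5 
      by (subst abs_minus_commute, intro mult_right_mono mult_left_mono) auto
    finally show ?thesis
      using caccioppoli_ordered[OF p 5 f(2,1)] 5 E0 unfolding abs_powr_sign[of "a - b"] by (auto simp: algebra_simps)
  qed
  then show ?thesis by (simp add: E_def)
qed

text \<open>The second point lies off the support of the cutoff. The right-hand side is negative
  only for \<open>0 < a < b\<close>, and there \<open>b - a\<close> is enlarged to \<open>b\<close>;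
  this produces the product of a local integral and a tail.\<close>

lemma caccioppoli_far:
  fixes a b p \<phi> :: real
  assumes p: "1 < p" and f: "0 \<le> \<phi>" "\<phi> \<le> 1"
  shows "(if b \<le> 0 then max 0 a * (a - b) powr (p - 1) * \<phi> powr p else 0) - max 0 a * max 0 b powr (p - 1)
     \<le> \<bar>a - b\<bar> powr (p - 2) * (a - b) * (max 0 a * \<phi> powr p)"
proof (cases "0 < a \<and> a < b")
  case True
  have "(b - a) powr (p - 1) * (a * \<phi> powr p) \<le> b powr (p - 1) * (a * 1)"
    using True assms by (intro mult_mono powr_mono2 powr_le1) auto
  then show ?thesis using True unfolding abs_powr_sign[of "a - b"] by (auto simp: algebra_simps)
next
  case False
  have "0 \<le> max 0 a * max 0 b powr (p - 1)" "0 \<le> a - b \<longrightarrow> 0 \<le> (a - b) powr (p - 1) * (max 0 a * \<phi> powr p)"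
    by simp_all
  then show ?thesis using False unfolding abs_powr_sign[of "a - b"] by (auto simp: max_def algebra_simps)
qed

section \<open>Local solutions and test functions\<close>

definition gagliardo :: "real \<Rightarrow> real \<Rightarrow> ('a::euclidean_space \<Rightarrow> real) \<Rightarrow> ennreal" where
  "gagliardo s p v = (\<integral>\<^sup>+ z. ennreal (\<bar>v (fst z) - v (snd z)\<bar> powr p * rker (s * p) (fst z - snd z))
     \<partial>lebesgue2)"

lemma frac_sobolev_gagliardo:
  "frac_sobolev s p = {u. u \<in> borel_measurable lebesgue
      \<and> integrable lebesgue (\<lambda>x. \<bar>u x\<bar> powr p) \<and> gagliardo s p (u::'a::euclidean_space \<Rightarrow> real) < \<infinity>}"
  unfolding frac_sobolev_def gagliardo_def rker_def powr_minus_divide by simp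

definition cutoff :: "'a::euclidean_space \<Rightarrow> real \<Rightarrow> real \<Rightarrow> 'a \<Rightarrow> real" where
  "cutoff c \<rho> d x = max 0 (min 1 ((\<rho> - dist c x) / d))"

lemma cutoff_nonneg: "0 \<le> cutoff c \<rho> d x" and cutoff_le_1: "cutoff c \<rho> d x \<le> 1"
  by (auto simp: cutoff_def)

lemma cutoff_eq_1: "0 < d \<Longrightarrow> x \<in> ball c (\<rho> - d) \<Longrightarrow> cutoff c \<rho> d x = 1"
  by (auto simp: cutoff_def field_simps)

lemma cutoff_eq_0: "0 < d \<Longrightarrow> x \<notin> ball c \<rho> \<Longrightarrow> cutoff c \<rho> d x = 0"
  by (auto simp: cutoff_def field_simps)

lemma cutoff_measurable [measurable]: "cutoff c \<rho> d \<in> borel_measurable lebesgue"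
  unfolding cutoff_def[abs_def] by measurable

lemma cutoff_lipschitz:
  assumes "0 < d"
  shows "\<bar>cutoff c \<rho> d x - cutoff c \<rho> d y\<bar> \<le> min 1 (norm (x - y) / d)"
proof -
  have "\<bar>cutoff c \<rho> d x - cutoff c \<rho> d y\<bar> \<le> \<bar>(\<rho> - dist c x) / d - (\<rho> - dist c y) / d\<bar>"
    by (auto simp: cutoff_def)
  also have "\<dots> = \<bar>dist c y - dist c x\<bar> / d"
    using assms by (simp add: diff_divide_distrib[symmetric])
  also have "\<dots> \<le> norm (x - y) / d"
    using assms abs_dist_diff_le[of y c x]
    by (intro divide_right_mono) (auto simp: dist_commute dist_norm)
  finally show ?thesis
    using cutoff_nonneg[of c \<rho> d x] cutoff_nonneg[of c \<rho> d y] cutoff_le_1[of c \<rho> d x] cutoff_le_1[of c \<rho> d y]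
    by auto
qed

locale frac_exponents =
  fixes s p :: real
  assumes s_pos: "0 < s" and s_less: "s < 1" and p_gt: "1 < p"
begin

abbreviation tail_int :: "('a::euclidean_space \<Rightarrow> real) \<Rightarrow> 'a \<Rightarrow> real \<Rightarrow> ennreal" where
  "tail_int f c R \<equiv> far_int (\<lambda>y. f y * rker (s * p) (y - c)) c R"

text \<open>The point \<open>y\<close> is not confined to the ball of \<open>x\<close>: in
  \<open>growth\<close> the pairs that matter have \<open>x\<close> in a half ball and
  \<open>y\<close> in the full ball.\<close>

abbreviation energy :: "('a::euclidean_space \<Rightarrow> real) \<Rightarrow> 'a \<Rightarrow> real \<Rightarrow> ennreal" where
  "energy v c r \<equiv> \<integral>\<^sup>+ x. indicator (ball c r) x *
     (\<integral>\<^sup>+ y. ennreal (max 0 (v x) * (v x - v y) powr (p - 1) * rker (s * p) (x - y))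
        * indicator {y. v y \<le> 0} y \<partial>lebesgue) \<partial>lebesgue"

lemma sp_pos: "0 < s * p"
  using s_pos p_gt by simp

text \<open>Unlike membership in the fractional Sobolev space, this notion of solution is stable under adding
  constants, which the iteration over level sets and oscillation intervals requires.\<close>

definition local_solution :: "('a::euclidean_space \<Rightarrow> 'a \<Rightarrow> real) \<Rightarrow> 'a set \<Rightarrow> ('a \<Rightarrow> real) \<Rightarrow> bool" where
  "local_solution K \<Omega> v \<longleftrightarrow> v \<in> borel_measurable lebesgue
    \<and> (\<forall>c R. (ball_int (\<lambda>x. \<bar>v x\<bar> powr p) c R) < \<infinity>)
    \<and> gagliardo s p v < \<infinity>
    \<and> (\<forall>\<eta> \<in> frac_sobolev0 s p \<Omega>.
          (\<integral>z. K (fst z) (snd z) * \<bar>v (fst z) - v (snd z)\<bar> powr (p - 2)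
               * (v (fst z) - v (snd z)) * (\<eta> (fst z) - \<eta> (snd z)) \<partial>lebesgue2) = 0)"

lemma nn_integral_powr_finite:
  assumes "u \<in> frac_sobolev s p"
  shows "(\<integral>\<^sup>+ x. ennreal (\<bar>u x\<bar> powr p) \<partial>lebesgue) < \<infinity>"
  using assms integrableD(2)[of lebesgue "\<lambda>x. \<bar>u x\<bar> powr p"]
  by (auto simp: frac_sobolev_def top.not_eq_extremum)

lemma weak_solution_local:
  assumes "weak_solution s p K \<Omega> g u"
  shows "local_solution K \<Omega> u"
proof -
  have u: "u \<in> frac_sobolev s p" using assms by (simp add: weak_solution_def)
  have "ball_int (\<lambda>x. \<bar>u x\<bar> powr p) c R < \<infinity>" for c R
    by (rule le_less_trans[OF nn_integral_mono nn_integral_powr_finite[OF u]])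
      (auto simp: indicator_def)
  then show ?thesis
    using assms by (auto simp: local_solution_def weak_solution_def frac_sobolev_gagliardo)
qed

text \<open>The equation sees only differences and is homogeneous in them, and a constant is
  p-integrable on balls. Negative \<open>a\<close> is included, which turns upper bounds into lower
  bounds.\<close>

lemma local_solution_affine:
  assumes v: "local_solution K \<Omega> v"
  shows "local_solution K \<Omega> (\<lambda>x. a * v x + b)"
proof -
  have [measurable]: "v \<in> borel_measurable lebesgue" using v by (simp add: local_solution_def)
  have "ball_int (\<lambda>x. \<bar>a * v x + b\<bar> powr p) c R < \<infinity>" for c R
  proof -
    have "ball_int (\<lambda>x. \<bar>a * v x + b\<bar> powr p) c R
       \<le> (\<integral>\<^sup>+ x. ennreal (2 powr p * \<bar>a\<bar> powr p) * (ennreal (\<bar>v x\<bar> powr p) * indicator (ball c R) x)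
           + ennreal (2 powr p * \<bar>b\<bar> powr p) * indicator (ball c R) x \<partial>lebesgue)"
    proof (rule nn_integral_mono)
      fix x
      have "\<bar>a * v x + b\<bar> powr p \<le> (\<bar>a\<bar> * \<bar>v x\<bar> + \<bar>b\<bar>) powr p"
        using p_gt by (intro powr_mono2) (auto simp: abs_mult[symmetric])
      also have "\<dots> \<le> 2 powr p * ((\<bar>a\<bar> * \<bar>v x\<bar>) powr p + \<bar>b\<bar> powr p)"
        using p_gt by (intro powr_add_le) auto
      also have "\<dots> = 2 powr p * \<bar>a\<bar> powr p * \<bar>v x\<bar> powr p + 2 powr p * \<bar>b\<bar> powr p"
        by (simp add: powr_mult algebra_simps)
      finally have "ennreal (\<bar>a * v x + b\<bar> powr p)
        \<le> ennreal (2 powr p * \<bar>a\<bar> powr p) * ennreal (\<bar>v x\<bar> powr p) + ennreal (2 powr p * \<bar>b\<bar> powr p)"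
        by (simp add: ennreal_mult'[symmetric] ennreal_plus[symmetric] ennreal_leI del: ennreal_plus)
      then show "ennreal (\<bar>a * v x + b\<bar> powr p) * indicator (ball c R) x
         \<le> ennreal (2 powr p * \<bar>a\<bar> powr p) * (ennreal (\<bar>v x\<bar> powr p) * indicator (ball c R) x)
           + ennreal (2 powr p * \<bar>b\<bar> powr p) * indicator (ball c R) x"
        by (simp add: indicator_def)
    qed
    also have "\<dots> = ennreal (2 powr p * \<bar>a\<bar> powr p) * ball_int (\<lambda>x. \<bar>v x\<bar> powr p) c R
      + ennreal (2 powr p * \<bar>b\<bar> powr p) * emeasure lebesgue (ball c R)"
      by (subst nn_integral_add) (auto simp: nn_integral_cmult nn_integral_cmult_indicator)
    also have "\<dots> < \<infinity>"
      using v by (auto simp: local_solution_def ennreal_mult_less_top emeasure_lborel_ball_finite[unfolded infinity_ennreal_def])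
    finally show ?thesis .
  qed
  moreover have "gagliardo s p (\<lambda>x. a * v x + b) = ennreal (\<bar>a\<bar> powr p) * gagliardo s p v"
    unfolding gagliardo_def
    by (subst nn_integral_cmult[symmetric])
      (auto intro!: nn_integral_cong simp: right_diff_distrib[symmetric] abs_mult powr_mult ennreal_mult' mult.assoc)
  then have "gagliardo s p (\<lambda>x. a * v x + b) < \<infinity>"
    using v by (auto simp: local_solution_def ennreal_mult_less_top)
  moreover have "(\<integral>z. K (fst z) (snd z) * \<bar>(a * v (fst z) + b) - (a * v (snd z) + b)\<bar> powr (p - 2)
               * ((a * v (fst z) + b) - (a * v (snd z) + b)) * (\<eta> (fst z) - \<eta> (snd z)) \<partial>lebesgue2) = 0"
    if "\<eta> \<in> frac_sobolev0 s p \<Omega>" for \<eta>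
  proof -
    have "K (fst z) (snd z) * \<bar>(a * v (fst z) + b) - (a * v (snd z) + b)\<bar> powr (p - 2)
               * ((a * v (fst z) + b) - (a * v (snd z) + b)) * (\<eta> (fst z) - \<eta> (snd z))
      = (\<bar>a\<bar> powr (p - 2) * a) * (K (fst z) (snd z) * \<bar>v (fst z) - v (snd z)\<bar> powr (p - 2)
               * (v (fst z) - v (snd z)) * (\<eta> (fst z) - \<eta> (snd z)))" for z
    proof -
      have "(a * v (fst z) + b) - (a * v (snd z) + b) = a * (v (fst z) - v (snd z))"
        by (simp add: algebra_simps)
      then show ?thesis by (simp only: abs_mult powr_mult abs_ge_zero ac_simps)
    qed
    then show ?thesis using v that by (simp only: local_solution_def integral_mult_right_zero)
  qed
  ultimately show ?thesis
    by (auto simp: local_solution_def)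
qed

text \<open>The bound of \<open>cutoff_integral\<close> is uniform in the first point, so by Tonelli
  the weight \<open>f\<close> factors out.\<close>

lemma cutoff_double_integral:
  "\<exists>C>0. \<forall>(f::'a::euclidean_space \<Rightarrow> ennreal) d. 0 < d \<and> f \<in> borel_measurable lebesgue \<longrightarrow>
    (\<integral>\<^sup>+ z. f (fst z) * ennreal (min 1 (norm (fst z - snd z) / d) powr p * rker (s * p) (fst z - snd z))
      \<partial>lebesgue2) \<le> ennreal (C * d powr (- (s * p))) * (\<integral>\<^sup>+ x. f x \<partial>lebesgue)"
proof -
  obtain C where C: "C > 0" "\<And>(x::'a) d. 0 < d \<Longrightarrow>
    (\<integral>\<^sup>+ y. ennreal (min 1 (norm (x - y) / d) powr p * rker (s * p) (x - y)) \<partial>lebesgue)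
      \<le> ennreal (C * d powr (- (s * p)))"
    using cutoff_integral[OF s_pos s_less p_gt] by blast
  show ?thesis
  proof (intro exI[of _ C] conjI allI impI; (elim conjE)?)
    fix f :: "'a \<Rightarrow> ennreal" and d :: real
    assume d: "0 < d" and [measurable]: "f \<in> borel_measurable lebesgue"
    have "(\<integral>\<^sup>+ z. f (fst z) * ennreal (min 1 (norm (fst z - snd z) / d) powr p * rker (s * p) (fst z - snd z))
        \<partial>lebesgue2)
      = (\<integral>\<^sup>+ x. \<integral>\<^sup>+ y. f x * ennreal (min 1 (norm (x - y) / d) powr p * rker (s * p) (x - y)) \<partial>lebesgue \<partial>lebesgue)"
      by (subst lebesgue.nn_integral_fst[symmetric]) auto
    also have "\<dots> = (\<integral>\<^sup>+ x. f x * (\<integral>\<^sup>+ y. ennreal (min 1 (norm (x - y) / d) powr p * rker (s * p) (x - y)) \<partial>lebesgue) \<partial>lebesgue)"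
      by (intro nn_integral_cong nn_integral_cmult) measurable
    also have "\<dots> \<le> (\<integral>\<^sup>+ x. f x * ennreal (C * d powr (- (s * p))) \<partial>lebesgue)"
      by (intro nn_integral_mono mult_left_mono C d) auto
    also have "\<dots> = ennreal (C * d powr (- (s * p))) * (\<integral>\<^sup>+ x. f x \<partial>lebesgue)"
      by (subst nn_integral_multc) (auto simp: mult.commute)
    finally show "(\<integral>\<^sup>+ z. f (fst z) * ennreal (min 1 (norm (fst z - snd z) / d) powr p * rker (s * p) (fst z - snd z))
      \<partial>lebesgue2) \<le> ennreal (C * d powr (- (s * p))) * (\<integral>\<^sup>+ x. f x \<partial>lebesgue)" .
  qed (fact C(1))
qed

lemma cutoff_double_integral_sym:
  fixes f :: "'a::euclidean_space \<Rightarrow> ennreal"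
  assumes [measurable]: "f \<in> borel_measurable lebesgue"
  shows "(\<integral>\<^sup>+ z. f (snd z) * ennreal (min 1 (norm (fst z - snd z) / d) powr p * rker (s * p) (fst z - snd z))
      \<partial>lebesgue2)
    = (\<integral>\<^sup>+ z. f (fst z) * ennreal (min 1 (norm (fst z - snd z) / d) powr p * rker (s * p) (fst z - snd z))
      \<partial>lebesgue2)"
  by (subst nn_integral_pair_swap[symmetric]) (auto simp: norm_minus_commute rker_minus_commute)

text \<open>Since \<open>v\<close> is only locally p-integrable, every term of the difference
  quotient in which the cutoff is differenced must involve \<open>v\<close> inside the ball alone;
  the remaining term is controlled by the finite seminorm of \<open>v\<close>.\<close>

lemma test_function:
  fixes v :: "'a::euclidean_space \<Rightarrow> real"
  assumes v: "local_solution K \<Omega> v" and d: "0 < d" and S: "ball c \<rho> \<subseteq> \<Omega>"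
  shows "(\<lambda>x. max 0 (v x) * cutoff c \<rho> d x powr p) \<in> frac_sobolev0 s p \<Omega>"
proof -
  let ?\<phi> = "cutoff c \<rho> d"
  let ?\<eta> = "\<lambda>x. max 0 (v x) * ?\<phi> x powr p"
  let ?S = "ball c \<rho>"
  define f where "f x = ennreal (\<bar>v x\<bar> powr p) * indicator ?S x" for x
  have vm[measurable]: "v \<in> borel_measurable lebesgue" using v by (simp add: local_solution_def)
  have [measurable]: "f \<in> borel_measurable lebesgue" unfolding f_def by measurable
  have fin: "(\<integral>\<^sup>+ x. f x \<partial>lebesgue) < \<infinity>" using v unfolding local_solution_def f_def by blast
  have \<phi>: "0 \<le> ?\<phi> x" "?\<phi> x \<le> 1" for x by (rule cutoff_nonneg cutoff_le_1)+
  have \<phi>p: "?\<phi> x powr p \<le> 1" for x using \<phi> p_gt by (intro powr_le1) auto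
  have \<phi>0: "?\<phi> x = 0" if "x \<notin> ?S" for x using that d by (rule cutoff_eq_0[rotated])
  have int: "integrable lebesgue (\<lambda>x. \<bar>?\<eta> x\<bar> powr p)"
  proof (rule integrableI_bounded)
    have "(\<integral>\<^sup>+ x. ennreal (norm (\<bar>?\<eta> x\<bar> powr p)) \<partial>lebesgue) \<le> (\<integral>\<^sup>+ x. f x \<partial>lebesgue)"
    proof (rule nn_integral_mono)
      fix x
      show "ennreal (norm (\<bar>?\<eta> x\<bar> powr p)) \<le> f x"
      proof (cases "x \<in> ?S")
        case True
        have "?\<eta> x \<le> \<bar>v x\<bar> * 1" using \<phi>p by (intro mult_mono) auto
        then have "\<bar>?\<eta> x\<bar> powr p \<le> \<bar>v x\<bar> powr p" using p_gt by (intro powr_mono2) auto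
        then show ?thesis using True by (simp add: f_def ennreal_leI)
      next
        case False then show ?thesis using \<phi>0 by simp
      qed
    qed
    then show "(\<integral>\<^sup>+ x. ennreal (norm (\<bar>?\<eta> x\<bar> powr p)) \<partial>lebesgue) < \<infinity>" using fin by (rule le_less_trans)
  qed measurable
  obtain C where C: "C > 0" "\<And>(f::'a \<Rightarrow> ennreal) d. 0 < d \<Longrightarrow> f \<in> borel_measurable lebesgue \<Longrightarrow>
    (\<integral>\<^sup>+ z. f (fst z) * ennreal (min 1 (norm (fst z - snd z) / d) powr p * rker (s * p) (fst z - snd z))
      \<partial>lebesgue2) \<le> ennreal (C * d powr (- (s * p))) * (\<integral>\<^sup>+ x. f x \<partial>lebesgue)"
    using cutoff_double_integral by blast
  let ?k = "\<lambda>z::'a \<times> 'a. rker (s * p) (fst z - snd z)"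
  let ?m = "\<lambda>z::'a \<times> 'a. min 1 (norm (fst z - snd z) / d) powr p * ?k z"
  have pw: "ennreal (\<bar>?\<eta> (fst z) - ?\<eta> (snd z)\<bar> powr p * ?k z)
    \<le> ennreal (3 powr p) * ennreal (\<bar>v (fst z) - v (snd z)\<bar> powr p * ?k z)
      + ennreal (3 powr p * p powr p) * (f (fst z) * ennreal (?m z) + f (snd z) * ennreal (?m z))" for z
  proof -
    obtain x y where z: "z = (x, y)" by (cases z)
    define e where "e = min 1 (norm (x - y) / d)"
    have e0: "0 \<le> e" using d by (simp add: e_def)
    have \<phi>d: "\<bar>?\<phi> x powr p - ?\<phi> y powr p\<bar> \<le> p * e"
      using powr_diff_abs_le[OF \<phi> \<phi> p_gt, of x y] mult_left_mono[OF cutoff_lipschitz[OF d, of c \<rho> x y], of p] p_gt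
      unfolding e_def by linarith
    \<comment> \<open>In the product rule the difference of the cutoffs is paired with the value at
      \<open>x\<close> if \<open>x\<close> is in the ball. Otherwise \<open>?\<phi> x\<close> is 0,
      and \<open>?\<phi> y powr p\<close> is itself the difference of the two cutoff powers.\<close>
    have \<eta>d: "\<bar>?\<eta> x - ?\<eta> y\<bar> \<le> \<bar>v x - v y\<bar> + \<bar>v x\<bar> * indicator ?S x * (p * e) + \<bar>v y\<bar> * indicator ?S y * (p * e)"
    proof (cases "x \<in> ?S")
      case True
      have "?\<eta> x - ?\<eta> y = (max 0 (v x) - max 0 (v y)) * ?\<phi> y powr p + max 0 (v x) * (?\<phi> x powr p - ?\<phi> y powr p)"
        by (simp add: algebra_simps)
      then have "\<bar>?\<eta> x - ?\<eta> y\<bar> \<le> \<bar>max 0 (v x) - max 0 (v y)\<bar> * ?\<phi> y powr p + max 0 (v x) * \<bar>?\<phi> x powr p - ?\<phi> y powr p\<bar>"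
        by (metis abs_mult abs_of_nonneg abs_triangle_ineq max.cobounded1 powr_ge_zero)
      also have "\<dots> \<le> \<bar>v x - v y\<bar> * 1 + \<bar>v x\<bar> * (p * e)"
        using \<phi>p \<phi>d by (intro add_mono mult_mono) auto
      finally show ?thesis using True e0 p_gt by (simp add: add_increasing2)
    next
      case False
      then have "\<bar>?\<eta> x - ?\<eta> y\<bar> = max 0 (v y) * ?\<phi> y powr p" using \<phi>0 by simp
      also have "\<dots> \<le> \<bar>v y\<bar> * indicator ?S y * (p * e)"
      proof (cases "y \<in> ?S")
        case True
        have "?\<phi> y powr p \<le> p * e" using \<phi>d \<phi>0[OF False] by simp
        then show ?thesis using True by (auto intro!: mult_mono)
      qed (use \<phi>0 in auto)
      finally show ?thesis using False abs_ge_zero[of "v x - v y"] by simp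
    qed
    have pow: "(\<bar>v x\<bar> * indicator ?S x * (p * e)) powr p = p powr p * (\<bar>v x\<bar> powr p * indicator ?S x * e powr p)" for x
      using e0 p_gt by (auto simp: powr_mult indicator_def)
    have "\<bar>?\<eta> x - ?\<eta> y\<bar> powr p \<le> (\<bar>v x - v y\<bar> + \<bar>v x\<bar> * indicator ?S x * (p * e) + \<bar>v y\<bar> * indicator ?S y * (p * e)) powr p"
      using p_gt by (intro powr_mono2 \<eta>d) auto
    also have "\<dots> \<le> 3 powr p * (\<bar>v x - v y\<bar> powr p + (\<bar>v x\<bar> * indicator ?S x * (p * e)) powr p + (\<bar>v y\<bar> * indicator ?S y * (p * e)) powr p)"
      using e0 p_gt by (intro powr_add3_le) auto
    also have "\<dots> = 3 powr p * (\<bar>v x - v y\<bar> powr p + p powr p * (\<bar>v x\<bar> powr p * indicator ?S x * e powr p)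
        + p powr p * (\<bar>v y\<bar> powr p * indicator ?S y * e powr p))"
      unfolding pow ..
    finally have "\<bar>?\<eta> x - ?\<eta> y\<bar> powr p * ?k z \<le> (3 powr p * (\<bar>v x - v y\<bar> powr p + p powr p * (\<bar>v x\<bar> powr p * indicator ?S x * e powr p)
        + p powr p * (\<bar>v y\<bar> powr p * indicator ?S y * e powr p))) * ?k z"
      by (intro mult_right_mono) auto
    also have "\<dots> = 3 powr p * (\<bar>v x - v y\<bar> powr p * ?k z)
       + 3 powr p * p powr p * (\<bar>v x\<bar> powr p * indicator ?S x * (e powr p * ?k z) + \<bar>v y\<bar> powr p * indicator ?S y * (e powr p * ?k z))"
      by (simp add: algebra_simps)
    finally have "ennreal (\<bar>?\<eta> x - ?\<eta> y\<bar> powr p * ?k z) \<le> ennreal (3 powr p * (\<bar>v x - v y\<bar> powr p * ?k z)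
       + 3 powr p * p powr p * (\<bar>v x\<bar> powr p * indicator ?S x * (e powr p * ?k z) + \<bar>v y\<bar> powr p * indicator ?S y * (e powr p * ?k z)))"
      by (rule ennreal_leI)
    also have "\<dots> = ennreal (3 powr p) * ennreal (\<bar>v x - v y\<bar> powr p * ?k z)
       + ennreal (3 powr p * p powr p) * (ennreal (\<bar>v x\<bar> powr p) * indicator ?S x * ennreal (e powr p * ?k z)
       + ennreal (\<bar>v y\<bar> powr p) * indicator ?S y * ennreal (e powr p * ?k z))"
      by (simp add: ennreal_mult' ennreal_indicator[symmetric])
    finally show ?thesis unfolding z by (simp add: f_def e_def)
  qed
  have "gagliardo s p ?\<eta> \<le> (\<integral>\<^sup>+ z. ennreal (3 powr p) * ennreal (\<bar>v (fst z) - v (snd z)\<bar> powr p * ?k z)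
      + ennreal (3 powr p * p powr p) * (f (fst z) * ennreal (?m z) + f (snd z) * ennreal (?m z)) \<partial>lebesgue2)"
    unfolding gagliardo_def by (intro nn_integral_mono pw)
  also have "\<dots> = ennreal (3 powr p) * gagliardo s p v + ennreal (3 powr p * p powr p)
     * (\<integral>\<^sup>+ z. f (fst z) * ennreal (?m z) + f (snd z) * ennreal (?m z) \<partial>lebesgue2)"
    unfolding gagliardo_def by (subst nn_integral_add, measurable, subst (1 2) nn_integral_cmult, measurable)
  also have "(\<integral>\<^sup>+ z. f (fst z) * ennreal (?m z) + f (snd z) * ennreal (?m z) \<partial>lebesgue2)
      = (\<integral>\<^sup>+ z. f (fst z) * ennreal (?m z) \<partial>lebesgue2) + (\<integral>\<^sup>+ z. f (fst z) * ennreal (?m z) \<partial>lebesgue2)"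
    by (subst nn_integral_add, measurable, subst cutoff_double_integral_sym, measurable)
  also have "ennreal (3 powr p) * gagliardo s p v + ennreal (3 powr p * p powr p) * \<dots> < \<infinity>"
    using v C(2)[OF d \<open>f \<in> borel_measurable lebesgue\<close>] fin
    by (auto simp: local_solution_def ennreal_mult_less_top intro: le_less_trans)
  finally have "gagliardo s p ?\<eta> < \<infinity>" .
  moreover have "AE x in lebesgue. x \<notin> \<Omega> \<longrightarrow> ?\<eta> x = 0"
  proof (intro AE_I2 impI)
    fix x assume "x \<notin> \<Omega>"
    then have "x \<notin> ?S" using S by blast
    then show "?\<eta> x = 0" using \<phi>0 by simp
  qed
  ultimately show ?thesis
    using int by (auto simp: frac_sobolev0_def frac_sobolev_gagliardo)
qed

end

section \<open>The energy estimate\<close>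

text \<open>The bridge from the signed weak formulation to nonnegative integrals. The Bochner
  integral of a non-integrable function is 0 by convention, so the vanishing of the integral is
  informative only together with integrability of \<open>G\<close>, which
  \<open>test_integrable\<close> supplies.\<close>

lemma nn_integral_le_of_integral_zero:
  fixes G P N :: "'b \<Rightarrow> real"
  assumes G: "integrable M G" "(\<integral>x. G x \<partial>M) = 0"
    and [measurable]: "P \<in> borel_measurable M" "N \<in> borel_measurable M"
    and nn: "\<And>x. 0 \<le> P x" "\<And>x. 0 \<le> N x" and le: "AE x in M. P x \<le> G x + N x"
  shows "(\<integral>\<^sup>+ x. ennreal (P x) \<partial>M) \<le> (\<integral>\<^sup>+ x. ennreal (N x) \<partial>M)"
proof (cases "(\<integral>\<^sup>+ x. ennreal (N x) \<partial>M) = \<infinity>")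
  case False
  then have N: "integrable M N"
    using nn by (intro integrableI_nonneg) (auto simp: top.not_eq_extremum)
  have P: "integrable M P"
    by (rule Bochner_Integration.integrable_bound[OF Bochner_Integration.integrable_add[OF G(1) N]])
      (use le nn in \<open>auto elim: eventually_mono simp: abs_of_nonneg intro: order_trans[OF _ abs_ge_self]\<close>)
  have "(\<integral>x. P x \<partial>M) \<le> (\<integral>x. G x + N x \<partial>M)"
    by (rule integral_mono_AE[OF P Bochner_Integration.integrable_add[OF G(1) N] le])
  also have "\<dots> = (\<integral>x. N x \<partial>M)" using G N by simp
  finally show ?thesis
    using nn P N by (simp add: nn_integral_eq_integral ennreal_leI)
qed simp

locale frac_kernel = frac_exponents +
  fixes lam Lam :: real
  assumes lam_ge: "1 \<le> lam" and Lam_ge: "lam \<le> Lam"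
begin

text \<open>Since \<open>lam\<close> is at least 1, the lower bound can be taken with constant 1,
  and only \<open>Lam\<close> appears in later constants.\<close>

lemma kernel_bounds:
  fixes K :: "'a::euclidean_space \<Rightarrow> 'a \<Rightarrow> real"
  assumes "admissible_kernel s p lam Lam K"
  shows "AE z in lebesgue \<Otimes>\<^sub>M lebesgue. rker (s * p) (fst z - snd z) \<le> K (fst z) (snd z)
    \<and> K (fst z) (snd z) \<le> Lam * rker (s * p) (fst z - snd z)"
proof -
  have "AE z in lebesgue \<Otimes>\<^sub>M lebesgue.
          lam \<le> K (fst z) (snd z) * norm (fst z - snd z) powr (real DIM('a) + s * p)
        \<and> K (fst z) (snd z) * norm (fst z - snd z) powr (real DIM('a) + s * p) \<le> Lam"
    using assms by (simp add: admissible_kernel_def)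
  then show ?thesis
  proof eventually_elim
    case (elim z)
    define N where "N = norm (fst z - snd z) powr (real DIM('a) + s * p)"
    \<comment> \<open>On the diagonal the product of kernel and distance power is 0, which
      contradicts \<open>1 \<le> lam\<close>; the almost everywhere bound thus excludes the diagonal
      by itself.\<close>
    have "N \<noteq> 0" using elim lam_ge unfolding N_def[symmetric] by auto
    then have N: "0 < N" by (simp add: N_def)
    have k: "rker (s * p) (fst z - snd z) = 1 / N"
      unfolding rker_def N_def powr_minus_divide ..
    then show ?case
      using elim lam_ge N unfolding N_def[symmetric] k by (auto simp: field_simps)
  qed
qed

text \<open>With \<open>a\<close> and \<open>b\<close> the two absolute differences,
  \<open>a powr (p - 1) * b \<le> a powr p + b powr p\<close> follows by comparing \<open>a\<close>
  with \<open>b\<close>, so the two finite seminorms dominate the integrand.\<close>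

lemma test_integrable:
  fixes K :: "'a::euclidean_space \<Rightarrow> 'a \<Rightarrow> real"
  assumes K: "admissible_kernel s p lam Lam K"
    and [measurable]: "v \<in> borel_measurable lebesgue" "\<eta> \<in> borel_measurable lebesgue"
    and v: "gagliardo s p v < \<infinity>" and \<eta>: "gagliardo s p \<eta> < \<infinity>"
  shows "integrable lebesgue2 (\<lambda>z. K (fst z) (snd z) * \<bar>v (fst z) - v (snd z)\<bar> powr (p - 2)
               * (v (fst z) - v (snd z)) * (\<eta> (fst z) - \<eta> (snd z)))" (is "integrable ?M ?G")
proof -
  have [measurable]: "(\<lambda>z. K (fst z) (snd z)) \<in> borel_measurable lebesgue2"
    using K by (simp add: admissible_kernel_def)
  let ?k = "\<lambda>z::'a \<times> 'a. rker (s * p) (fst z - snd z)"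
  have "integrable ?M (\<lambda>z. \<bar>v (fst z) - v (snd z)\<bar> powr p * ?k z)"
    using v by (intro integrableI_nonneg) (auto simp: gagliardo_def)
  moreover have "integrable ?M (\<lambda>z. \<bar>\<eta> (fst z) - \<eta> (snd z)\<bar> powr p * ?k z)"
    using \<eta> by (intro integrableI_nonneg) (auto simp: gagliardo_def)
  ultimately have i: "integrable ?M (\<lambda>z. Lam * (\<bar>v (fst z) - v (snd z)\<bar> powr p * ?k z + \<bar>\<eta> (fst z) - \<eta> (snd z)\<bar> powr p * ?k z))"
    by simp
  show ?thesis
  proof (rule Bochner_Integration.integrable_bound[OF i])
    show "AE z in ?M. norm (?G z) \<le> norm (Lam * (\<bar>v (fst z) - v (snd z)\<bar> powr p * ?k z + \<bar>\<eta> (fst z) - \<eta> (snd z)\<bar> powr p * ?k z))"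
      using kernel_bounds[OF K]
    proof eventually_elim
      case (elim z)
      define a where "a = \<bar>v (fst z) - v (snd z)\<bar>"
      define b where "b = \<bar>\<eta> (fst z) - \<eta> (snd z)\<bar>"
      have ab: "0 \<le> a" "0 \<le> b" by (simp_all add: a_def b_def)
      have pp: "x powr p = x powr (p - 1) * x" if "0 \<le> x" for x :: real
        using that by (simp add: powr_mult_base mult.commute)
      have 1: "a powr (p - 2) * a = a powr (p - 1)"
        using abs_powr_sign[of a p] ab by simp
      have 2: "a powr (p - 1) * b \<le> a powr p + b powr p"
      proof (cases "a \<le> b")
        case True
        have "a powr (p - 1) * b \<le> b powr (p - 1) * b"
          using True ab p_gt by (intro mult_right_mono powr_mono2) auto
        also have "\<dots> = b powr p" by (rule pp[symmetric]) (fact ab)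
        finally show ?thesis by (simp add: add_increasing)
      next
        case False
        have "a powr (p - 1) * b \<le> a powr (p - 1) * a"
          using False ab by (intro mult_left_mono) auto
        also have "\<dots> = a powr p" by (rule pp[symmetric]) (fact ab)
        finally show ?thesis by (simp add: add_increasing2)
      qed
      have K0: "0 \<le> K (fst z) (snd z)" using K by (simp add: admissible_kernel_def)
      have "norm (?G z) = K (fst z) (snd z) * (a powr (p - 2) * a * b)"
        using K0 by (simp add: a_def b_def abs_mult mult.assoc)
      also have "\<dots> \<le> (Lam * ?k z) * (a powr p + b powr p)"
        unfolding 1 using elim 2 ab lam_ge Lam_ge by (intro mult_mono) auto
      also have "\<dots> \<le> norm (Lam * (a powr p * ?k z + b powr p * ?k z))"
        by (simp add: algebra_simps)
      finally show ?case by (simp add: a_def b_def)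
    qed
  qed measurable
qed

text \<open>Caccioppoli inequality.  Its left-hand side keeps the interaction between the positive and the
  nonpositive set, which is the only coercive term needed later on.\<close>

lemma energy_estimate:
  "\<exists>C>0. \<forall>(K::'a::euclidean_space \<Rightarrow> 'a \<Rightarrow> real) \<Omega> v x0 r R.
     admissible_kernel s p lam Lam K \<and> local_solution K \<Omega> v \<and> 0 < r \<and> r < R \<and> ball x0 R \<subseteq> \<Omega> \<longrightarrow>
     (energy v x0 r)
     \<le> ennreal C * (ennreal ((R - r) powr (- (s * p))) * ball_int (\<lambda>x. max 0 (v x) powr p) x0 R
        + ennreal ((R / (R - r)) powr (real DIM('a) + s * p)) * ball_int (\<lambda>x. max 0 (v x)) x0 R
          * tail_int (\<lambda>y. max 0 (v y) powr (p - 1)) x0 R)"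
proof -
  obtain C where C: "C > 0" "\<And>(f::'a \<Rightarrow> ennreal) d. 0 < d \<Longrightarrow> f \<in> borel_measurable lebesgue \<Longrightarrow>
    (\<integral>\<^sup>+ z. f (fst z) * ennreal (min 1 (norm (fst z - snd z) / d) powr p * rker (s * p) (fst z - snd z))
      \<partial>lebesgue2) \<le> ennreal (C * d powr (- (s * p))) * (\<integral>\<^sup>+ x. f x \<partial>lebesgue)"
    using cutoff_double_integral by blast
  \<comment> \<open>The factor 2 comes from symmetrising the error, \<open>Lam\<close> from the
    upper kernel bound, \<open>p powr p\<close> from the pointwise inequality and \<open>C\<close>
    from the cutoff integral. The remaining powers of 2 reflect the width
    \<open>(R - r) / 2\<close>.\<close>
  define C' where "C' = 2 * Lam * max (p powr p * C * (1/2) powr (-(s*p))) (2 powr (real DIM('a) + s * p))"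
  have Lam0: "0 < Lam" using lam_ge Lam_ge by simp
  have C'0: "0 < C'" unfolding C'_def using Lam0 by (simp add: less_max_iff_disj)
  show ?thesis
  proof (rule exI[of _ C'], rule conjI[OF C'0], intro allI impI, elim conjE)
    fix K :: "'a \<Rightarrow> 'a \<Rightarrow> real" and \<Omega> :: "'a set" and v :: "'a \<Rightarrow> real" and x0 :: 'a and r R :: real
    assume K: "admissible_kernel s p lam Lam K" and v: "local_solution K \<Omega> v"
      and r: "0 < r" and rR: "r < R" and B: "ball x0 R \<subseteq> \<Omega>"
    let ?M = "lebesgue \<Otimes>\<^sub>M lebesgue :: ('a \<times> 'a) measure"
    have vm[measurable]: "v \<in> borel_measurable lebesgue" using v by (simp add: local_solution_def)
    \<comment> \<open>Half of the annulus is used for the transition of the cutoff. The other half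
      separates its support from the complement of the ball of radius \<open>R\<close>, so that the
      kernel can be recentred at \<open>x0\<close> in the tail term.\<close>
    define d where "d = (R - r) / 2"
    define \<rho> where "\<rho> = (R + r) / 2"
    have d: "0 < d" using rR by (simp add: d_def)
    define \<phi> where "\<phi> = cutoff x0 \<rho> d"
    define w where "w x = max 0 (v x)" for x
    have wm[measurable]: "w \<in> borel_measurable lebesgue" unfolding w_def by measurable
    define \<eta> where "\<eta> x = w x * \<phi> x powr p" for x
    have \<rho>R: "\<rho> < R" using rR by (simp add: \<rho>_def)
    have S: "ball x0 \<rho> \<subseteq> ball x0 R" using \<rho>R by auto
    have \<phi>: "0 \<le> \<phi> x" "\<phi> x \<le> 1" for x unfolding \<phi>_def by (rule cutoff_nonneg cutoff_le_1)+
    have \<phi>0: "\<phi> x = 0" if "x \<notin> ball x0 \<rho>" for x unfolding \<phi>_def using d that by (rule cutoff_eq_0)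
    have \<phi>1: "\<phi> x = 1" if "x \<in> ball x0 r" for x
      unfolding \<phi>_def by (rule cutoff_eq_1[OF d]) (use that in \<open>simp add: \<rho>_def d_def field_simps\<close>)
    have [measurable]: "\<phi> \<in> borel_measurable lebesgue" unfolding \<phi>_def by measurable
    have \<eta>: "\<eta> \<in> frac_sobolev0 s p \<Omega>"
      unfolding \<eta>_def w_def \<phi>_def using B S by (intro test_function[OF v d]) auto
    then have \<eta>m[measurable]: "\<eta> \<in> borel_measurable lebesgue" and \<eta>g: "gagliardo s p \<eta> < \<infinity>"
      by (auto simp: frac_sobolev0_def frac_sobolev_gagliardo)
    define G where "G z = K (fst z) (snd z) * \<bar>v (fst z) - v (snd z)\<bar> powr (p - 2)
               * (v (fst z) - v (snd z)) * (\<eta> (fst z) - \<eta> (snd z))" for z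
    have G: "integrable ?M G" "(\<integral>z. G z \<partial>?M) = 0"
      unfolding G_def using v \<eta> \<eta>g by (auto intro!: test_integrable[OF K] simp: local_solution_def)
    let ?k = "\<lambda>x y::'a. rker (s * p) (x - y)"
    let ?m = "\<lambda>x y::'a. min 1 (norm (x - y) / d) powr p"
    define P where "P z = indicator (ball x0 r) (fst z) * (w (fst z) * (v (fst z) - v (snd z)) powr (p - 1) * ?k (fst z) (snd z)
       * indicator {y. v y \<le> 0} (snd z))" for z
    \<comment> \<open>The two losses for an ordered pair: one from the variation of the cutoff, one
      from a far point \<open>y\<close> above the zero level. \<open>N\<close> adds the same with
      the roles of the points exchanged.\<close>
    define n1 where "n1 x y = p powr p * (w x powr p * indicator (ball x0 R) x * (?m x y * ?k x y))
       + (w x * indicator (ball x0 \<rho>) x) * (w y powr (p - 1) * indicator (- ball x0 R) y * ?k x y)" for x y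
    define N where "N z = Lam * (n1 (fst z) (snd z) + n1 (snd z) (fst z))" for z
    have n10: "0 \<le> n1 x y" for x y unfolding n1_def w_def by simp
    have [measurable]: "P \<in> borel_measurable ?M" unfolding P_def by measurable
    have n1m[measurable]: "(\<lambda>z. n1 (fst z) (snd z)) \<in> borel_measurable ?M" unfolding n1_def by measurable
    have [measurable]: "(\<lambda>z. n1 (snd z) (fst z)) \<in> borel_measurable ?M" unfolding n1_def by measurable
    have [measurable]: "N \<in> borel_measurable ?M" unfolding N_def by measurable
    have PN: "P z \<le> G z + N z" if k: "?k (fst z) (snd z) \<le> K (fst z) (snd z)" "K (fst z) (snd z) \<le> Lam * ?k (fst z) (snd z)" for z
    proof -
      obtain x y where z: "z = (x, y)" by (cases z)
      define J where "J = \<bar>v x - v y\<bar> powr (p - 2) * (v x - v y)"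
      define P0 where "P0 = (if v y \<le> 0 then w x * (v x - v y) powr (p - 1) * \<phi> x powr p else 0)"
      define e where "e = (p powr p * (w x powr p * indicator (ball x0 R) x * ?m x y)
         + (w x * indicator (ball x0 \<rho>) x) * (w y powr (p - 1) * indicator (- ball x0 R) y))
         + (p powr p * (w y powr p * indicator (ball x0 R) y * ?m x y)
         + (w y * indicator (ball x0 \<rho>) y) * (w x powr (p - 1) * indicator (- ball x0 R) x))"
      have w0: "0 \<le> w x" for x by (simp add: w_def)
      have P00: "0 \<le> P0" by (simp add: P0_def w0)
      have e0: "0 \<le> e" by (simp add: e_def w0)
      have "P z \<le> ?k x y * P0"
        unfolding P_def P0_def z using \<phi>1[of x] w0[of x] by (auto simp: indicator_def mult.commute)
      also have "\<dots> \<le> K x y * P0" using k P00 z by (intro mult_right_mono) auto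
      also have "P0 \<le> J * (\<eta> x - \<eta> y) + e"
      proof -
        \<comment> \<open>The cases overlap, but they are exhaustive: if one point lies outside the
          large ball, the other is either in the small ball or both are outside it.\<close>
        consider "x \<in> ball x0 R" "y \<in> ball x0 R" | "x \<notin> ball x0 \<rho>" "y \<notin> ball x0 \<rho>" | "x \<in> ball x0 \<rho>" "y \<notin> ball x0 R"
          | "x \<notin> ball x0 R" "y \<in> ball x0 \<rho>"
          using S by blast
        then show ?thesis
        proof cases
          case 1
          have "\<bar>\<phi> x - \<phi> y\<bar> powr p \<le> ?m x y"
            unfolding \<phi>_def using p_gt d by (intro powr_mono2 cutoff_lipschitz) auto
          then have "p powr p * (w x powr p + w y powr p) * \<bar>\<phi> x - \<phi> y\<bar> powr p \<le> p powr p * (w x powr p + w y powr p) * ?m x y"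
            by (intro mult_left_mono) auto
          also have "\<dots> \<le> e" using 1 by (simp add: e_def algebra_simps)
          finally show ?thesis
            using caccioppoli_near[OF p_gt \<phi>(1)[of x] \<phi>(1)[of y], of "v y" "v x"]
            unfolding P0_def J_def \<eta>_def w_def by linarith
        next
          case 2
          then have "\<phi> x = 0" "\<phi> y = 0" using \<phi>0 by auto
          then show ?thesis using e0 by (simp add: P0_def \<eta>_def)
        next
          case 3
          then have y: "y \<notin> ball x0 \<rho>" using S by auto
          have e: "w x * w y powr (p - 1) \<le> e" using 3 w0 by (simp add: e_def)
          show ?thesis
            using caccioppoli_far[OF p_gt \<phi>[of x], of "v y" "v x"] e \<phi>0[OF y]
            unfolding P0_def J_def \<eta>_def w_def by simp
        next
          case 4
          then have x: "x \<notin> ball x0 \<rho>" using S by auto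
          have e: "w y * w x powr (p - 1) \<le> e" using 4 w0 by (simp add: e_def)
          \<comment> \<open>Here \<open>P0\<close> vanishes since the cutoff is 0 at
            \<open>x\<close>. Only a lower bound for the flux term is required, and the far
            inequality provides it with the points exchanged.\<close>
          have "- (w y * w x powr (p - 1)) \<le> (if v x \<le> 0 then max 0 (v y) * (v y - v x) powr (p - 1) * \<phi> y powr p else 0) - max 0 (v y) * max 0 (v x) powr (p - 1)"
            by (simp add: w_def)
          also have "\<dots> \<le> \<bar>v y - v x\<bar> powr (p - 2) * (v y - v x) * (max 0 (v y) * \<phi> y powr p)"
            by (rule caccioppoli_far[OF p_gt \<phi>[of y], of "v x" "v y"])
          also have "\<dots> = J * (\<eta> x - \<eta> y)"
            unfolding J_def \<eta>_def w_def \<phi>0[OF x] abs_minus_commute[of "v y"] by (simp add: algebra_simps)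
          finally show ?thesis
            using e \<phi>0[OF x] by (simp add: P0_def)
        qed
      qed
      then have "K x y * P0 \<le> K x y * (J * (\<eta> x - \<eta> y) + e)"
        using K by (intro mult_left_mono) (auto simp: admissible_kernel_def)
      also have "\<dots> = G z + K x y * e" by (simp add: G_def z J_def algebra_simps)
      also have "\<dots> \<le> G z + Lam * ?k x y * e"
        using k e0 z by (intro add_left_mono mult_right_mono) auto
      also have "Lam * ?k x y * e = N z"
        unfolding N_def n1_def e_def z fst_conv snd_conv rker_minus_commute[of _ y x] norm_minus_commute[of y x]
        by (simp add: algebra_simps)
      finally show ?thesis .
    qed
    have "(\<integral>\<^sup>+ z. ennreal (P z) \<partial>?M) \<le> (\<integral>\<^sup>+ z. ennreal (N z) \<partial>?M)"
    proof (rule nn_integral_le_of_integral_zero[OF G])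
      show "AE z in ?M. P z \<le> G z + N z"
        using kernel_bounds[OF K] by eventually_elim (rule PN, auto)
      show "0 \<le> P z" "0 \<le> N z" for z
        using Lam0 n10 by (auto simp: P_def N_def w_def)
    qed measurable
    also have "\<dots> = ennreal Lam * ((\<integral>\<^sup>+ z. ennreal (n1 (fst z) (snd z)) \<partial>?M) + (\<integral>\<^sup>+ z. ennreal (n1 (snd z) (fst z)) \<partial>?M))"
      unfolding N_def using Lam0 n10
      by (simp add: ennreal_mult' nn_integral_cmult nn_integral_add)
    also have "(\<integral>\<^sup>+ z. ennreal (n1 (snd z) (fst z)) \<partial>?M) = (\<integral>\<^sup>+ z. ennreal (n1 (fst z) (snd z)) \<partial>?M)"
      using nn_integral_pair_swap[of "\<lambda>z. ennreal (n1 (fst z) (snd z))"] by simp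
    also have "ennreal Lam * ((\<integral>\<^sup>+ z. ennreal (n1 (fst z) (snd z)) \<partial>?M) + (\<integral>\<^sup>+ z. ennreal (n1 (fst z) (snd z)) \<partial>?M))
      = ennreal (2 * Lam) * (\<integral>\<^sup>+ z. ennreal (n1 (fst z) (snd z)) \<partial>?M)"
      using Lam0 by (simp only: mult_2[symmetric] ennreal_mult' ennreal_numeral zero_le_numeral ac_simps)
    finally have main: "(\<integral>\<^sup>+ z. ennreal (P z) \<partial>?M) \<le> ennreal (2 * Lam) * (\<integral>\<^sup>+ z. ennreal (n1 (fst z) (snd z)) \<partial>?M)" .

    let ?A = "ball_int (\<lambda>x. w x powr p) x0 R"
    let ?B = "ball_int (\<lambda>x. w x) x0 R"
    let ?T = "tail_int (\<lambda>y. w y powr (p - 1)) x0 R"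
    let ?q = "real DIM('a) + s * p"
    have n1_split: "(\<integral>\<^sup>+ z. ennreal (n1 (fst z) (snd z)) \<partial>?M)
       = ennreal (p powr p) * (\<integral>\<^sup>+ z. ennreal (w (fst z) powr p) * indicator (ball x0 R) (fst z) * ennreal (?m (fst z) (snd z) * ?k (fst z) (snd z)) \<partial>?M)
        + (\<integral>\<^sup>+ z. (ennreal (w (fst z)) * indicator (ball x0 \<rho>) (fst z)) * (ennreal (w (snd z) powr (p - 1) * ?k (fst z) (snd z)) * indicator (- ball x0 R) (snd z)) \<partial>?M)"
    proof -
      have "ennreal (n1 x y) = ennreal (p powr p) * (ennreal (w x powr p) * indicator (ball x0 R) x * ennreal (?m x y * ?k x y))
        + (ennreal (w x) * indicator (ball x0 \<rho>) x) * (ennreal (w y powr (p - 1) * ?k x y) * indicator (- ball x0 R) y)" for x y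
        unfolding n1_def by (subst ennreal_plus)
         (auto simp: w_def ennreal_mult' ennreal_indicator[symmetric] ac_simps)
      then show ?thesis
        by (simp only:, subst nn_integral_add, measurable, subst nn_integral_cmult, measurable)
    qed
    have 1: "(\<integral>\<^sup>+ z. ennreal (w (fst z) powr p) * indicator (ball x0 R) (fst z) * ennreal (?m (fst z) (snd z) * ?k (fst z) (snd z)) \<partial>?M)
       \<le> ennreal (C * d powr (- (s * p))) * ?A"
      by (rule C(2)[OF d, of "\<lambda>x. ennreal (w x powr p) * indicator (ball x0 R) x"]) measurable
    have 2: "(\<integral>\<^sup>+ z. (ennreal (w (fst z)) * indicator (ball x0 \<rho>) (fst z)) * (ennreal (w (snd z) powr (p - 1) * ?k (fst z) (snd z)) * indicator (- ball x0 R) (snd z)) \<partial>?M)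
       \<le> ennreal ((2 * R / (R - r)) powr ?q) * (?B * ?T)"
    proof -
      have pw: "(ennreal (w x) * indicator (ball x0 \<rho>) x) * (ennreal (w y powr (p - 1) * ?k x y) * indicator (- ball x0 R) y)
        \<le> ennreal ((2 * R / (R - r)) powr ?q) * ((ennreal (w x) * indicator (ball x0 R) x) * (ennreal (w y powr (p - 1) * rker (s * p) (y - x0)) * indicator (- ball x0 R) y))" for x y
      proof (cases "x \<in> ball x0 \<rho> \<and> y \<notin> ball x0 R")
        case True
        have ny: "R \<le> norm (y - x0)" using True by (simp add: dist_norm norm_minus_commute)
        have nx: "norm (x - x0) < \<rho>" using True by (simp add: dist_norm norm_minus_commute)
        \<comment> \<open>Chosen such that \<open>\<rho> = (1 - c) * R\<close>; then
          \<open>c * norm (y - x0)\<close> bounds the distance of \<open>x\<close> and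
          \<open>y\<close> from below, however far away \<open>y\<close> is.\<close>
        define c where "c = (R - r) / (2 * R)"
        have c: "0 < c" "c < 1" using r rR by (auto simp: c_def field_simps)
        have "\<rho> = (1 - c) * R" using r rR by (simp add: c_def \<rho>_def field_simps)
        also have "\<dots> \<le> (1 - c) * norm (y - x0)" using c ny by (intro mult_left_mono) auto
        finally have "c * norm (y - x0) \<le> norm (y - x0) - \<rho>" by (simp add: algebra_simps)
        also have "\<dots> \<le> norm (x - y)"
          using nx norm_triangle_ineq2[of "y - x0" "x - x0"] by (simp add: norm_minus_commute)
        finally have cn: "c * norm (y - x0) \<le> norm (x - y)" .
        have "?k x y \<le> (c * norm (y - x0)) powr (- ?q)"
          unfolding rker_def using cn c ny r rR sp_pos by (intro powr_mono2') (auto intro!: mult_pos_pos)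
        also have "\<dots> = (2 * R / (R - r)) powr ?q * rker (s * p) (y - x0)"
          using c r rR by (simp add: rker_def powr_mult c_def powr_minus_divide powr_divide del: minus_add_distrib)
        finally have "w y powr (p - 1) * ?k x y \<le> (2 * R / (R - r)) powr ?q * (w y powr (p - 1) * rker (s * p) (y - x0))"
          by (simp add: mult_left_mono mult.left_commute)
        then have "ennreal (w y powr (p - 1) * ?k x y) \<le> ennreal ((2 * R / (R - r)) powr ?q) * ennreal (w y powr (p - 1) * rker (s * p) (y - x0))"
          by (simp add: ennreal_mult'[symmetric] ennreal_leI)
        then have "ennreal (w x) * ennreal (w y powr (p - 1) * ?k x y) \<le> ennreal (w x) * (ennreal ((2 * R / (R - r)) powr ?q) * ennreal (w y powr (p - 1) * rker (s * p) (y - x0)))"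
          by (rule mult_left_mono) simp
        then show ?thesis using True S by (auto simp: mult.left_commute)
      qed auto
      have "(\<integral>\<^sup>+ z. (ennreal (w (fst z)) * indicator (ball x0 \<rho>) (fst z)) * (ennreal (w (snd z) powr (p - 1) * ?k (fst z) (snd z)) * indicator (- ball x0 R) (snd z)) \<partial>?M)
        \<le> (\<integral>\<^sup>+ z. ennreal ((2 * R / (R - r)) powr ?q) * ((ennreal (w (fst z)) * indicator (ball x0 R) (fst z)) * (ennreal (w (snd z) powr (p - 1) * rker (s * p) (snd z - x0)) * indicator (- ball x0 R) (snd z))) \<partial>?M)"
        by (intro nn_integral_mono pw)
      also have "\<dots> = ennreal ((2 * R / (R - r)) powr ?q) * (\<integral>\<^sup>+ z. ((ennreal (w (fst z)) * indicator (ball x0 R) (fst z)) * (ennreal (w (snd z) powr (p - 1) * rker (s * p) (snd z - x0)) * indicator (- ball x0 R) (snd z))) \<partial>?M)"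
        by (rule nn_integral_cmult) measurable
      also have "(\<integral>\<^sup>+ z. ((ennreal (w (fst z)) * indicator (ball x0 R) (fst z)) * (ennreal (w (snd z) powr (p - 1) * rker (s * p) (snd z - x0)) * indicator (- ball x0 R) (snd z))) \<partial>?M)
        = (\<integral>\<^sup>+ x. \<integral>\<^sup>+ y. (ennreal (w x) * indicator (ball x0 R) x) * (ennreal (w y powr (p - 1) * rker (s * p) (y - x0)) * indicator (- ball x0 R) y) \<partial>lebesgue \<partial>lebesgue)"
        by (subst lebesgue.nn_integral_fst[symmetric]) auto
      also have "\<dots> = ?B * ?T"
        by (subst nn_integral_cmult, measurable, subst nn_integral_multc, auto)
      finally show ?thesis .
    qed
    have Pint: "(\<integral>\<^sup>+ z. ennreal (P z) \<partial>?M) = (\<integral>\<^sup>+ x. indicator (ball x0 r) x * (\<integral>\<^sup>+ y. ennreal (w x * (v x - v y) powr (p - 1) * ?k x y)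
          * indicator {y. v y \<le> 0} y \<partial>lebesgue) \<partial>lebesgue)"
    proof -
      have "(\<integral>\<^sup>+ z. ennreal (P z) \<partial>?M) = (\<integral>\<^sup>+ x. \<integral>\<^sup>+ y. ennreal (P (x, y)) \<partial>lebesgue \<partial>lebesgue)"
        by (subst lebesgue.nn_integral_fst[symmetric]) auto
      also have "\<dots> = (\<integral>\<^sup>+ x. \<integral>\<^sup>+ y. indicator (ball x0 r) x * (ennreal (w x * (v x - v y) powr (p - 1) * ?k x y)
          * indicator {y. v y \<le> 0} y) \<partial>lebesgue \<partial>lebesgue)"
        unfolding P_def by (intro nn_integral_cong) (auto simp: indicator_def)
      also have "\<dots> = (\<integral>\<^sup>+ x. indicator (ball x0 r) x * (\<integral>\<^sup>+ y. ennreal (w x * (v x - v y) powr (p - 1) * ?k x y)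
          * indicator {y. v y \<le> 0} y \<partial>lebesgue) \<partial>lebesgue)"
        by (intro nn_integral_cong nn_integral_cmult) measurable
      finally show ?thesis .
    qed
    have c1: "2 * Lam * (p powr p * (C * d powr (- (s * p)))) \<le> C' * (R - r) powr (- (s * p))"
    proof -
      have "d powr (- (s * p)) = (1/2) powr (-(s*p)) * (R - r) powr (-(s*p))"
        unfolding d_def using rR powr_mult[of "1/2" "R - r" "-(s*p)"] by simp
      then have "2 * Lam * (p powr p * (C * d powr (- (s * p)))) = 2 * Lam * (p powr p * C * (1/2) powr (-(s*p))) * (R - r) powr (-(s*p))"
        by simp
      also have "\<dots> \<le> C' * (R - r) powr (- (s * p))"
        unfolding C'_def using Lam0 by (intro mult_right_mono mult_left_mono) auto
      finally show ?thesis .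
    qed
    have c2: "2 * Lam * ((2 * R / (R - r)) powr ?q) \<le> C' * (R / (R - r)) powr ?q"
    proof -
      have "(2 * R / (R - r)) powr ?q = 2 powr ?q * (R / (R - r)) powr ?q"
        using r rR powr_mult[of 2 "R / (R - r)" ?q] by simp
      then have "2 * Lam * ((2 * R / (R - r)) powr ?q) = 2 * Lam * 2 powr ?q * (R / (R - r)) powr ?q"
        by simp
      also have "\<dots> \<le> C' * (R / (R - r)) powr ?q"
        unfolding C'_def using Lam0 by (intro mult_right_mono mult_left_mono) auto
      finally show ?thesis .
    qed
    have "(\<integral>\<^sup>+ z. ennreal (P z) \<partial>?M) \<le> ennreal (2 * Lam) * (ennreal (p powr p) * (ennreal (C * d powr (- (s * p))) * ?A) + ennreal ((2 * R / (R - r)) powr ?q) * (?B * ?T))"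
      by (rule order_trans[OF main]) (unfold n1_split, intro mult_left_mono add_mono 1 2, auto)
    also have "\<dots> = ennreal (2 * Lam * (p powr p * (C * d powr (- (s * p))))) * ?A + ennreal (2 * Lam * ((2 * R / (R - r)) powr ?q)) * (?B * ?T)"
      using Lam0 C(1) by (simp add: ennreal_mult' distrib_left mult.assoc)
    also have "\<dots> \<le> ennreal (C' * (R - r) powr (- (s * p))) * ?A + ennreal (C' * (R / (R - r)) powr ?q) * (?B * ?T)"
      by (intro add_mono mult_right_mono ennreal_leI c1 c2) auto
    also have "\<dots> = ennreal C' * (ennreal ((R - r) powr (- (s * p))) * ?A + ennreal ((R / (R - r)) powr ?q) * ?B * ?T)"
      using C'0 by (simp add: ennreal_mult' distrib_left mult.assoc)
    finally show "(energy v x0 r)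
     \<le> ennreal C' * (ennreal ((R - r) powr (- (s * p))) * ball_int (\<lambda>x. max 0 (v x) powr p) x0 R
        + ennreal ((R / (R - r)) powr (real DIM('a) + s * p)) * ball_int (\<lambda>x. max 0 (v x)) x0 R
          * tail_int (\<lambda>y. max 0 (v y) powr (p - 1)) x0 R)"
      unfolding Pint unfolding w_def .
  qed
qed

end

section \<open>The level set iteration\<close>

lemma unit_ball_vol_real_pos: "0 < unit_ball_vol (real n)"
  by (rule unit_ball_vol_pos) simp

context frac_exponents
begin

text \<open>A Faber--Krahn type lower bound; it replaces the fractional Sobolev inequality.\<close>

lemma complement_interaction_lower_bound:
  obtains c where "0 < c" "\<And>(A::'a::euclidean_space set) x0 x r R m. A \<in> sets lebesgue \<Longrightarrow> r < R \<Longrightarrow> x \<in> ball x0 r \<Longrightarrow> 0 < m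
      \<Longrightarrow> emeasure lebesgue (A \<inter> ball x0 R) \<le> ennreal m \<Longrightarrow>
    ennreal (c * m powr (- (s * p / real DIM('a))))
      \<le> (\<integral>\<^sup>+ y. ennreal (rker (s * p) (x - y)) * indicator (- A) y \<partial>lebesgue) + ennreal ((R - r) powr (- (s * p)))"
proof -
  let ?n = "real DIM('a)"
  let ?\<beta> = "s * p / ?n"
  define \<omega> where "\<omega> = unit_ball_vol ?n"
  have \<omega>: "0 < \<omega>" unfolding \<omega>_def by (rule unit_ball_vol_real_pos)
  define c where "c = min 1 (\<omega> / 2) * (2 / \<omega>) powr (- ?\<beta>)"
  have c0: "0 < c" using \<omega> by (simp add: c_def)
  have n0: "0 < ?n" by simp
  have "ennreal (c * m powr (- ?\<beta>))
      \<le> (\<integral>\<^sup>+ y. ennreal (rker (s * p) (x - y)) * indicator (- A) y \<partial>lebesgue) + ennreal ((R - r) powr (- (s * p)))"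
    if A[measurable]: "A \<in> sets lebesgue" and rR: "r < R" and x: "x \<in> ball x0 r" and m: "0 < m"
      and Am: "emeasure lebesgue (A \<inter> ball x0 R) \<le> ennreal m" for A :: "'a set" and x0 x r R m
  proof -
    \<comment> \<open>The ball of radius \<open>d\<close> has measure \<open>2 * m\<close>. If it
      fits into the ball of radius \<open>R\<close>, at least half of it avoids \<open>A\<close>; if
      not, \<open>d\<close> exceeds \<open>R - r\<close> and the additive term alone suffices. The
      minimum in \<open>c\<close> serves both alternatives.\<close>
    define d where "d = (2 * m / \<omega>) powr (1 / ?n)"
    have d0: "0 < d" using \<omega> m by (simp add: d_def)
    have dn: "d ^ DIM('a) = 2 * m / \<omega>"
      using d0 \<omega> m n0 by (simp add: d_def powr_realpow[symmetric] powr_powr)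
    have dsp: "d powr (- (s * p)) = (2 / \<omega>) powr (- ?\<beta>) * m powr (- ?\<beta>)"
      using m \<omega> powr_mult[of "2 / \<omega>" m "- ?\<beta>"] by (simp add: d_def powr_powr)
    show ?thesis
    proof (cases "d \<le> R - r")
      case True
      \<comment> \<open>The centre is removed because the kernel has the value 0 there and the lower
        bound fails; a point costs no measure.\<close>
      have [measurable]: "{x} \<in> sets lebesgue" by simp
      have sub: "ball x d \<subseteq> ball x0 R"
      proof
        fix y assume "y \<in> ball x d"
        then have "dist x0 y < r + d" using x dist_triangle_lt[of x0 x y] dist_triangle[of x0 y x] by simp
        then show "y \<in> ball x0 R" using True by simp
      qed
      have "emeasure lebesgue (ball x d) \<le> emeasure lebesgue (A \<inter> ball x0 R) + emeasure lebesgue (ball x d - A - {x}) + emeasure lebesgue {x}"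
      proof -
        have "emeasure lebesgue (ball x d) \<le> emeasure lebesgue ((A \<inter> ball x0 R) \<union> (ball x d - A - {x}) \<union> {x})"
          using sub by (intro emeasure_mono sets.Un) (auto simp del: Un_insert_right)
        also have "\<dots> \<le> emeasure lebesgue ((A \<inter> ball x0 R) \<union> (ball x d - A - {x})) + emeasure lebesgue {x}"
          by (rule emeasure_subadditive) measurable
        also have "\<dots> \<le> emeasure lebesgue (A \<inter> ball x0 R) + emeasure lebesgue (ball x d - A - {x}) + emeasure lebesgue {x}"
          by (rule add_right_mono, rule emeasure_subadditive) measurable
        finally show ?thesis .
      qed
      also have "\<dots> \<le> ennreal m + emeasure lebesgue (ball x d - A - {x})"
        using Am by (simp add: add_right_mono)
      also have "emeasure lebesgue (ball x d) = ennreal (2 * m)"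
        using d0 \<omega> dn by (simp add: emeasure_ball \<omega>_def[symmetric])
      finally have "ennreal m + ennreal m \<le> ennreal m + emeasure lebesgue (ball x d - A - {x})"
        using m by (simp add: ennreal_plus[symmetric] del: ennreal_plus)
      then have meas: "ennreal m \<le> emeasure lebesgue (ball x d - A - {x})"
        by (subst (asm) ennreal_add_left_cancel_le) auto
      have "c * m powr (- ?\<beta>) \<le> d powr (- (?n + s * p)) * m"
      proof -
        have "d powr (- (?n + s * p)) = d powr (- (s * p)) / d ^ DIM('a)"
          using d0 by (simp add: powr_diff powr_realpow[symmetric] powr_minus_divide algebra_simps powr_add)
        then have "d powr (- (?n + s * p)) * m = (\<omega> / 2) * ((2 / \<omega>) powr (- ?\<beta>) * m powr (- ?\<beta>))"
          unfolding dn dsp using m \<omega> by simp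
        moreover have "c * m powr (- ?\<beta>) \<le> (\<omega> / 2) * (2 / \<omega>) powr (- ?\<beta>) * m powr (- ?\<beta>)"
          unfolding c_def using \<omega> by (intro mult_right_mono) auto
        ultimately show ?thesis by (simp add: mult.assoc)
      qed
      then have "ennreal (c * m powr (- ?\<beta>)) \<le> ennreal (d powr (- (?n + s * p))) * ennreal m"
        using m by (simp add: ennreal_mult''[symmetric] ennreal_leI)
      also have "\<dots> \<le> ennreal (d powr (- (?n + s * p))) * emeasure lebesgue (ball x d - A - {x})"
        by (intro mult_left_mono meas) simp
      also have "\<dots> = (\<integral>\<^sup>+ y. ennreal (d powr (- (?n + s * p))) * indicator (ball x d - A - {x}) y \<partial>lebesgue)"
        by (subst nn_integral_cmult_indicator) auto
      also have "\<dots> \<le> (\<integral>\<^sup>+ y. ennreal (rker (s * p) (x - y)) * indicator (- A) y \<partial>lebesgue)"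
      proof (intro nn_integral_mono)
        fix y
        show "ennreal (d powr (- (?n + s * p))) * indicator (ball x d - A - {x}) y \<le> ennreal (rker (s * p) (x - y)) * indicator (- A) y"
          using rker_mono_lower[of "x - y" d "s * p"] sp_pos
          by (auto simp: indicator_def dist_norm intro!: ennreal_leI)
      qed
      finally show ?thesis by (simp add: add_increasing2)
    next
      case False
      have "c * m powr (- ?\<beta>) \<le> 1 * (2 / \<omega>) powr (- ?\<beta>) * m powr (- ?\<beta>)"
        unfolding c_def by (intro mult_right_mono) auto
      also have "\<dots> = d powr (- (s * p))" by (simp add: dsp)
      also have "\<dots> \<le> (R - r) powr (- (s * p))"
        using False rR sp_pos by (intro powr_mono2') auto
      finally show ?thesis by (simp add: add_increasing ennreal_leI)
    qed
  qed
  then show ?thesis by (rule that[OF c0])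
qed

end

context frac_kernel
begin

text \<open>For \<open>v y \<le> 0\<close> the difference \<open>v x - v y\<close> is at least
  \<open>v x\<close>, so the energy dominates the integral of the positive part to the power p
  against the interaction with the complement. The additive error of the complement bound is of the
  same form as the first energy term and is absorbed there, whence \<open>Ce + 1\<close>.\<close>

lemma level_gain:
  obtains C where "0 < C" "\<And>(K::'a::euclidean_space \<Rightarrow> 'a \<Rightarrow> real) \<Omega> v x0 r R a b t m.
     admissible_kernel s p lam Lam K \<Longrightarrow> local_solution K \<Omega> v \<Longrightarrow> 0 < r \<Longrightarrow> r < R \<Longrightarrow> ball x0 R \<subseteq> \<Omega>
     \<Longrightarrow> 0 \<le> a \<Longrightarrow> 0 \<le> b \<Longrightarrow> 0 \<le> t \<Longrightarrow> 0 < m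
     \<Longrightarrow> emeasure lebesgue ({x. 0 < v x} \<inter> ball x0 R) \<le> ennreal m
     \<Longrightarrow> ball_int (\<lambda>x. max 0 (v x) powr p) x0 R \<le> ennreal a
     \<Longrightarrow> ball_int (\<lambda>x. max 0 (v x)) x0 R \<le> ennreal b
     \<Longrightarrow> tail_int (\<lambda>y. max 0 (v y) powr (p - 1)) x0 R \<le> ennreal t
     \<Longrightarrow> ball_int (\<lambda>x. max 0 (v x) powr p) x0 r
        \<le> ennreal (C * m powr (s * p / real DIM('a)) * ((R - r) powr (- (s * p)) * a + (R / (R - r)) powr (real DIM('a) + s * p) * b * t))"
proof -
  let ?n = "real DIM('a)"
  let ?\<beta> = "s * p / ?n"
  obtain Ce where Ce: "Ce > 0" "\<And>(K::'a \<Rightarrow> 'a \<Rightarrow> real) \<Omega> v x0 r R.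
     admissible_kernel s p lam Lam K \<Longrightarrow> local_solution K \<Omega> v \<Longrightarrow> 0 < r \<Longrightarrow> r < R \<Longrightarrow> ball x0 R \<subseteq> \<Omega> \<Longrightarrow>
     (energy v x0 r)
     \<le> ennreal Ce * (ennreal ((R - r) powr (- (s * p))) * ball_int (\<lambda>x. max 0 (v x) powr p) x0 R
        + ennreal ((R / (R - r)) powr (?n + s * p)) * ball_int (\<lambda>x. max 0 (v x)) x0 R
          * tail_int (\<lambda>y. max 0 (v y) powr (p - 1)) x0 R)"
    using energy_estimate by blast
  obtain c where c: "c > 0" "\<And>(A::'a set) x0 x r R m. A \<in> sets lebesgue \<Longrightarrow> r < R \<Longrightarrow> x \<in> ball x0 r \<Longrightarrow> 0 < m
      \<Longrightarrow> emeasure lebesgue (A \<inter> ball x0 R) \<le> ennreal m \<Longrightarrow>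
    ennreal (c * m powr (- ?\<beta>))
      \<le> (\<integral>\<^sup>+ y. ennreal (rker (s * p) (x - y)) * indicator (- A) y \<partial>lebesgue) + ennreal ((R - r) powr (- (s * p)))"
    
  proof (rule complement_interaction_lower_bound[where 'a='a], goal_cases)
    case (1 c)
    show ?case by (rule 1(1)[OF 1(2)]) (rule 1(3))
  qed
  define C where "C = (Ce + 1) / c"
  have C0: "0 < C" using Ce c by (simp add: C_def)
  show ?thesis
  proof (rule that[OF C0])
    fix K :: "'a \<Rightarrow> 'a \<Rightarrow> real" and \<Omega> :: "'a set" and v :: "'a \<Rightarrow> real" and x0 :: 'a and r R a b t m :: real
    assume K: "admissible_kernel s p lam Lam K" and v: "local_solution K \<Omega> v"
      and r: "0 < r" and rR: "r < R" and B: "ball x0 R \<subseteq> \<Omega>"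
      and abt: "0 \<le> a" "0 \<le> b" "0 \<le> t" and m: "0 < m"
      and hm: "emeasure lebesgue ({x. 0 < v x} \<inter> ball x0 R) \<le> ennreal m"
      and ha: "ball_int (\<lambda>x. max 0 (v x) powr p) x0 R \<le> ennreal a" (is "?A \<le> _")
      and hb: "ball_int (\<lambda>x. max 0 (v x)) x0 R \<le> ennreal b" (is "?B \<le> _")
      and ht: "tail_int (\<lambda>y. max 0 (v y) powr (p - 1)) x0 R \<le> ennreal t" (is "?T \<le> _")
    have vm[measurable]: "v \<in> borel_measurable lebesgue" using v by (simp add: local_solution_def)
    define A where "A = {x. 0 < v x}"
    have "{x \<in> space lebesgue. 0 < v x} \<in> sets lebesgue" by measurable
    then have Am[measurable]: "A \<in> sets lebesgue" by (simp add: A_def)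
    have cA: "- A = {y. v y \<le> 0}" by (auto simp: A_def)
    let ?W = "ball_int (\<lambda>x. max 0 (v x) powr p) x0 r"
    let ?I = "\<lambda>x. \<integral>\<^sup>+ y. ennreal (rker (s * p) (x - y)) * indicator (- A) y \<partial>lebesgue"
    have WA: "?W \<le> ?A" using rR by (intro nn_integral_mono) (auto simp: indicator_def)
    have Im: "?I \<in> borel_measurable lebesgue" by measurable
    have "ennreal (c * m powr (- ?\<beta>)) * ?W = (\<integral>\<^sup>+ x. ennreal (c * m powr (- ?\<beta>)) * (ennreal (max 0 (v x) powr p) * indicator (ball x0 r) x) \<partial>lebesgue)"
      by (rule nn_integral_cmult[symmetric]) measurable
    also have "\<dots> \<le> (\<integral>\<^sup>+ x. indicator (ball x0 r) x * (ennreal (max 0 (v x) powr p) * ?I x)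
       + ennreal ((R - r) powr (- (s * p))) * (ennreal (max 0 (v x) powr p) * indicator (ball x0 r) x) \<partial>lebesgue)"
    proof (intro nn_integral_mono)
      fix x
      show "ennreal (c * m powr (- ?\<beta>)) * (ennreal (max 0 (v x) powr p) * indicator (ball x0 r) x)
        \<le> indicator (ball x0 r) x * (ennreal (max 0 (v x) powr p) * ?I x)
       + ennreal ((R - r) powr (- (s * p))) * (ennreal (max 0 (v x) powr p) * indicator (ball x0 r) x)"
      proof (cases "x \<in> ball x0 r")
        case True
        have "ennreal (c * m powr (- ?\<beta>)) * ennreal (max 0 (v x) powr p) \<le> (?I x + ennreal ((R - r) powr (- (s * p)))) * ennreal (max 0 (v x) powr p)"
          by (intro mult_right_mono c(2)[OF Am rR True m]) (use hm in \<open>auto simp: A_def\<close>)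
        then show ?thesis using True by (simp add: distrib_left mult.commute)
      qed simp
    qed
    also have "\<dots> = (\<integral>\<^sup>+ x. indicator (ball x0 r) x * (ennreal (max 0 (v x) powr p) * ?I x) \<partial>lebesgue)
       + ennreal ((R - r) powr (- (s * p))) * ?W"
      by (subst nn_integral_add, use Im in measurable, subst nn_integral_cmult, measurable)
    also have "\<dots> \<le> ennreal Ce * (ennreal ((R - r) powr (- (s * p))) * ?A + ennreal ((R / (R - r)) powr (?n + s * p)) * ?B * ?T)
       + ennreal ((R - r) powr (- (s * p))) * ?W"
    proof (rule add_right_mono)
    have "(\<integral>\<^sup>+ x. indicator (ball x0 r) x * (ennreal (max 0 (v x) powr p) * ?I x) \<partial>lebesgue)
      \<le> (energy v x0 r)"
    proof (intro nn_integral_mono mult_left_mono)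
      fix x
      have "ennreal (max 0 (v x) powr p) * ?I x = (\<integral>\<^sup>+ y. ennreal (max 0 (v x) powr p) * (ennreal (rker (s * p) (x - y)) * indicator (- A) y) \<partial>lebesgue)"
        by (rule nn_integral_cmult[symmetric]) measurable
      also have "\<dots> \<le> (\<integral>\<^sup>+ y. ennreal (max 0 (v x) * (v x - v y) powr (p - 1) * rker (s * p) (x - y)) * indicator {y. v y \<le> 0} y \<partial>lebesgue)"
      proof (intro nn_integral_mono)
        fix y
        have "max 0 (v x) powr p \<le> max 0 (v x) * (v x - v y) powr (p - 1)" if "v y \<le> 0"
        proof (cases "0 < v x")
          case True
          then have "v x powr p = v x * v x powr (p - 1)" by (simp add: powr_mult_base)
          also have "\<dots> \<le> v x * (v x - v y) powr (p - 1)"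
            using True that p_gt by (intro mult_left_mono powr_mono2) auto
          finally show ?thesis using True by simp
        qed simp
        then have "max 0 (v x) powr p * rker (s * p) (x - y) \<le> max 0 (v x) * (v x - v y) powr (p - 1) * rker (s * p) (x - y)" if "v y \<le> 0"
          using that by (intro mult_right_mono) auto
        then show "ennreal (max 0 (v x) powr p) * (ennreal (rker (s * p) (x - y)) * indicator (- A) y)
          \<le> ennreal (max 0 (v x) * (v x - v y) powr (p - 1) * rker (s * p) (x - y)) * indicator {y. v y \<le> 0} y"
          unfolding cA by (auto simp: indicator_def ennreal_mult'[symmetric] intro!: ennreal_leI)
      qed
      finally show "ennreal (max 0 (v x) powr p) * ?I x \<le> (\<integral>\<^sup>+ y. ennreal (max 0 (v x) * (v x - v y) powr (p - 1) * rker (s * p) (x - y)) * indicator {y. v y \<le> 0} y \<partial>lebesgue)" .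
    qed simp
    also have "\<dots> \<le> ennreal Ce * (ennreal ((R - r) powr (- (s * p))) * ?A + ennreal ((R / (R - r)) powr (?n + s * p)) * ?B * ?T)"
      by (rule Ce(2)[OF K v r rR B])
    finally show "(\<integral>\<^sup>+ x. indicator (ball x0 r) x * (ennreal (max 0 (v x) powr p) * ?I x) \<partial>lebesgue)
      \<le> ennreal Ce * (ennreal ((R - r) powr (- (s * p))) * ?A + ennreal ((R / (R - r)) powr (?n + s * p)) * ?B * ?T)" .
    qed
    also have "\<dots> \<le> ennreal Ce * (ennreal ((R - r) powr (- (s * p))) * ennreal a + ennreal ((R / (R - r)) powr (?n + s * p)) * ennreal b * ennreal t) + ennreal ((R - r) powr (- (s * p))) * ennreal a"
      by (intro add_mono mult_mono mult_left_mono ha hb ht order_trans[OF WA ha]) auto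
    also have "\<dots> = ennreal (Ce * ((R - r) powr (- (s * p)) * a + (R / (R - r)) powr (?n + s * p) * b * t) + (R - r) powr (- (s * p)) * a)"
      using Ce(1) abt by (simp add: ennreal_mult' ennreal_plus)
    also have "\<dots> \<le> ennreal ((Ce + 1) * ((R - r) powr (- (s * p)) * a + (R / (R - r)) powr (?n + s * p) * b * t))"
      using abt by (intro ennreal_leI) (simp add: algebra_simps)
    finally have le: "ennreal (c * m powr (- ?\<beta>)) * ?W \<le> ennreal ((Ce + 1) * ((R - r) powr (- (s * p)) * a + (R / (R - r)) powr (?n + s * p) * b * t))" .
    \<comment> \<open>The reciprocal of the gain: multiplying by a finite positive number avoids
      dividing a possibly infinite integral.\<close>
    let ?g = "m powr ?\<beta> / c"
    have one: "?g * (c * m powr (- ?\<beta>)) = 1"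
      using c m by (simp add: powr_minus_divide)
    have "?W = ennreal ?g * (ennreal (c * m powr (- ?\<beta>)) * ?W)"
      using one c by (simp add: mult.assoc[symmetric] ennreal_mult'[symmetric] del: times_divide_eq_left)
    also have "\<dots> \<le> ennreal ?g * ennreal ((Ce + 1) * ((R - r) powr (- (s * p)) * a + (R / (R - r)) powr (?n + s * p) * b * t))"
      by (intro mult_left_mono le) simp
    also have "\<dots> = ennreal (C * m powr ?\<beta> * ((R - r) powr (- (s * p)) * a + (R / (R - r)) powr (?n + s * p) * b * t))"
      using c by (simp add: ennreal_mult'[symmetric] C_def mult_ac)
    finally show "?W \<le> ennreal (C * m powr ?\<beta> * ((R - r) powr (- (s * p)) * a + (R / (R - r)) powr (?n + s * p) * b * t))" .
  qed
qed

text \<open>The tail enters each step as a mere factor, so any bound \<open>H\<close> is admissible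
  at the price of a smaller \<open>\<nu>\<close>. It is measured from \<open>R / 2\<close> since all
  radii of the iteration exceed \<open>R / 2\<close> and the positive parts decrease with the level;
  one hypothesis then covers every step.\<close>

lemma de_giorgi:
  assumes H: "0 \<le> H"
  obtains \<nu> where "0 < \<nu>" "\<And>(K::'a::euclidean_space \<Rightarrow> 'a \<Rightarrow> real) \<Omega> v x0 R.
     admissible_kernel s p lam Lam K \<Longrightarrow> local_solution K \<Omega> v \<Longrightarrow> 0 < R \<Longrightarrow> ball x0 R \<subseteq> \<Omega>
     \<Longrightarrow> tail_int (\<lambda>y. max 0 (v y) powr (p - 1)) x0 (R / 2)
          \<le> ennreal (H * R powr (- (s * p)))
     \<Longrightarrow> ball_int (\<lambda>x. max 0 (v x) powr p) x0 R \<le> ennreal (\<nu> * R ^ DIM('a))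
     \<Longrightarrow> (AE x in lebesgue. x \<in> ball x0 (R / 2) \<longrightarrow> v x \<le> 1)"
proof -
  let ?n = "real DIM('a)"
  define \<beta> where "\<beta> = s * p / ?n"
  have \<beta>: "0 < \<beta>" using sp_pos by (simp add: \<beta>_def)
  obtain C where C: "C > 0" "\<And>(K::'a \<Rightarrow> 'a \<Rightarrow> real) \<Omega> v x0 r R a b t m.
     admissible_kernel s p lam Lam K \<Longrightarrow> local_solution K \<Omega> v \<Longrightarrow> 0 < r \<Longrightarrow> r < R \<Longrightarrow> ball x0 R \<subseteq> \<Omega>
     \<Longrightarrow> 0 \<le> a \<Longrightarrow> 0 \<le> b \<Longrightarrow> 0 \<le> t \<Longrightarrow> 0 < m
     \<Longrightarrow> emeasure lebesgue ({x. 0 < v x} \<inter> ball x0 R) \<le> ennreal m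
     \<Longrightarrow> ball_int (\<lambda>x. max 0 (v x) powr p) x0 R \<le> ennreal a
     \<Longrightarrow> ball_int (\<lambda>x. max 0 (v x)) x0 R \<le> ennreal b
     \<Longrightarrow> tail_int (\<lambda>y. max 0 (v y) powr (p - 1)) x0 R \<le> ennreal t
     \<Longrightarrow> ball_int (\<lambda>x. max 0 (v x) powr p) x0 r
        \<le> ennreal (C * m powr \<beta> * ((R - r) powr (- (s * p)) * a + (R / (R - r)) powr (?n + s * p) * b * t))"
    unfolding \<beta>_def
  proof (rule level_gain[where 'a='a], goal_cases)
    case (1 C)
    show ?case by (rule 1(1)[OF 1(2)]) (rule 1(3))
  qed
  (* The level set integrals satisfy Y (j + 1) \<le> const * E ^ j * Y j powr (1 + \<beta>); this recursion
     propagates Y j \<le> Y 0 * q ^ j as soon as E * q powr \<beta> = 1 and Y 0 is below the threshold \<nu>. *)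
  define e where "e = p * \<beta> + ?n + s * p + p"
  have e0: "0 < e" using \<beta> p_gt sp_pos by (simp add: e_def add_pos_pos)
  \<comment> \<open>In \<open>e\<close> the summand \<open>p * \<beta>\<close> stems from the
    measure of the level set and \<open>n + s * p\<close> from the ratio of the radii; the last
    \<open>p\<close> covers the exponent \<open>p - 1\<close> lost in the bound for the first
    power.\<close>
  define E where "E = 2 powr e"
  have E1: "1 < E" unfolding E_def using e0 powr_less_mono[of 0 e 2] by simp
  define q where "q = E powr (- 1 / \<beta>)"
  have q0: "0 < q" using E1 by (simp add: q_def)
  have q1: "q < 1" using E1 \<beta> by (simp add: q_def powr_less_one)
  have Eq: "E * q powr \<beta> = 1" unfolding q_def powr_powr using E1 \<beta> by (simp add: powr_minus)
  \<comment> \<open>Makes \<open>C * (1 + H) * E\<^sup>2 * \<nu> powr \<beta>\<close> equal to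
    \<open>q\<close>, so that one step multiplies the bound by exactly \<open>q\<close>. The square
    of \<open>E\<close> is the offset 2 in the exponent of \<open>D\<close>.\<close>
  define \<nu> where "\<nu> = (q / (C * (1 + H) * E\<^sup>2)) powr (1 / \<beta>)"
  have \<nu>b: "\<nu> powr \<beta> = q / (C * (1 + H) * E\<^sup>2)"
    using q0 C(1) H E1 \<beta> by (simp add: \<nu>_def powr_powr)
  have \<nu>0: "0 < \<nu>" using q0 C(1) H E1 by (simp add: \<nu>_def)
  show ?thesis
  proof (rule that[OF \<nu>0])
    fix K :: "'a \<Rightarrow> 'a \<Rightarrow> real" and \<Omega> :: "'a set" and v :: "'a \<Rightarrow> real" and x0 :: 'a and R :: real
    assume K: "admissible_kernel s p lam Lam K" and v: "local_solution K \<Omega> v"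
      and R: "0 < R" and B: "ball x0 R \<subseteq> \<Omega>"
      and hT: "tail_int (\<lambda>y. max 0 (v y) powr (p - 1)) x0 (R / 2)
          \<le> ennreal (H * R powr (- (s * p)))"
      and h0: "ball_int (\<lambda>x. max 0 (v x) powr p) x0 R \<le> ennreal (\<nu> * R ^ DIM('a))"
    have vm[measurable]: "v \<in> borel_measurable lebesgue" using v by (simp add: local_solution_def)
    define \<rho> where "\<rho> j = R / 2 * (1 + 1 / 2 ^ j)" for j :: nat
    define k :: "nat \<Rightarrow> real" where "k j = 1 - 1 / 2 ^ j" for j
    define y where "y j = \<nu> * R ^ DIM('a) * q ^ j" for j :: nat
    have y0: "0 < y j" for j using \<nu>0 R q0 by (simp add: y_def)
    have \<rho>R: "\<rho> j \<le> R" and \<rho>R2: "R / 2 < \<rho> j" for j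
      using R by (simp_all add: \<rho>_def field_simps)
    have step: "ball_int (\<lambda>x. max 0 (v x - k j) powr p) x0 (\<rho> j) \<le> ennreal (y j)" for j
    proof (induction j)
      case 0
      then show ?case using h0 by (simp add: k_def \<rho>_def y_def)
    next
      case (Suc j)
      let ?u = "\<lambda>x. v x - k (Suc j)"
      let ?w = "\<lambda>x. max 0 (v x - k j)"
      let ?W = "\<lambda>x. max 0 (v x - k (Suc j))"
      \<comment> \<open>One factor for both gaps: the radii differ by exactly \<open>R / D\<close>,
        the levels by \<open>2 / D\<close>, of which only \<open>1 / D\<close> is used.\<close>
      define D where "D = (2::real) ^ (j + 2)"
      have D1: "1 \<le> D" unfolding D_def by (rule one_le_power) simp
      then have D: "1 \<le> D" "0 < D" by simp_all
      have "(1::real) \<le> 2 ^ Suc j" by (rule one_le_power) simp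
      then have "0 \<le> k (Suc j)" unfolding k_def by (simp add: divide_le_eq_1_pos del: power_Suc)
      then have kk: "k j \<le> k (Suc j)" "k (Suc j) - k j \<ge> 1 / D" "0 \<le> k (Suc j)"
        unfolding k_def D_def by (simp_all add: field_simps)
      have \<rho>\<rho>: "\<rho> j - \<rho> (Suc j) = R / D" by (simp add: \<rho>_def D_def field_simps)
      have u: "local_solution K \<Omega> ?u"
        using local_solution_affine[OF v, of 1 "- k (Suc j)"] by simp
      \<comment> \<open>Chebyshev in pointwise form. It yields the measure of the new level set and
        also trades the first power of the new positive part for the p-th power of the old
        one.\<close>
      have pos: "1 \<le> D * ?w x" if "0 < ?u x" for x
      proof -
        have "1 / D \<le> ?w x" using that kk by auto
        then have "D * (1 / D) \<le> D * ?w x" using D by (intro mult_left_mono) auto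
        then show ?thesis using D by simp
      qed
      have Wp: "?W x powr p \<le> ?w x powr p" for x using kk p_gt by (intro powr_mono2) auto
      have W1: "?W x \<le> D powr (p - 1) * ?w x powr p" for x
      proof (cases "0 < ?u x")
        case True
        have "?W x \<le> ?w x * 1" using kk by auto
        also have "\<dots> \<le> ?w x * (D * ?w x) powr (p - 1)"
          using pos[OF True] p_gt by (intro mult_left_mono ge_one_powr_ge_zero) auto
        also have "\<dots> = D powr (p - 1) * ?w x powr p"
          using D powr_mult_base[of "?w x" "p - 1"] by (simp add: powr_mult)
        finally show ?thesis .
      qed simp
      have hm: "emeasure lebesgue ({x. 0 < ?u x} \<inter> ball x0 (\<rho> j)) \<le> ennreal (D powr p * y j)"
      proof -
        have "{x \<in> space lebesgue. 0 < ?u x} \<in> sets lebesgue" by measurable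
        then have m[measurable]: "{x. 0 < ?u x} \<in> sets lebesgue" by simp
        have "emeasure lebesgue ({x. 0 < ?u x} \<inter> ball x0 (\<rho> j)) = (\<integral>\<^sup>+ x. indicator ({x. 0 < ?u x} \<inter> ball x0 (\<rho> j)) x \<partial>lebesgue)"
          by (subst nn_integral_indicator) auto
        also have "\<dots> \<le> (\<integral>\<^sup>+ x. ennreal (D powr p) * (ennreal (?w x powr p) * indicator (ball x0 (\<rho> j)) x) \<partial>lebesgue)"
        proof (intro nn_integral_mono)
          fix x
          have "1 \<le> D powr p * ?w x powr p" if "0 < ?u x"
            using ge_one_powr_ge_zero[OF pos[OF that], of p] p_gt D by (simp add: powr_mult)
          then show "indicator ({x. 0 < ?u x} \<inter> ball x0 (\<rho> j)) x \<le> ennreal (D powr p) * (ennreal (?w x powr p) * indicator (ball x0 (\<rho> j)) x)"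
            by (auto simp: indicator_def ennreal_mult'[symmetric])
        qed
        also have "\<dots> = ennreal (D powr p) * ball_int (\<lambda>x. ?w x powr p) x0 (\<rho> j)"
          by (rule nn_integral_cmult) measurable
        also have "\<dots> \<le> ennreal (D powr p) * ennreal (y j)" by (intro mult_left_mono Suc.IH) simp
        finally show ?thesis using y0[of j] by (simp add: ennreal_mult')
      qed
      have ha: "ball_int (\<lambda>x. ?W x powr p) x0 (\<rho> j) \<le> ennreal (y j)"
        by (rule order_trans[OF _ Suc.IH]) (intro nn_integral_mono mult_right_mono ennreal_leI Wp, simp)
      have hb: "ball_int (\<lambda>x. ?W x) x0 (\<rho> j) \<le> ennreal (D powr (p - 1) * y j)"
        by (rule nn_integral_on_le[OF Suc.IH]) (use W1 in auto)
      have ht: "tail_int (\<lambda>y. ?W y powr (p - 1)) x0 (\<rho> j) \<le> ennreal (H * R powr (- (s * p)))"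
      proof (rule order_trans[OF nn_integral_mono hT])
        fix y
        have "?W y powr (p - 1) * rker (s * p) (y - x0) \<le> max 0 (v y) powr (p - 1) * rker (s * p) (y - x0)"
          using kk p_gt by (intro mult_right_mono powr_mono2) auto
        then show "ennreal (?W y powr (p - 1) * rker (s * p) (y - x0)) * indicator (- ball x0 (\<rho> j)) y
          \<le> ennreal (max 0 (v y) powr (p - 1) * rker (s * p) (y - x0)) * indicator (- ball x0 (R / 2)) y"
          using \<rho>R2[of j] by (auto simp: indicator_def intro: ennreal_leI)
      qed
      have "ball_int (\<lambda>x. ?W x powr p) x0 (\<rho> (Suc j))
        \<le> ennreal (C * (D powr p * y j) powr \<beta> * ((\<rho> j - \<rho> (Suc j)) powr (- (s * p)) * y j
           + (\<rho> j / (\<rho> j - \<rho> (Suc j))) powr (?n + s * p) * (D powr (p - 1) * y j) * (H * R powr (- (s * p)))))"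
      proof (rule C(2)[OF K u _ _ _ _ _ _ _ hm ha hb ht])
        show "0 < \<rho> (Suc j)" using \<rho>R2[of "Suc j"] R by linarith
        have "0 < R / D" using R D by simp
        then show "\<rho> (Suc j) < \<rho> j" using \<rho>\<rho> by linarith
        show "ball x0 (\<rho> j) \<subseteq> \<Omega>" using B \<rho>R[of j] by (meson order_trans subset_ball)
      qed (use y0[of j] D H in \<open>auto intro: less_imp_le\<close>)
      also have "\<dots> \<le> ennreal (y (Suc j))"
      proof (rule ennreal_leI)
        have sp0: "0 \<le> s * p" using sp_pos by simp
        have b1: "(\<rho> j - \<rho> (Suc j)) powr (- (s * p)) = R powr (- (s * p)) * D powr (s * p)"
          unfolding \<rho>\<rho> using R D by (simp add: powr_divide powr_minus_divide)
        have b2: "(\<rho> j / (\<rho> j - \<rho> (Suc j))) powr (?n + s * p) \<le> D powr (?n + s * p)"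
        proof (rule powr_mono2)
          show "\<rho> j / (\<rho> j - \<rho> (Suc j)) \<le> D"
            unfolding \<rho>\<rho> using \<rho>R[of j] R D by (simp add: field_simps)
          show "0 \<le> \<rho> j / (\<rho> j - \<rho> (Suc j))"
            unfolding \<rho>\<rho> using \<rho>R2[of j] R D by simp
        qed (use sp0 in simp)
        have yb: "y j powr \<beta> = \<nu> powr \<beta> * R powr (s * p) * (q powr \<beta>) ^ j"
        proof -
          have "(R ^ DIM('a)) powr \<beta> = R powr (s * p)"
            using R by (simp add: powr_realpow[symmetric] powr_powr \<beta>_def)
          moreover have "(q ^ j) powr \<beta> = (q powr \<beta>) ^ j"
            using q0 by (simp add: powr_realpow[symmetric] powr_powr mult.commute)
          ultimately show ?thesis
            unfolding y_def using \<nu>0 R q0 by (simp add: powr_mult)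
        qed
        have De: "D powr e = E ^ (j + 2)"
          unfolding D_def E_def by (simp add: powr_realpow[symmetric] powr_powr mult.commute del: power_Suc)
        have "(\<rho> j - \<rho> (Suc j)) powr (- (s * p)) * y j
           + (\<rho> j / (\<rho> j - \<rho> (Suc j))) powr (?n + s * p) * (D powr (p - 1) * y j) * (H * R powr (- (s * p)))
          \<le> R powr (- (s * p)) * D powr (s * p) * y j + D powr (?n + s * p) * (D powr (p - 1) * y j) * (H * R powr (- (s * p)))"
          unfolding b1 using y0[of j] H by (intro add_left_mono mult_right_mono b2) auto
        also have "\<dots> = R powr (- (s * p)) * y j * (D powr (s * p) + H * D powr (?n + s * p + (p - 1)))"
          unfolding powr_add[of D "?n + s * p" "p - 1"] by (simp only: distrib_left mult_ac)
        also have "\<dots> \<le> R powr (- (s * p)) * y j * (D powr (?n + s * p + p) + H * D powr (?n + s * p + p))"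
          using y0[of j] H D p_gt s_pos by (intro mult_left_mono add_mono powr_mono) auto
        finally have br: "(\<rho> j - \<rho> (Suc j)) powr (- (s * p)) * y j
           + (\<rho> j / (\<rho> j - \<rho> (Suc j))) powr (?n + s * p) * (D powr (p - 1) * y j) * (H * R powr (- (s * p)))
          \<le> R powr (- (s * p)) * y j * ((1 + H) * D powr (?n + s * p + p))"
          by (simp add: algebra_simps)
        have yD: "(D powr p * y j) powr \<beta> = D powr (p * \<beta>) * y j powr \<beta>"
          using D y0[of j] by (simp add: powr_mult powr_powr)
        have "C * (D powr p * y j) powr \<beta> * ((\<rho> j - \<rho> (Suc j)) powr (- (s * p)) * y j
           + (\<rho> j / (\<rho> j - \<rho> (Suc j))) powr (?n + s * p) * (D powr (p - 1) * y j) * (H * R powr (- (s * p))))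
          \<le> C * (D powr (p * \<beta>) * y j powr \<beta>) * (R powr (- (s * p)) * y j * ((1 + H) * D powr (?n + s * p + p)))"
          unfolding yD using C(1) by (intro mult_left_mono br) auto
        also have "C * (D powr (p * \<beta>) * y j powr \<beta>) * (R powr (- (s * p)) * y j * ((1 + H) * D powr (?n + s * p + p)))
          = C * (1 + H) * (D powr (p * \<beta>) * D powr (?n + s * p + p)) * y j powr \<beta> * R powr (- (s * p)) * y j"
          by (simp only: mult_ac)
        also have "D powr (p * \<beta>) * D powr (?n + s * p + p) = E ^ (j + 2)"
          unfolding De[symmetric] e_def by (simp add: powr_add[symmetric] add_ac)
        also have "C * (1 + H) * E ^ (j + 2) * y j powr \<beta> * R powr (- (s * p)) * y j
          = (C * (1 + H) * E\<^sup>2 * \<nu> powr \<beta>) * (R powr (s * p) * R powr (- (s * p))) * ((E * q powr \<beta>) ^ j) * y j"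
          unfolding yb by (simp add: power_add power_mult_distrib power2_eq_square)
        also have "\<dots> = q * y j"
        proof -
          have "R powr (s * p) * R powr (- (s * p)) = 1" using R by (simp add: powr_minus_divide)
          then show ?thesis unfolding Eq \<nu>b using C(1) H E1 by simp
        qed
        also have "\<dots> = y (Suc j)" by (simp add: y_def)
        finally show "C * (D powr p * y j) powr \<beta> * ((\<rho> j - \<rho> (Suc j)) powr (- (s * p)) * y j
           + (\<rho> j / (\<rho> j - \<rho> (Suc j))) powr (?n + s * p) * (D powr (p - 1) * y j) * (H * R powr (- (s * p)))) \<le> y (Suc j)" .
      qed
      finally show ?case .
    qed
    let ?I = "ball_int (\<lambda>x. max 0 (v x - 1) powr p) x0 (R / 2)"
    have le: "?I \<le> ennreal (y j)" for j
    proof (rule order_trans[OF nn_integral_mono step[of j]])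
      fix x
      have "max 0 (v x - 1) powr p \<le> max 0 (v x - k j) powr p"
        unfolding k_def using p_gt by (intro powr_mono2 max.mono) auto
      then show "ennreal (max 0 (v x - 1) powr p) * indicator (ball x0 (R / 2)) x
         \<le> ennreal (max 0 (v x - k j) powr p) * indicator (ball x0 (\<rho> j)) x"
        using \<rho>R2[of j] by (auto simp: indicator_def intro: ennreal_leI)
    qed
    have "(\<lambda>j. \<nu> * R ^ DIM('a) * q ^ j) \<longlonglongrightarrow> \<nu> * R ^ DIM('a) * 0"
      using q0 q1 by (intro tendsto_mult tendsto_const LIMSEQ_realpow_zero) auto
    then have "y \<longlonglongrightarrow> 0" unfolding y_def[abs_def] by simp
    then have "(\<lambda>j. ennreal (y j)) \<longlonglongrightarrow> ennreal 0" by (rule tendsto_ennrealI)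
    then have "?I \<le> ennreal 0" by (rule LIMSEQ_le_const) (use le in auto)
    then have "?I = 0" by simp
    then have "AE x in lebesgue. ennreal (max 0 (v x - 1) powr p) * indicator (ball x0 (R / 2)) x = 0"
      by (subst (asm) nn_integral_0_iff_AE) auto
    then show "AE x in lebesgue. x \<in> ball x0 (R / 2) \<longrightarrow> v x \<le> 1"
    proof eventually_elim
      case (elim x)
      show ?case
      proof
        assume "x \<in> ball x0 (R / 2)"
        then have "max 0 (v x - 1) powr p \<le> 0" using elim by simp
        then have "max 0 (v x - 1) = 0" by (simp add: powr_ge_zero order.antisym)
        then show "v x \<le> 1" by linarith
      qed
    qed
  qed
qed

end

section \<open>Expansion of positivity\<close>

context frac_kernel
begin

text \<open>\<open>de_giorgi\<close> is applied to \<open>2 - 2 / k * z\<close>, whose level 1 is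
  \<open>z = k / 2\<close>; hence \<open>\<theta> = k / 2\<close>. The order of the choices matters:
  \<open>H\<close> is free of \<open>k\<close> because \<open>\<epsilon> = k powr (p - 1)\<close>
  cancels the rescaling of the tail, \<open>H\<close> determines \<open>\<nu>\<close>, and
  \<open>\<nu>\<close> determines \<open>k\<close>.\<close>

lemma growth:
  obtains \<theta> \<epsilon> where "0 < \<theta>" "\<theta> < 1" "0 < \<epsilon>" "\<And>(K::'a::euclidean_space \<Rightarrow> 'a \<Rightarrow> real) \<Omega> z x0 R.
     admissible_kernel s p lam Lam K \<Longrightarrow> local_solution K \<Omega> z \<Longrightarrow> 0 < R \<Longrightarrow> ball x0 R \<subseteq> \<Omega>
     \<Longrightarrow> (AE y in lebesgue. y \<in> ball x0 R \<longrightarrow> 0 \<le> z y)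
     \<Longrightarrow> ennreal (unit_ball_vol (real DIM('a)) / 2 * R ^ DIM('a)) \<le> emeasure lebesgue ({y. 1 \<le> z y} \<inter> ball x0 R)
     \<Longrightarrow> tail_int (\<lambda>y. max 0 (- z y) powr (p - 1)) x0 R
          \<le> ennreal (\<epsilon> * R powr (- (s * p)))
     \<Longrightarrow> (AE x in lebesgue. x \<in> ball x0 (R / 4) \<longrightarrow> \<theta> \<le> z x)"
proof -
  let ?n = "real DIM('a)"
  define \<omega> where "\<omega> = unit_ball_vol ?n"
  have \<omega>: "0 < \<omega>" unfolding \<omega>_def by (rule unit_ball_vol_real_pos)
  obtain Cf where Cf: "Cf > 0" "\<And>(x0::'a) r. 0 < r \<Longrightarrow>
    far_int (\<lambda>y. rker (s * p) (y - x0)) x0 r \<le> ennreal (Cf * r powr (-(s * p)))"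
    using rker_integral_far[OF sp_pos] by blast
  obtain Ce where Ce: "Ce > 0" "\<And>(K::'a \<Rightarrow> 'a \<Rightarrow> real) \<Omega> v x0 r R.
     admissible_kernel s p lam Lam K \<Longrightarrow> local_solution K \<Omega> v \<Longrightarrow> 0 < r \<Longrightarrow> r < R \<Longrightarrow> ball x0 R \<subseteq> \<Omega> \<Longrightarrow>
     (energy v x0 r)
     \<le> ennreal Ce * (ennreal ((R - r) powr (- (s * p))) * ball_int (\<lambda>x. max 0 (v x) powr p) x0 R
        + ennreal ((R / (R - r)) powr (?n + s * p)) * ball_int (\<lambda>x. max 0 (v x)) x0 R
          * tail_int (\<lambda>y. max 0 (v y) powr (p - 1)) x0 R)"
    using energy_estimate by blast
  \<comment> \<open>The constant 2 in \<open>u\<close> and the multiple of the negative part of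
    \<open>z\<close> give one summand each, after splitting the power of their sum;
    \<open>4 powr (s * p)\<close> is the price of starting the tail at \<open>R / 4\<close>.\<close>
  define H where "H = 4 powr (p - 1) * (Cf * 4 powr (s * p) + 1)"
  have H0: "0 < H" using Cf(1) by (simp add: H_def add_pos_pos)
  obtain \<nu> where \<nu>: "0 < \<nu>" "\<And>(K::'a \<Rightarrow> 'a \<Rightarrow> real) \<Omega> v x0 R.
     admissible_kernel s p lam Lam K \<Longrightarrow> local_solution K \<Omega> v \<Longrightarrow> 0 < R \<Longrightarrow> ball x0 R \<subseteq> \<Omega>
     \<Longrightarrow> tail_int (\<lambda>y. max 0 (v y) powr (p - 1)) x0 (R / 2)
          \<le> ennreal (H * R powr (- (s * p)))
     \<Longrightarrow> ball_int (\<lambda>x. max 0 (v x) powr p) x0 R \<le> ennreal (\<nu> * R ^ DIM('a))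
     \<Longrightarrow> (AE x in lebesgue. x \<in> ball x0 (R / 2) \<longrightarrow> v x \<le> 1)"
  proof (rule de_giorgi[OF less_imp_le[OF H0], where 'a='a], goal_cases)
    case (1 \<nu>)
    show ?case by (rule 1(1)[OF 1(2)]) (rule 1(3))
  qed
  \<comment> \<open>Points of the ball are at distance at most \<open>2 * R\<close>, and the set
    where \<open>z \<ge> 1\<close> has at least half of its volume.\<close>
  define c2 where "c2 = 2 powr (- (?n + s * p)) * (\<omega> / 2)"
  have c2: "0 < c2" using \<omega> by (simp add: c2_def)
  define C3 where "C3 = Ce * (2 powr (s * p) * (2 powr p * \<omega>) + 2 powr (?n + s * p) * (2 * \<omega>) * H)"
  have C3: "0 < C3" unfolding C3_def using Ce(1) \<omega> H0 by (intro mult_pos_pos add_pos_pos) auto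
  \<comment> \<open>Comparing both energy bounds limits the integral of the positive part of
    \<open>u\<close>, and \<open>u \<le> 2\<close> turns it into the p-th power at the cost
    \<open>2 powr (p - 1)\<close>. The value \<open>\<kappa>\<close> is what makes the result meet
    the threshold on the ball of radius \<open>R / 2\<close>.\<close>
  define \<kappa> where "\<kappa> = \<nu> / 2 ^ DIM('a) * 2 powr (1 - p) * c2 / C3"
  have \<kappa>: "0 < \<kappa>" using \<nu>(1) c2 C3 by (simp add: \<kappa>_def)
  \<comment> \<open>The bound \<open>k \<le> 1/2\<close> means \<open>2 \<le> 1 / k\<close>, which
    is what gives \<open>u \<le> - (1 / k)\<close> where \<open>z \<ge> 1\<close>.\<close>
  define k where "k = min (1/2) (\<kappa> powr (1 / (p - 1)))"
  have k: "0 < k" "k \<le> 1/2" using \<kappa> by (auto simp: k_def)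
  have kp: "k powr (p - 1) \<le> \<kappa>"
  proof -
    have "k powr (p - 1) \<le> (\<kappa> powr (1 / (p - 1))) powr (p - 1)"
      using k p_gt by (intro powr_mono2) (auto simp: k_def)
    then show ?thesis using \<kappa> p_gt by (simp add: powr_powr)
  qed
  define \<epsilon> where "\<epsilon> = k powr (p - 1)"
  have \<epsilon>: "0 < \<epsilon>" using k by (simp add: \<epsilon>_def)
  have th: "0 < k / 2" "k / 2 < 1" using k by auto
  show ?thesis
  proof (rule that[OF th \<epsilon>])
    fix K :: "'a \<Rightarrow> 'a \<Rightarrow> real" and \<Omega> :: "'a set" and z :: "'a \<Rightarrow> real" and x0 :: 'a and R :: real
    assume K: "admissible_kernel s p lam Lam K" and z: "local_solution K \<Omega> z"
      and R: "0 < R" and B: "ball x0 R \<subseteq> \<Omega>"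
      and nonneg: "AE y in lebesgue. y \<in> ball x0 R \<longrightarrow> 0 \<le> z y"
      and dens: "ennreal (unit_ball_vol ?n / 2 * R ^ DIM('a)) \<le> emeasure lebesgue ({y. 1 \<le> z y} \<inter> ball x0 R)"
      and tl: "tail_int (\<lambda>y. max 0 (- z y) powr (p - 1)) x0 R
          \<le> ennreal (\<epsilon> * R powr (- (s * p)))"
    have zm[measurable]: "z \<in> borel_measurable lebesgue" using z by (simp add: local_solution_def)
    define u where "u x = 2 - 2 / k * z x" for x
    have um[measurable]: "u \<in> borel_measurable lebesgue" unfolding u_def by measurable
    have u: "local_solution K \<Omega> u"
      using local_solution_affine[OF z, of "- (2 / k)" 2] by (simp add: u_def[abs_def])
    have u2: "max 0 (u y) \<le> 2" if "0 \<le> z y" for y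
      using that k by (simp add: u_def)
    \<comment> \<open>Radius \<open>R / 4\<close> because the level iteration runs on the ball of
      radius \<open>R / 2\<close> and sees the tail from half of that radius. Inside the ball of
      radius \<open>R\<close> the bound \<open>u \<le> 2\<close> is used, outside it the hypothesis
      on the negative part of \<open>z\<close>.\<close>
    have tail: "tail_int (\<lambda>y. max 0 (u y) powr (p - 1)) x0 (R / 4)
       \<le> ennreal (H * R powr (- (s * p)))"
    proof -
      have "tail_int (\<lambda>y. max 0 (u y) powr (p - 1)) x0 (R / 4)
        \<le> (\<integral>\<^sup>+ y. ennreal (4 powr (p - 1)) * (ennreal (rker (s * p) (y - x0)) * indicator (- ball x0 (R / 4)) y)
            + ennreal (4 powr (p - 1) * k powr (1 - p)) * (ennreal (max 0 (- z y) powr (p - 1) * rker (s * p) (y - x0)) * indicator (- ball x0 R) y) \<partial>lebesgue)"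
      proof (rule nn_integral_mono_AE)
        show "AE y in lebesgue. ennreal (max 0 (u y) powr (p - 1) * rker (s * p) (y - x0)) * indicator (- ball x0 (R / 4)) y
          \<le> ennreal (4 powr (p - 1)) * (ennreal (rker (s * p) (y - x0)) * indicator (- ball x0 (R / 4)) y)
            + ennreal (4 powr (p - 1) * k powr (1 - p)) * (ennreal (max 0 (- z y) powr (p - 1) * rker (s * p) (y - x0)) * indicator (- ball x0 R) y)"
          using nonneg
        proof eventually_elim
          case (elim y)
          show ?case
          proof (cases "y \<in> ball x0 R")
            case True
            then have "max 0 (u y) powr (p - 1) \<le> 4 powr (p - 1)"
              using u2 elim p_gt by (intro powr_mono2) force+
            then have "max 0 (u y) powr (p - 1) * rker (s * p) (y - x0) \<le> 4 powr (p - 1) * rker (s * p) (y - x0)"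
              by (rule mult_right_mono) simp
            then show ?thesis using True by (auto simp: indicator_def ennreal_mult'[symmetric] intro!: ennreal_leI)
          next
            case False
            have "max 0 (u y) powr (p - 1) \<le> (2 + 2 / k * max 0 (- z y)) powr (p - 1)"
              using k p_gt by (intro powr_mono2) (auto simp: u_def max_def field_simps)
            also have "\<dots> \<le> 2 powr (p - 1) * (2 powr (p - 1) + (2 / k * max 0 (- z y)) powr (p - 1))"
              using k p_gt by (intro powr_add_le) auto
            also have "(2 / k * max 0 (- z y)) powr (p - 1) = 2 powr (p - 1) * k powr (1 - p) * max 0 (- z y) powr (p - 1)"
              using k powr_minus_divide[of k "p - 1"] by (simp add: powr_mult powr_divide)
            also have "2 powr (p - 1) * (2 powr (p - 1) + 2 powr (p - 1) * k powr (1 - p) * max 0 (- z y) powr (p - 1))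
               = 4 powr (p - 1) + 4 powr (p - 1) * k powr (1 - p) * max 0 (- z y) powr (p - 1)"
              using powr_mult[of 2 2 "p - 1"] by (simp add: algebra_simps)
            finally have "max 0 (u y) powr (p - 1) * rker (s * p) (y - x0)
                \<le> (4 powr (p - 1) + 4 powr (p - 1) * k powr (1 - p) * max 0 (- z y) powr (p - 1)) * rker (s * p) (y - x0)"
              by (rule mult_right_mono) simp
            also have "\<dots> = 4 powr (p - 1) * rker (s * p) (y - x0) + 4 powr (p - 1) * k powr (1 - p) * (max 0 (- z y) powr (p - 1) * rker (s * p) (y - x0))"
              by (simp add: algebra_simps)
            finally have "ennreal (max 0 (u y) powr (p - 1) * rker (s * p) (y - x0)) \<le>
               ennreal (4 powr (p - 1)) * ennreal (rker (s * p) (y - x0)) + ennreal (4 powr (p - 1) * k powr (1 - p)) * ennreal (max 0 (- z y) powr (p - 1) * rker (s * p) (y - x0))"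
              by (simp add: ennreal_mult'[symmetric] ennreal_plus[symmetric] ennreal_leI del: ennreal_plus)
            moreover have "y \<notin> ball x0 (R / 4)" using False R by auto
            ultimately show ?thesis using False by simp
          qed
        qed
      qed
      also have "\<dots> = ennreal (4 powr (p - 1)) * far_int (\<lambda>y. rker (s * p) (y - x0)) x0 (R / 4)
            + ennreal (4 powr (p - 1) * k powr (1 - p)) * tail_int (\<lambda>y. max 0 (- z y) powr (p - 1)) x0 R"
        by (subst nn_integral_add, measurable, subst (1 2) nn_integral_cmult, measurable)
      also have "\<dots> \<le> ennreal (4 powr (p - 1)) * ennreal (Cf * (R / 4) powr (-(s * p))) + ennreal (4 powr (p - 1) * k powr (1 - p)) * ennreal (\<epsilon> * R powr (- (s * p)))"
        using R by (intro add_mono mult_left_mono Cf tl) auto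
      also have "\<dots> = ennreal (4 powr (p - 1) * (Cf * (R / 4) powr (-(s * p))) + 4 powr (p - 1) * (k powr (1 - p) * \<epsilon>) * R powr (- (s * p)))"
        using Cf(1) \<epsilon> by (simp add: ennreal_mult'[symmetric] ennreal_plus[symmetric] mult.assoc del: ennreal_plus)
      also have "k powr (1 - p) * \<epsilon> = 1"
        using k by (simp add: \<epsilon>_def powr_add[symmetric])
      also have "(R / 4) powr (-(s * p)) = R powr (-(s * p)) * 4 powr (s * p)"
        using R by (simp add: powr_divide powr_minus_divide)
      also have "4 powr (p - 1) * (Cf * (R powr (-(s * p)) * 4 powr (s * p))) + 4 powr (p - 1) * 1 * R powr (- (s * p)) = H * R powr (- (s * p))"
        by (simp add: H_def algebra_simps)
      finally show ?thesis .
    qed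
    have ball_int: "ball_int (\<lambda>x. max 0 (u x) powr q) x0 R \<le> ennreal (2 powr q * \<omega> * R ^ DIM('a))" if "0 \<le> q" for q
    proof -
      have "ball_int (\<lambda>x. max 0 (u x) powr q) x0 R \<le> ball_int (\<lambda>x. 2 powr q) x0 R"
      proof (rule nn_integral_mono_AE)
        show "AE x in lebesgue. ennreal (max 0 (u x) powr q) * indicator (ball x0 R) x \<le> ennreal (2 powr q) * indicator (ball x0 R) x"
          using nonneg
        proof eventually_elim
          case (elim x)
          show ?case
          proof (cases "x \<in> ball x0 R")
            case True
            have "max 0 (u x) powr q \<le> 2 powr q"
              using u2[of x] elim True that by (intro powr_mono2) auto
            then show ?thesis using True by (simp add: ennreal_leI)
          qed simp
        qed
      qed
      also have "\<dots> = ennreal (2 powr q) * emeasure lebesgue (ball x0 R)"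
        by (subst nn_integral_cmult_indicator) auto
      also have "\<dots> = ennreal (2 powr q * \<omega> * R ^ DIM('a))"
        using R \<omega> by (simp add: emeasure_ball \<omega>_def[symmetric] ennreal_mult'[symmetric] mult.assoc)
      finally show ?thesis .
    qed
    let ?E = "energy u x0 (R/2)"
    let ?X = "ball_int (\<lambda>x. max 0 (u x)) x0 (R/2)"
    have upper: "?E \<le> ennreal (C3 * R ^ DIM('a) * R powr (- (s * p)))"
    proof -
      have Rd: "R - R / 2 = R / 2" "R / (R / 2) = 2" using R by (auto simp: field_simps)
      have R2: "(R / 2) powr (- (s * p)) = 2 powr (s * p) * R powr (- (s * p))"
        using R by (simp add: powr_divide powr_minus_divide)
      have 1: "ball_int (\<lambda>x. max 0 (u x) powr p) x0 R \<le> ennreal (2 powr p * \<omega> * R ^ DIM('a))"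
        using p_gt by (intro ball_int) simp
      have 2: "ball_int (\<lambda>x. max 0 (u x)) x0 R \<le> ennreal (2 * \<omega> * R ^ DIM('a))"
        using ball_int[of 1] by (simp add: powr_one)
      have 3: "tail_int (\<lambda>y. max 0 (u y) powr (p - 1)) x0 R \<le> ennreal (H * R powr (- (s * p)))"
        by (rule order_trans[OF nn_integral_mono tail]) (use R in \<open>auto simp: indicator_def\<close>)
      have "?E \<le> ennreal Ce * (ennreal ((R - R/2) powr (- (s * p))) * ball_int (\<lambda>x. max 0 (u x) powr p) x0 R
        + ennreal ((R / (R - R/2)) powr (?n + s * p)) * ball_int (\<lambda>x. max 0 (u x)) x0 R
          * tail_int (\<lambda>y. max 0 (u y) powr (p - 1)) x0 R)"
        by (rule Ce(2)[OF K u _ _ B]) (use R in auto)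
      also have "\<dots> \<le> ennreal Ce * (ennreal ((R - R/2) powr (- (s * p))) * ennreal (2 powr p * \<omega> * R ^ DIM('a))
        + ennreal ((R / (R - R/2)) powr (?n + s * p)) * ennreal (2 * \<omega> * R ^ DIM('a)) * ennreal (H * R powr (- (s * p))))"
        by (intro mult_mono add_mono mult_left_mono 1 2 3) auto
      also have "\<dots> = ennreal (Ce * ((R - R/2) powr (- (s * p)) * (2 powr p * \<omega> * R ^ DIM('a)) + (R / (R - R/2)) powr (?n + s * p) * (2 * \<omega> * R ^ DIM('a)) * (H * R powr (- (s * p)))))"
        using Ce(1) \<omega> H0 R by (simp add: ennreal_mult'[symmetric] ennreal_plus[symmetric] del: ennreal_plus)
      also have "Ce * ((R - R/2) powr (- (s * p)) * (2 powr p * \<omega> * R ^ DIM('a)) + (R / (R - R/2)) powr (?n + s * p) * (2 * \<omega> * R ^ DIM('a)) * (H * R powr (- (s * p))))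
        = C3 * R ^ DIM('a) * R powr (- (s * p))"
        unfolding Rd R2 C3_def by (simp add: algebra_simps)
      finally show ?thesis .
    qed
    define g where "g = k powr (1 - p) * c2 * R powr (- (s * p))"
    have g0: "0 < g" using k c2 R by (simp add: g_def)
    have lower: "ennreal g * ?X \<le> ?E"
    proof -
      have "ennreal g * ?X = (\<integral>\<^sup>+ x. ennreal g * (ennreal (max 0 (u x)) * indicator (ball x0 (R/2)) x) \<partial>lebesgue)"
        by (rule nn_integral_cmult[symmetric]) measurable
      also have "\<dots> \<le> ?E"
      proof (rule nn_integral_mono)
        fix x
        show "ennreal g * (ennreal (max 0 (u x)) * indicator (ball x0 (R/2)) x) \<le> indicator (ball x0 (R/2)) x * (\<integral>\<^sup>+ y. ennreal (max 0 (u x) * (u x - u y) powr (p - 1) * rker (s * p) (x - y))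
          * indicator {y. u y \<le> 0} y \<partial>lebesgue)"
        proof (cases "x \<in> ball x0 (R/2) \<and> 0 < u x")
          case True
          then have x: "x \<in> ball x0 (R/2)" and ux: "0 < u x" by auto
          let ?S = "{y. 1 \<le> z y} \<inter> ball x0 R"
          have "{y \<in> space lebesgue. 1 \<le> z y} \<in> sets lebesgue" by measurable
          then have Sm[measurable]: "?S \<in> sets lebesgue" by simp
          have gu: "g * u x = u x * k powr (1 - p) * (2 * R) powr (- (?n + s * p)) * (\<omega> / 2 * R ^ DIM('a))"
          proof -
            have a: "(2 * R) powr (- (?n + s * p)) = 2 powr (- (?n + s * p)) * (R powr (- ?n) * R powr (- (s * p)))"
              using R by (simp add: powr_mult powr_add[symmetric])
            have b: "R powr (- ?n) * R ^ DIM('a) = 1"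
              using R by (simp add: powr_minus powr_realpow)
            have "u x * k powr (1 - p) * (2 * R) powr (- (?n + s * p)) * (\<omega> / 2 * R ^ DIM('a))
               = u x * k powr (1 - p) * 2 powr (- (?n + s * p)) * (\<omega> / 2) * R powr (- (s * p)) * (R powr (- ?n) * R ^ DIM('a))"
              unfolding a by (simp only: mult_ac)
            then show ?thesis unfolding g_def c2_def b by (simp only: mult_ac mult_1_right mult_1_left)
          qed
          have "ennreal g * ennreal (u x) = ennreal (g * u x)"
            using g0 by (simp add: ennreal_mult')
          also have "\<dots> = ennreal (u x * k powr (1 - p) * (2 * R) powr (- (?n + s * p))) * ennreal (\<omega> / 2 * R ^ DIM('a))"
            unfolding gu using ux by (intro ennreal_mult') simp
          also have "\<dots> \<le> ennreal (u x * k powr (1 - p) * (2 * R) powr (- (?n + s * p))) * emeasure lebesgue ?S"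
            using dens unfolding \<omega>_def by (rule mult_left_mono) simp
          also have "\<dots> = (\<integral>\<^sup>+ y. ennreal (u x * k powr (1 - p) * (2 * R) powr (- (?n + s * p))) * indicator ?S y \<partial>lebesgue)"
            by (rule nn_integral_cmult_indicator[symmetric]) measurable
          also have "\<dots> \<le> (\<integral>\<^sup>+ y. ennreal (max 0 (u x) * (u x - u y) powr (p - 1) * rker (s * p) (x - y)) * indicator {y. u y \<le> 0} y \<partial>lebesgue)"
          proof (rule nn_integral_mono)
            fix y
            show "ennreal (u x * k powr (1 - p) * (2 * R) powr (- (?n + s * p))) * indicator ?S y
              \<le> ennreal (max 0 (u x) * (u x - u y) powr (p - 1) * rker (s * p) (x - y)) * indicator {y. u y \<le> 0} y"
            proof (cases "y \<in> ?S")
              case True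
              then have zy: "1 \<le> z y" and y: "y \<in> ball x0 R" by auto
              have "2 / k * 1 \<le> 2 / k * z y" using zy k by (intro mult_left_mono) auto
              moreover have "2 \<le> 1 / k" using k by (simp add: field_simps)
              ultimately have uy: "u y \<le> - (1 / k)" unfolding u_def by simp
              then have uy0: "u y \<le> 0" using k order_trans[OF uy, of 0] by simp
              have ne: "x \<noteq> y" using uy0 ux by auto
              have "dist x y < 2 * R" using x y R dist_triangle[of x y x0] by (simp add: dist_commute)
              then have n2: "norm (x - y) \<le> 2 * R" by (simp add: dist_norm)
              have "k powr (1 - p) = (1 / k) powr (p - 1)"
                using k powr_minus_divide[of k "p - 1"] by (simp add: powr_divide)
              also have "\<dots> \<le> (u x - u y) powr (p - 1)" using uy ux k p_gt by (intro powr_mono2) auto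
              finally have 1: "k powr (1 - p) \<le> (u x - u y) powr (p - 1)" .
              have "u x * k powr (1 - p) * (2 * R) powr (- (?n + s * p)) \<le> u x * (u x - u y) powr (p - 1) * rker (s * p) (x - y)"
                using ux ne n2 sp_pos by (intro mult_mono mult_left_mono 1 rker_mono_lower) auto
              then show ?thesis using True uy0 ux by (auto intro: ennreal_leI)
            qed simp
          qed
          finally show ?thesis using x ux by simp
        qed (auto simp: max_def)
      qed
      finally show ?thesis .
    qed
    have X: "?X \<le> ennreal (k powr (p - 1) * C3 / c2 * R ^ DIM('a))"
    proof -
      have "?X = ennreal (1 / g) * (ennreal g * ?X)"
        using g0 by (simp add: mult.assoc[symmetric] ennreal_mult'[symmetric])
      also have "\<dots> \<le> ennreal (1 / g) * ennreal (C3 * R ^ DIM('a) * R powr (- (s * p)))"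
        by (intro mult_left_mono order_trans[OF lower upper]) simp
      also have "\<dots> = ennreal (1 / g * (C3 * R ^ DIM('a) * R powr (- (s * p))))"
        using g0 by (simp add: ennreal_mult'[symmetric])
      also have "1 / g * (C3 * R ^ DIM('a) * R powr (- (s * p))) = k powr (p - 1) * C3 / c2 * R ^ DIM('a)"
        unfolding g_def using k c2 R powr_minus_divide[of k "p - 1"] by (simp add: field_simps)
      finally show ?thesis .
    qed
    have small: "ball_int (\<lambda>x. max 0 (u x) powr p) x0 (R/2) \<le> ennreal (\<nu> * (R / 2) ^ DIM('a))"
    proof -
      have "ball_int (\<lambda>x. max 0 (u x) powr p) x0 (R/2) \<le> ennreal (2 powr (p - 1) * (k powr (p - 1) * C3 / c2 * R ^ DIM('a)))"
      proof (rule nn_integral_on_le[OF X])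
        show "AE x in lebesgue. x \<in> ball x0 (R/2) \<longrightarrow> max 0 (u x) powr p \<le> 2 powr (p - 1) * max 0 (u x)"
          using nonneg
        proof eventually_elim
          case (elim x)
          show ?case
          proof
            assume "x \<in> ball x0 (R/2)"
            then have "x \<in> ball x0 R" using R by auto
            then have "max 0 (u x) \<le> 2" using u2[of x] elim by blast
            have "max 0 (u x) powr p = max 0 (u x) powr (p - 1) * max 0 (u x)"
              using powr_mult_base[of "max 0 (u x)" "p - 1"] by (simp add: mult.commute)
            also have "\<dots> \<le> 2 powr (p - 1) * max 0 (u x)"
              using \<open>max 0 (u x) \<le> 2\<close> p_gt by (intro mult_right_mono powr_mono2) auto
            finally show "max 0 (u x) powr p \<le> 2 powr (p - 1) * max 0 (u x)" .
          qed
        qed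
      qed auto
      also have "\<dots> \<le> ennreal (\<nu> * (R / 2) ^ DIM('a))"
      proof (rule ennreal_leI)
        have "2 powr (p - 1) * (k powr (p - 1) * C3 / c2 * R ^ DIM('a)) \<le> 2 powr (p - 1) * (\<kappa> * C3 / c2 * R ^ DIM('a))"
          using C3 c2 R by (intro mult_left_mono mult_right_mono divide_right_mono kp) auto
        also have "\<dots> = (2 powr (p - 1) * 2 powr (1 - p)) * (\<nu> * (R / 2) ^ DIM('a))"
          using C3 c2 by (simp add: \<kappa>_def power_divide)
        also have "2 powr (p - 1) * 2 powr (1 - p) = (1::real)" by (simp add: powr_add[symmetric])
        finally show "2 powr (p - 1) * (k powr (p - 1) * C3 / c2 * R ^ DIM('a)) \<le> \<nu> * (R / 2) ^ DIM('a)" by simp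
      qed
      finally show ?thesis .
    qed
    have "AE x in lebesgue. x \<in> ball x0 (R / 2 / 2) \<longrightarrow> u x \<le> 1"
    proof (rule \<nu>(2)[OF K u])
      show "0 < R / 2" using R by simp
      show "ball x0 (R / 2) \<subseteq> \<Omega>" using B R subset_ball[of "R / 2" R x0] by auto
      have "R powr (- (s * p)) \<le> (R / 2) powr (- (s * p))"
        using R sp_pos by (intro powr_mono2') auto
      then have "ennreal (H * R powr (- (s * p))) \<le> ennreal (H * (R / 2) powr (- (s * p)))"
        using H0 by (intro ennreal_leI mult_left_mono) auto
      with tail show "tail_int (\<lambda>y. max 0 (u y) powr (p - 1)) x0 (R / 2 / 2)
          \<le> ennreal (H * (R / 2) powr (- (s * p)))"
        by (simp add: order_trans)
      show "ball_int (\<lambda>x. max 0 (u x) powr p) x0 (R/2) \<le> ennreal (\<nu> * (R / 2) ^ DIM('a))"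
        by (rule small)
    qed
    then show "AE x in lebesgue. x \<in> ball x0 (R / 4) \<longrightarrow> k / 2 \<le> z x"
    proof eventually_elim
      case (elim x)
      show ?case
      proof
        assume "x \<in> ball x0 (R / 4)"
        then have "1 \<le> 2 / k * z x" using elim by (simp add: u_def)
        then show "k / 2 \<le> z x" using k by (simp add: field_simps)
      qed
    qed
  qed
qed

end

section \<open>Decay of the oscillation\<close>

text \<open>\<open>a\<close> becomes the value of the representative at \<open>c\<close>, and
  \<open>4 powr \<alpha>\<close> is the loss of one dyadic step. The bound on \<open>a\<close>
  itself serves points that are too far apart for the decay to compare them.\<close>

abbreviation decays :: "real \<Rightarrow> real \<Rightarrow> ('a::euclidean_space \<Rightarrow> real) \<Rightarrow> 'a \<Rightarrow> real \<Rightarrow> real \<Rightarrow> bool" where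
  "decays \<alpha> L u c r a \<equiv> \<bar>a\<bar> \<le> L / 2 \<and> (\<forall>\<rho>. 0 < \<rho> \<and> \<rho> \<le> r \<longrightarrow>
     (AE x in lebesgue. x \<in> ball c \<rho> \<longrightarrow> \<bar>u x - a\<bar> \<le> 4 powr \<alpha> * L * (\<rho> / r) powr \<alpha>))"

text \<open>With \<open>t = exp l\<close> the left side is at most
  \<open>\<alpha> * l * exp (\<alpha> * l)\<close>, and both \<open>l\<close> and the exponential
  are absorbed by \<open>exp (\<beta> / 2 * l)\<close>. The point is the prefactor proportional to
  \<open>\<alpha>\<close>: the growth is integrable against the kernel and its coefficient can be
  made small.\<close>

lemma powr_minus_one_le:
  fixes t \<alpha> \<beta> :: real
  assumes t: "1 \<le> t" and \<alpha>: "0 < \<alpha>" "\<alpha> \<le> \<beta> / 2"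
  shows "t powr \<alpha> - 1 \<le> (2 * \<alpha> / \<beta>) * t powr \<beta>"
proof -
  define l where "l = ln t"
  have l: "0 \<le> l" using t by (simp add: l_def)
  have \<beta>: "0 < \<beta>" using \<alpha> by simp
  have P: "t powr x = exp (x * l)" for x using t by (simp add: powr_def l_def)
  have "1 - \<alpha> * l \<le> exp (- (\<alpha> * l))" using exp_ge_add_one_self[of "- (\<alpha> * l)"] by simp
  then have "(1 - \<alpha> * l) * exp (\<alpha> * l) \<le> exp (- (\<alpha> * l)) * exp (\<alpha> * l)" by (intro mult_right_mono) auto
  then have 1: "exp (\<alpha> * l) - 1 \<le> \<alpha> * l * exp (\<alpha> * l)" by (simp add: algebra_simps exp_minus)
  have "\<beta> / 2 * l \<le> exp (\<beta> / 2 * l)" using exp_ge_add_one_self[of "\<beta> / 2 * l"] by linarith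
  then have "2 / \<beta> * (\<beta> / 2 * l) \<le> 2 / \<beta> * exp (\<beta> / 2 * l)" using \<beta> by (intro mult_left_mono) auto
  then have 2: "l \<le> 2 / \<beta> * exp (\<beta> / 2 * l)" using \<beta> by simp
  have 3: "\<alpha> * l \<le> \<beta> / 2 * l" using \<alpha> l by (intro mult_right_mono) auto
  have "\<alpha> * l * exp (\<alpha> * l) \<le> \<alpha> * (2 / \<beta> * exp (\<beta> / 2 * l)) * exp (\<beta> / 2 * l)"
    using \<alpha> l 2 3 \<beta> by (intro mult_mono mult_left_mono) simp_all
  also have "\<dots> = (2 * \<alpha> / \<beta>) * exp (\<beta> * l)" by (simp add: mult_exp_exp)
  finally show ?thesis using 1 unfolding P by linarith
qed

lemma dyadic_shell:
  fixes r d :: real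
  assumes "d < r" and "r / 4 ^ j \<le> d"
  shows "\<exists>i<j. d < r / 4 ^ i \<and> r / 4 ^ Suc i \<le> d"
  using assms(2)
proof (induction j)
  case (Suc j)
  then show ?case by (cases "r / 4 ^ j \<le> d") (auto simp: less_Suc_eq)
qed (use assms(1) in simp)

context frac_kernel
begin

text \<open>On the ball of radius \<open>r / 4 ^ j\<close> the values are trapped in an interval of
  length \<open>L * q ^ j\<close>. Whichever half of the interval is occupied on half of the ball,
  \<open>growth\<close> cuts a fixed fraction off the opposite end, and \<open>q\<close> is so close
  to 1 that this fraction covers the prescribed shortening.\<close>

lemma oscillation_decay:
  obtains \<alpha> \<epsilon> where "0 < \<alpha>" "\<alpha> < s * p / (p - 1)" "0 < \<epsilon>"
    "\<And>(K::'a::euclidean_space \<Rightarrow> 'a \<Rightarrow> real) \<Omega> u x0 r L.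
     admissible_kernel s p lam Lam K \<Longrightarrow> local_solution K \<Omega> u \<Longrightarrow> 0 < r \<Longrightarrow> ball x0 r \<subseteq> \<Omega> \<Longrightarrow> 0 < L
     \<Longrightarrow> (AE x in lebesgue. x \<in> ball x0 r \<longrightarrow> \<bar>u x\<bar> \<le> L / 2)
     \<Longrightarrow> tail_int (\<lambda>y. \<bar>u y\<bar> powr (p - 1)) x0 r
          \<le> ennreal (\<epsilon> * L powr (p - 1) * r powr (- (s * p)))
     \<Longrightarrow> \<exists>a. decays \<alpha> L u x0 r a"
proof -
  let ?n = "real DIM('a)"
  define \<omega> where "\<omega> = unit_ball_vol ?n"
  have \<omega>: "0 < \<omega>" unfolding \<omega>_def by (rule unit_ball_vol_real_pos)
  obtain \<theta> \<epsilon>0 where g: "0 < \<theta>" "\<theta> < 1" "0 < \<epsilon>0" and growth: "\<And>(K::'a \<Rightarrow> 'a \<Rightarrow> real) \<Omega> z x0 R.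
     admissible_kernel s p lam Lam K \<Longrightarrow> local_solution K \<Omega> z \<Longrightarrow> 0 < R \<Longrightarrow> ball x0 R \<subseteq> \<Omega>
     \<Longrightarrow> (AE y in lebesgue. y \<in> ball x0 R \<longrightarrow> 0 \<le> z y)
     \<Longrightarrow> ennreal (unit_ball_vol ?n / 2 * R ^ DIM('a)) \<le> emeasure lebesgue ({y. 1 \<le> z y} \<inter> ball x0 R)
     \<Longrightarrow> tail_int (\<lambda>y. max 0 (- z y) powr (p - 1)) x0 R
          \<le> ennreal (\<epsilon>0 * R powr (- (s * p)))
     \<Longrightarrow> (AE x in lebesgue. x \<in> ball x0 (R / 4) \<longrightarrow> \<theta> \<le> z x)"
  proof (rule growth[where 'a='a], goal_cases)
    case (1 \<theta> \<epsilon>0)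
    show ?case by (rule 1(1)[OF 1(2-4)]) (rule 1(5))
  qed
  \<comment> \<open>The excess of the earlier intervals, raised to the power \<open>p - 1\<close>,
    grows like the distance to the power \<open>\<beta> * (p - 1) = s * p / 2\<close>; a kernel of
    order \<open>s * p / 2\<close> is left to integrate.\<close>
  have sp2: "0 < s * p / 2" using sp_pos by simp
  obtain Ch where Ch: "Ch > 0" "\<And>(x0::'a) r. 0 < r \<Longrightarrow>
    far_int (\<lambda>y. rker (s * p / 2) (y - x0)) x0 r \<le> ennreal (Ch * r powr (-(s * p / 2)))"
    using rker_integral_far[OF sp2] by blast
  define \<beta> where "\<beta> = s * p / (2 * (p - 1))"
  have \<beta>: "0 < \<beta>" using sp_pos p_gt by (simp add: \<beta>_def)
  have \<beta>p: "\<beta> * (p - 1) = s * p / 2" using p_gt by (simp add: \<beta>_def field_simps)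
  \<comment> \<open>Solves \<open>(8 * \<alpha>1 / \<beta>) powr (p - 1) * 4 powr (s * p / 2) * Ch =
    \<epsilon>0 / 2\<close>, so the excess uses up half of the tail allowed in
    \<open>growth\<close>.\<close>
  define \<alpha>1 where "\<alpha>1 = \<beta> / 8 * (\<epsilon>0 / (2 * 4 powr (s * p / 2) * Ch)) powr (1 / (p - 1))"
  have \<alpha>1: "0 < \<alpha>1" using \<beta> g Ch(1) by (simp add: \<alpha>1_def)
  \<comment> \<open>The first entry permits \<open>powr_minus_one_le\<close> and keeps
    \<open>\<alpha>\<close> below the required limit, the second makes the tail small, the third
    gives \<open>1 - \<theta> / 2 \<le> q\<close> by \<open>1 + x \<le> exp x\<close>.\<close>
  define \<alpha> where "\<alpha> = min (\<beta> / 2) (min \<alpha>1 (\<theta> / (2 * ln 4)))"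
  have \<alpha>0: "0 < \<alpha>" using \<beta> \<alpha>1 g by (simp add: \<alpha>_def)
  have \<alpha>\<beta>: "\<alpha> \<le> \<beta> / 2" and \<alpha>\<alpha>1: "\<alpha> \<le> \<alpha>1" and \<alpha>\<theta>: "\<alpha> \<le> \<theta> / (2 * ln 4)" by (simp_all add: \<alpha>_def)
  have \<alpha>sp: "\<alpha> * (p - 1) \<le> s * p"
  proof -
    have "\<alpha> * (p - 1) \<le> \<beta> * (p - 1)" using \<alpha>\<beta> \<beta> p_gt by (intro mult_right_mono) auto
    then show ?thesis using \<beta>p sp_pos by linarith
  qed
  have \<alpha>lt: "\<alpha> < s * p / (p - 1)"
  proof -
    have "\<alpha> < \<beta>" using \<alpha>\<beta> \<beta> by simp
    also have "\<beta> \<le> s * p / (p - 1)" using p_gt sp_pos by (simp add: \<beta>_def frac_le)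
    finally show ?thesis .
  qed
  define q where "q = 4 powr (- \<alpha>)"
  have q: "0 < q" "q < 1" using \<alpha>0 by (auto simp: q_def powr_less_one)
  have q\<theta>: "1 - \<theta> / 2 \<le> q"
  proof -
    have "\<alpha> * ln 4 \<le> \<theta> / 2" using \<alpha>\<theta> by (simp add: field_simps)
    moreover have "1 - \<alpha> * ln 4 \<le> q"
      using exp_ge_add_one_self[of "- \<alpha> * ln 4"] by (simp add: q_def powr_def)
    ultimately show ?thesis by linarith
  qed
  \<comment> \<open>The values of \<open>u\<close> outside the initial ball take the other half. One
    factor \<open>2 powr (p - 1)\<close> comes from splitting a sum, another from the normalisation
    by \<open>2 / l j\<close>.\<close>
  define \<epsilon> where "\<epsilon> = \<epsilon>0 / (2 * 4 powr (p - 1))"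
  have \<epsilon>: "0 < \<epsilon>" using g by (simp add: \<epsilon>_def)
  have tail1: "2 powr (p - 1) * (4 * \<alpha> / \<beta>) powr (p - 1) * 4 powr (s * p / 2) * Ch \<le> \<epsilon>0 / 2"
  proof -
    have "2 powr (p - 1) * (4 * \<alpha> / \<beta>) powr (p - 1) = (8 * \<alpha> / \<beta>) powr (p - 1)"
      using \<alpha>0 \<beta> powr_mult[of 2 "4 * \<alpha> / \<beta>" "p - 1"] by simp
    also have "\<dots> \<le> ((\<epsilon>0 / (2 * 4 powr (s * p / 2) * Ch)) powr (1 / (p - 1))) powr (p - 1)"
    proof (rule powr_mono2)
      show "8 * \<alpha> / \<beta> \<le> (\<epsilon>0 / (2 * 4 powr (s * p / 2) * Ch)) powr (1 / (p - 1))"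
        using \<alpha>\<alpha>1 \<beta> by (simp add: \<alpha>1_def field_simps)
    qed (use p_gt \<alpha>0 \<beta> in auto)
    also have "\<dots> = \<epsilon>0 / (2 * 4 powr (s * p / 2) * Ch)"
      using p_gt g Ch(1) by (simp add: powr_powr)
    finally have "2 powr (p - 1) * (4 * \<alpha> / \<beta>) powr (p - 1) * (4 powr (s * p / 2) * Ch) \<le> \<epsilon>0 / (2 * 4 powr (s * p / 2) * Ch) * (4 powr (s * p / 2) * Ch)"
      using Ch(1) by (intro mult_right_mono) auto
    then show ?thesis using Ch(1) by (simp add: mult.assoc)
  qed
  show ?thesis
  proof (rule that[OF \<alpha>0 \<alpha>lt \<epsilon>])
    fix K :: "'a \<Rightarrow> 'a \<Rightarrow> real" and \<Omega> :: "'a set" and u :: "'a \<Rightarrow> real" and x0 :: 'a and r L :: real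
    assume K: "admissible_kernel s p lam Lam K" and u: "local_solution K \<Omega> u"
      and r: "0 < r" and B: "ball x0 r \<subseteq> \<Omega>" and L: "0 < L"
      and bd: "AE x in lebesgue. x \<in> ball x0 r \<longrightarrow> \<bar>u x\<bar> \<le> L / 2"
      and tl: "tail_int (\<lambda>y. \<bar>u y\<bar> powr (p - 1)) x0 r
          \<le> ennreal (\<epsilon> * L powr (p - 1) * r powr (- (s * p)))"
    have um[measurable]: "u \<in> borel_measurable lebesgue" using u by (simp add: local_solution_def)
    define \<rho> where "\<rho> j = r / 4 ^ j" for j :: nat
    define l where "l j = L * q ^ j" for j :: nat
    have \<rho>0: "0 < \<rho> j" and \<rho>r: "\<rho> j \<le> r" for j using r by (auto simp: \<rho>_def field_simps)
    have l0: "0 < l j" for j using L q by (simp add: l_def)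
    have lS: "l (Suc j) = q * l j" for j by (simp add: l_def)
    have lmono: "l j \<le> l i" if "i \<le> j" for i j
      using that L q by (auto simp: l_def intro!: mult_left_mono power_decreasing)
    have q4: "q ^ j = (1 / 4 ^ j) powr \<alpha>" for j
      by (simp add: q_def powr_divide powr_minus_divide powr_realpow[symmetric] powr_powr power_divide mult.commute)
    have lfrac: "l i / l j = (4 ^ (j - i)) powr \<alpha>" if ij: "i \<le> j" for i j
    proof -
      obtain d where d: "j = i + d" using le_Suc_ex[OF ij] by blast
      have "l i / l j = 1 / q ^ d" using L q by (simp add: l_def d power_add)
      then show ?thesis by (simp add: d q4 powr_divide)
    qed
    \<comment> \<open>\<open>z\<close> stands for a normalised solution at scale \<open>j\<close>.
      Its negative part is bounded by the excess of the intervals belonging to larger balls, to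
      which the values of \<open>u\<close> are added outside the ball of radius
      \<open>r\<close>.\<close>
    have tail: "tail_int (\<lambda>y. max 0 (- z y) powr (p - 1)) x0 (\<rho> j)
          \<le> ennreal (\<epsilon>0 * \<rho> j powr (- (s * p)))"
      if zin: "AE y in lebesgue. \<forall>i\<le>j. y \<in> ball x0 (\<rho> i) \<longrightarrow> - z y \<le> 2 / l j * (l i - l j)"
        and zout: "\<And>y. - z y \<le> 2 / l j * (\<bar>u y\<bar> + (L - l j))" for z :: "'a \<Rightarrow> real" and j
    proof -
      define A where "A = 2 powr (p - 1) * (4 * \<alpha> / \<beta>) powr (p - 1) * (4 / \<rho> j) powr (s * p / 2)"
      define A' where "A' = 2 powr (p - 1) * (2 / l j) powr (p - 1)"
      have A0: "0 \<le> A" "0 \<le> A'" by (simp_all add: A_def A'_def)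
      have "tail_int (\<lambda>y. max 0 (- z y) powr (p - 1)) x0 (\<rho> j)
       \<le> (\<integral>\<^sup>+ y. ennreal A * (ennreal (rker (s * p / 2) (y - x0)) * indicator (- ball x0 (\<rho> j)) y)
           + ennreal A' * (ennreal (\<bar>u y\<bar> powr (p - 1) * rker (s * p) (y - x0)) * indicator (- ball x0 r) y) \<partial>lebesgue)"
      proof (rule nn_integral_mono_AE)
        show "AE y in lebesgue. ennreal (max 0 (- z y) powr (p - 1) * rker (s * p) (y - x0)) * indicator (- ball x0 (\<rho> j)) y
          \<le> ennreal A * (ennreal (rker (s * p / 2) (y - x0)) * indicator (- ball x0 (\<rho> j)) y)
           + ennreal A' * (ennreal (\<bar>u y\<bar> powr (p - 1) * rker (s * p) (y - x0)) * indicator (- ball x0 r) y)"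
          using zin
        proof eventually_elim
          case (elim y)
          show ?case
          proof (cases "y \<in> ball x0 (\<rho> j)")
            case False
            define d where "d = norm (y - x0)"
            have d: "\<rho> j \<le> d" using False by (simp add: d_def dist_norm norm_minus_commute)
            have d0: "0 < d" using d \<rho>0[of j] by linarith
            \<comment> \<open>The factor 4 allows for the shell being known only from its inner
              radius: \<open>\<rho> (Suc i) \<le> d\<close> gives
              \<open>4 ^ (j - i) \<le> t\<close>.\<close>
            define t where "t = 4 * d / \<rho> j"
            have t1: "1 \<le> t" using d \<rho>0[of j] by (simp add: t_def field_simps)
            have key: "- z y \<le> 4 * \<alpha> / \<beta> * t powr \<beta> + 2 / l j * (\<bar>u y\<bar> * indicator (- ball x0 r) y)"
            proof -
              have "\<exists>i\<le>j. l i / l j \<le> t powr \<alpha> \<and> - z y \<le> 2 / l j * (l i - l j) + 2 / l j * (\<bar>u y\<bar> * indicator (- ball x0 r) y)"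
              proof (cases "y \<in> ball x0 r")
                case True
                then have "d < r" by (simp add: d_def dist_norm norm_minus_commute)
                then obtain i where i: "i < j" "d < \<rho> i" "\<rho> (Suc i) \<le> d"
                  using dyadic_shell[of d r j] d unfolding \<rho>_def by blast
                have "4 ^ (j - i) \<le> t"
                proof -
                  have e: "(4::real) ^ j = 4 ^ (j - i) * 4 ^ i" using i(1) by (simp add: power_add[symmetric])
                  have "4 ^ (j - i) * \<rho> j = 4 * \<rho> (Suc i)" unfolding \<rho>_def e by simp
                  also have "\<dots> \<le> 4 * d" using i(3) by simp
                  finally show ?thesis unfolding t_def using \<rho>0[of j] by (simp add: pos_le_divide_eq)
                qed
                then have "l i / l j \<le> t powr \<alpha>"
                  unfolding lfrac[OF less_imp_le[OF i(1)]] using \<alpha>0 by (intro powr_mono2) auto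
                moreover have "y \<in> ball x0 (\<rho> i)" using i(2) by (simp add: d_def dist_norm norm_minus_commute)
                ultimately show ?thesis using elim i(1) True by (intro exI[of _ i]) auto
              next
                case False
                then have "r \<le> d" by (simp add: d_def dist_norm norm_minus_commute)
                then have "4 ^ j \<le> t" using r d0 by (simp add: t_def \<rho>_def field_simps)
                then have "l 0 / l j \<le> t powr \<alpha>"
                  unfolding lfrac[OF le0] using \<alpha>0 by (intro powr_mono2) auto
                moreover have "l 0 = L" by (simp add: l_def)
                moreover have "2 / l j * (\<bar>u y\<bar> + (L - l j)) = 2 / l j * (L - l j) + 2 / l j * \<bar>u y\<bar>"
                  by (simp only: distrib_left add.commute)
                moreover have "indicator (- ball x0 r) y = (1::real)" using False by simp
                ultimately show ?thesis using zout[of y]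
                  by (intro exI[of _ 0]) (simp only: mult_1_right le0 simp_thms)
              qed
              then obtain i where i: "l i / l j \<le> t powr \<alpha>" "- z y \<le> 2 / l j * (l i - l j) + 2 / l j * (\<bar>u y\<bar> * indicator (- ball x0 r) y)"
                by blast
              have "2 / l j * (l i - l j) = 2 * (l i / l j - 1)" using l0[of j] by (simp add: field_simps)
              also have "\<dots> \<le> 2 * (t powr \<alpha> - 1)" using i(1) by simp
              also have "\<dots> \<le> 2 * ((2 * \<alpha> / \<beta>) * t powr \<beta>)"
                using powr_minus_one_le[OF t1 \<alpha>0 \<alpha>\<beta>] by simp
              finally show ?thesis using i(2) by simp
            qed
            define X where "X = 4 * \<alpha> / \<beta> * t powr \<beta>"
            define Y where "Y = 2 / l j * (\<bar>u y\<bar> * indicator (- ball x0 r) y)"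
            have XY: "0 \<le> X" "0 \<le> Y" using \<alpha>0 \<beta> l0[of j] by (auto simp: X_def Y_def)
            have "max 0 (- z y) powr (p - 1) \<le> (X + Y) powr (p - 1)"
              using key XY p_gt unfolding X_def[symmetric] Y_def[symmetric] by (intro powr_mono2) auto
            also have "\<dots> \<le> 2 powr (p - 1) * (X powr (p - 1) + Y powr (p - 1))"
              using XY p_gt by (intro powr_add_le) auto
            also have "X powr (p - 1) = (4 * \<alpha> / \<beta>) powr (p - 1) * ((4 / \<rho> j) powr (s * p / 2) * d powr (s * p / 2))"
            proof -
              have "X powr (p - 1) = (4 * \<alpha> / \<beta>) powr (p - 1) * t powr (s * p / 2)"
                unfolding X_def using \<alpha>0 \<beta> by (subst powr_mult) (auto simp: powr_powr \<beta>p)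
              also have "t powr (s * p / 2) = (4 / \<rho> j) powr (s * p / 2) * d powr (s * p / 2)"
                unfolding t_def using \<rho>0[of j] d0 by (subst powr_mult[symmetric]) auto
              finally show ?thesis .
            qed
            also have "Y powr (p - 1) = (2 / l j) powr (p - 1) * (\<bar>u y\<bar> powr (p - 1) * indicator (- ball x0 r) y)"
              unfolding Y_def using l0[of j] p_gt powr_mult[of "2 / l j" "\<bar>u y\<bar>" "p - 1"]
              by (cases "y \<in> ball x0 r") auto
            finally have "max 0 (- z y) powr (p - 1) * rker (s * p) (y - x0)
               \<le> 2 powr (p - 1) * ((4 * \<alpha> / \<beta>) powr (p - 1) * ((4 / \<rho> j) powr (s * p / 2) * d powr (s * p / 2))
                  + (2 / l j) powr (p - 1) * (\<bar>u y\<bar> powr (p - 1) * indicator (- ball x0 r) y)) * rker (s * p) (y - x0)"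
              by (rule mult_right_mono) simp
            also have "\<dots> = A * (d powr (s * p / 2) * rker (s * p) (y - x0)) + A' * (\<bar>u y\<bar> powr (p - 1) * rker (s * p) (y - x0) * indicator (- ball x0 r) y)"
              by (simp add: A_def A'_def algebra_simps)
            also have "d powr (s * p / 2) * rker (s * p) (y - x0) = rker (s * p / 2) (y - x0)"
              unfolding rker_def d_def by (subst powr_add[symmetric], rule arg_cong[where f = "\<lambda>e. norm (y - x0) powr e"]) simp
            finally have "ennreal (max 0 (- z y) powr (p - 1) * rker (s * p) (y - x0))
               \<le> ennreal (A * rker (s * p / 2) (y - x0) + A' * (\<bar>u y\<bar> powr (p - 1) * rker (s * p) (y - x0) * indicator (- ball x0 r) y))"
              by (rule ennreal_leI)
            also have "\<dots> = ennreal A * ennreal (rker (s * p / 2) (y - x0)) + ennreal A' * (ennreal (\<bar>u y\<bar> powr (p - 1) * rker (s * p) (y - x0)) * indicator (- ball x0 r) y)"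
              using A0 by (simp add: ennreal_mult' ennreal_indicator[symmetric])
            finally show ?thesis using False by simp
          qed simp
        qed
      qed
      also have "\<dots> = ennreal A * far_int (\<lambda>y. rker (s * p / 2) (y - x0)) x0 (\<rho> j)
           + ennreal A' * tail_int (\<lambda>y. \<bar>u y\<bar> powr (p - 1)) x0 r"
        by (subst nn_integral_add, measurable, subst (1 2) nn_integral_cmult, measurable)
      also have "\<dots> \<le> ennreal A * ennreal (Ch * \<rho> j powr (-(s * p / 2))) + ennreal A' * ennreal (\<epsilon> * L powr (p - 1) * r powr (- (s * p)))"
        by (intro add_mono mult_left_mono Ch(2) tl \<rho>0) auto
      also have "\<dots> = ennreal (A * (Ch * \<rho> j powr (-(s * p / 2))) + A' * (\<epsilon> * L powr (p - 1) * r powr (- (s * p))))"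
        using A0 Ch(1) \<epsilon> by (simp add: ennreal_mult'[symmetric] ennreal_plus[symmetric] del: ennreal_plus)
      also have "\<dots> \<le> ennreal (\<epsilon>0 * \<rho> j powr (- (s * p)))"
      proof (rule ennreal_leI)
        have "A * (Ch * \<rho> j powr (-(s * p / 2))) = (2 powr (p - 1) * (4 * \<alpha> / \<beta>) powr (p - 1) * 4 powr (s * p / 2) * Ch) * (\<rho> j powr (-(s * p / 2)) * \<rho> j powr (-(s * p / 2)))"
          unfolding A_def using \<rho>0[of j] by (simp add: powr_divide powr_minus_divide)
        also have "\<rho> j powr (-(s * p / 2)) * \<rho> j powr (-(s * p / 2)) = \<rho> j powr (-(s * p))"
          by (subst powr_add[symmetric]) (simp add: mult.commute)
        also have "2 powr (p - 1) * (4 * \<alpha> / \<beta>) powr (p - 1) * 4 powr (s * p / 2) * Ch * \<rho> j powr (-(s * p)) \<le> \<epsilon>0 / 2 * \<rho> j powr (-(s * p))"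
          by (intro mult_right_mono tail1) simp
        finally have 1: "A * (Ch * \<rho> j powr (-(s * p / 2))) \<le> \<epsilon>0 / 2 * \<rho> j powr (-(s * p))" .
        have 2: "A' * (\<epsilon> * L powr (p - 1) * r powr (- (s * p))) \<le> \<epsilon>0 / 2 * \<rho> j powr (-(s * p))"
        proof -
          have a: "A' = 4 powr (p - 1) / l j powr (p - 1)"
            unfolding A'_def using l0[of j] powr_mult[of 2 2 "p - 1"] by (simp add: powr_divide)
          have b: "L powr (p - 1) = l j powr (p - 1) * (4 ^ j) powr (\<alpha> * (p - 1))"
          proof -
            have "L = l j * (4 ^ j) powr \<alpha>"
            proof -
              have "l 0 = l j * (l 0 / l j)" using l0[of j] by simp
              then show ?thesis by (simp only: lfrac[OF le0] diff_zero) (simp add: l_def)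
            qed
            then have "L powr (p - 1) = (l j * (4 ^ j) powr \<alpha>) powr (p - 1)" by (rule arg_cong)
            also have "\<dots> = l j powr (p - 1) * (4 ^ j) powr (\<alpha> * (p - 1))"
              using l0[of j] by (simp add: powr_mult powr_powr)
            finally show ?thesis .
          qed
          have c: "r powr (- (s * p)) = \<rho> j powr (-(s * p)) * (4 ^ j) powr (- (s * p))"
            unfolding \<rho>_def using r by (simp add: powr_divide powr_minus_divide)
          have "A' * (\<epsilon> * L powr (p - 1) * r powr (- (s * p))) = \<epsilon>0 / 2 * \<rho> j powr (-(s * p)) * ((4 ^ j) powr (\<alpha> * (p - 1)) * (4 ^ j) powr (- (s * p)))"
            unfolding a b c \<epsilon>_def using l0[of j] by simp
          also have "(4 ^ j) powr (\<alpha> * (p - 1)) * (4 ^ j) powr (- (s * p)) \<le> (1::real)"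
          proof -
            have "(4 ^ j) powr (\<alpha> * (p - 1)) * (4 ^ j) powr (- (s * p)) = (4 ^ j :: real) powr (\<alpha> * (p - 1) - s * p)"
              by (subst powr_add[symmetric]) simp
            also have "\<dots> \<le> (4 ^ j) powr 0"
              using \<alpha>sp by (intro powr_mono) auto
            finally show ?thesis by simp
          qed
          then have "\<epsilon>0 / 2 * \<rho> j powr (-(s * p)) * ((4 ^ j) powr (\<alpha> * (p - 1)) * (4 ^ j) powr (- (s * p))) \<le> \<epsilon>0 / 2 * \<rho> j powr (-(s * p)) * 1"
            using g by (intro mult_left_mono) auto
          finally show ?thesis by simp
        qed
        show "A * (Ch * \<rho> j powr (-(s * p / 2))) + A' * (\<epsilon> * L powr (p - 1) * r powr (- (s * p))) \<le> \<epsilon>0 * \<rho> j powr (- (s * p))"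
          using 1 2 by simp
      qed
      finally show ?thesis .
    qed
    \<comment> \<open>\<open>v\<close> is the height of \<open>u\<close> above the left endpoint or
      its depth below the right one, so both alternatives are settled here. Scaling by
      \<open>2 / l j\<close> sends the midpoint of the interval to level 1.\<close>
    have step: "AE x in lebesgue. x \<in> ball x0 (\<rho> (Suc j)) \<longrightarrow> l j - l (Suc j) \<le> v x"
      if v: "local_solution K \<Omega> v"
        and vin: "AE y in lebesgue. \<forall>i\<le>j. y \<in> ball x0 (\<rho> i) \<longrightarrow> - v y \<le> l i - l j"
        and vout: "\<And>y. - v y \<le> \<bar>u y\<bar> + (L - l j)"
        and dens: "ennreal (unit_ball_vol ?n / 2 * \<rho> j ^ DIM('a)) \<le> emeasure lebesgue ({y. l j / 2 \<le> v y} \<inter> ball x0 (\<rho> j))"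
      for v :: "'a \<Rightarrow> real" and j
    proof -
      define z where "z x = 2 / l j * v x" for x
      have z: "local_solution K \<Omega> z"
        using local_solution_affine[OF v, of "2 / l j" 0] by (simp add: z_def[abs_def])
      have scale: "- z y \<le> 2 / l j * c" if "- v y \<le> c" for y c
      proof -
        have "2 / l j * (- v y) \<le> 2 / l j * c" using that l0[of j] by (intro mult_left_mono) auto
        then show ?thesis by (simp add: z_def)
      qed
      have "AE x in lebesgue. x \<in> ball x0 (\<rho> j / 4) \<longrightarrow> \<theta> \<le> z x"
      proof (rule growth[OF K z \<rho>0])
        show "ball x0 (\<rho> j) \<subseteq> \<Omega>" using B \<rho>r[of j] subset_ball[of "\<rho> j" r x0] by blast
        show "AE y in lebesgue. y \<in> ball x0 (\<rho> j) \<longrightarrow> 0 \<le> z y"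
          using vin
        proof eventually_elim
          case (elim y)
          then have "y \<in> ball x0 (\<rho> j) \<longrightarrow> - v y \<le> 0" by (metis order_refl diff_self)
          then show ?case using l0[of j] by (auto simp: z_def)
        qed
        have "{y. 1 \<le> z y} = {y. l j / 2 \<le> v y}" using l0[of j] by (auto simp: z_def field_simps)
        then show "ennreal (unit_ball_vol ?n / 2 * \<rho> j ^ DIM('a)) \<le> emeasure lebesgue ({y. 1 \<le> z y} \<inter> ball x0 (\<rho> j))"
          using dens by simp
        show "tail_int (\<lambda>y. max 0 (- z y) powr (p - 1)) x0 (\<rho> j)
          \<le> ennreal (\<epsilon>0 * \<rho> j powr (- (s * p)))"
        proof (rule tail)
          show "AE y in lebesgue. \<forall>i\<le>j. y \<in> ball x0 (\<rho> i) \<longrightarrow> - z y \<le> 2 / l j * (l i - l j)"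
            using vin by eventually_elim (use scale in blast)
          show "- z y \<le> 2 / l j * (\<bar>u y\<bar> + (L - l j))" for y by (rule scale[OF vout])
        qed
      qed
      then show ?thesis
      proof eventually_elim
        case (elim x)
        show ?case
        proof
          assume "x \<in> ball x0 (\<rho> (Suc j))"
          then have "\<theta> \<le> z x" using elim by (simp add: \<rho>_def)
          then have "\<theta> / 2 * l j \<le> v x" using l0[of j] by (simp add: z_def field_simps)
          moreover have "(1 - q) * l j \<le> \<theta> / 2 * l j" using q\<theta> l0[of j] by (intro mult_right_mono) auto
          ultimately show "l j - l (Suc j) \<le> v x" by (simp add: lS algebra_simps)
        qed
      qed
    qed
    (* The bounds on the larger balls are expressed through the current left endpoint m alone, so that the
       invariant needs no history of the nested intervals. *)
    define P where "P j m \<longleftrightarrow> - L / 2 \<le> m \<and> m + l j \<le> L / 2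
      \<and> (AE y in lebesgue. \<forall>i\<le>j. y \<in> ball x0 (\<rho> i) \<longrightarrow> m - (l i - l j) \<le> u y \<and> u y \<le> m + l i)" for j m
    \<comment> \<open>The induction starts from the interval between \<open>- L / 2\<close> and
      \<open>L / 2\<close>. Monotonicity of both endpoints is recorded because it forces a point
      common to all intervals.\<close>
    have "\<exists>m. \<forall>j. P j (m j) \<and> m j \<le> m (Suc j) \<and> m (Suc j) + l (Suc j) \<le> m j + l j"
    proof (rule dependent_nat_choice)
      have "AE y in lebesgue. \<forall>i\<le>0. y \<in> ball x0 (\<rho> i) \<longrightarrow> - L / 2 - (l i - l 0) \<le> u y \<and> u y \<le> - L / 2 + l i"
        using bd by eventually_elim (auto simp: \<rho>_def l_def)
      then show "\<exists>m. P 0 m" unfolding P_def by (intro exI[of _ "- L / 2"]) (auto simp: l_def)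
    next
      fix m j assume "P j m"
      then have m: "- L / 2 \<le> m" "m + l j \<le> L / 2"
        and ae: "AE y in lebesgue. \<forall>i\<le>j. y \<in> ball x0 (\<rho> i) \<longrightarrow> m - (l i - l j) \<le> u y \<and> u y \<le> m + l i"
        by (auto simp: P_def)
      have lle: "l (Suc j) \<le> l j" by (rule lmono) simp
      \<comment> \<open>Every value lies above or below the midpoint, so one of these sets fills
        half of the ball. The first lifts the left endpoint, the second lowers the right
        one.\<close>
      let ?E1 = "{y. l j / 2 \<le> u y - m} \<inter> ball x0 (\<rho> j)"
      let ?E2 = "{y. l j / 2 \<le> m + l j - u y} \<inter> ball x0 (\<rho> j)"
      define H where "H = unit_ball_vol ?n / 2 * \<rho> j ^ DIM('a)"
      have H0: "0 \<le> H" using \<omega> \<rho>0[of j] by (simp add: H_def \<omega>_def[symmetric])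
      have "ennreal H \<le> emeasure lebesgue ?E1 \<or> ennreal H \<le> emeasure lebesgue ?E2"
      proof (rule ccontr)
        assume "\<not> ?thesis"
        then have lt: "emeasure lebesgue ?E1 < ennreal H" "emeasure lebesgue ?E2 < ennreal H" by (simp_all only: de_Morgan_disj not_le)
        have "{y \<in> space lebesgue. l j / 2 \<le> u y - m} \<in> sets lebesgue" "{y \<in> space lebesgue. l j / 2 \<le> m + l j - u y} \<in> sets lebesgue"
          by measurable
        then have [measurable]: "?E1 \<in> sets lebesgue" "?E2 \<in> sets lebesgue" by simp_all
        have "emeasure lebesgue (ball x0 (\<rho> j)) \<le> emeasure lebesgue (?E1 \<union> ?E2)"
          by (rule emeasure_mono) (auto simp: field_simps)
        also have "\<dots> \<le> emeasure lebesgue ?E1 + emeasure lebesgue ?E2"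
          by (rule emeasure_subadditive) measurable
        also have "\<dots> < ennreal H + ennreal H" by (rule add_strict_mono[OF lt])
        also have "\<dots> = ennreal (2 * H)" using H0 by (simp add: ennreal_plus[symmetric] del: ennreal_plus)
        also have "ennreal (2 * H) = emeasure lebesgue (ball x0 (\<rho> j))"
          using \<rho>0[of j] by (simp add: emeasure_ball H_def)
        finally show False by simp
      qed
      then show "\<exists>m'. P (Suc j) m' \<and> m \<le> m' \<and> m' + l (Suc j) \<le> m + l j"
      proof
        assume E: "ennreal H \<le> emeasure lebesgue ?E1"
        have "AE x in lebesgue. x \<in> ball x0 (\<rho> (Suc j)) \<longrightarrow> l j - l (Suc j) \<le> u x - m"
        proof (rule step)
          show "local_solution K \<Omega> (\<lambda>x. u x - m)" using local_solution_affine[OF u, of 1 "- m"] by simp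
          show "AE y in lebesgue. \<forall>i\<le>j. y \<in> ball x0 (\<rho> i) \<longrightarrow> - (u y - m) \<le> l i - l j"
            using ae
          proof eventually_elim
            case (elim y)
            show ?case
            proof (intro allI impI)
              fix i assume "i \<le> j" "y \<in> ball x0 (\<rho> i)"
              then have "m - (l i - l j) \<le> u y" using elim by blast
              then show "- (u y - m) \<le> l i - l j" by linarith
            qed
          qed
          show "- (u y - m) \<le> \<bar>u y\<bar> + (L - l j)" for y using m L by linarith
          show "ennreal (unit_ball_vol ?n / 2 * \<rho> j ^ DIM('a)) \<le> emeasure lebesgue ?E1" using E by (simp add: H_def)
        qed
        \<comment> \<open>Lifting the left endpoint by \<open>l j - l (Suc j)\<close> leaves the
          lower bounds on the larger balls unchanged, since the shift cancels, and only relaxes the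
          upper ones.\<close>
        with ae have "AE y in lebesgue. \<forall>i\<le>Suc j. y \<in> ball x0 (\<rho> i) \<longrightarrow> (m + l j - l (Suc j)) - (l i - l (Suc j)) \<le> u y \<and> u y \<le> (m + l j - l (Suc j)) + l i"
        proof eventually_elim
          case (elim y)
          show ?case
          proof (intro allI impI)
            fix i assume i: "i \<le> Suc j" "y \<in> ball x0 (\<rho> i)"
            show "(m + l j - l (Suc j)) - (l i - l (Suc j)) \<le> u y \<and> u y \<le> (m + l j - l (Suc j)) + l i"
            proof (cases "i = Suc j")
              case True
              have "ball x0 (\<rho> (Suc j)) \<subseteq> ball x0 (\<rho> j)" using r by (intro subset_ball) (simp add: \<rho>_def field_simps)
              then have "u y \<le> m + l j" using elim(1) i True by blast
              then show ?thesis using elim(2) i True by auto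
            next
              case False
              then have "m - (l i - l j) \<le> u y \<and> u y \<le> m + l i" using i elim(1) by auto
              then show ?thesis using lle by auto
            qed
          qed
        qed
        then show ?thesis using m lle unfolding P_def by (intro exI[of _ "m + l j - l (Suc j)"]) auto
      next
        assume E: "ennreal H \<le> emeasure lebesgue ?E2"
        have "AE x in lebesgue. x \<in> ball x0 (\<rho> (Suc j)) \<longrightarrow> l j - l (Suc j) \<le> m + l j - u x"
        proof (rule step)
          show "local_solution K \<Omega> (\<lambda>x. m + l j - u x)" using local_solution_affine[OF u, of "-1" "m + l j"] by simp
          show "AE y in lebesgue. \<forall>i\<le>j. y \<in> ball x0 (\<rho> i) \<longrightarrow> - (m + l j - u y) \<le> l i - l j"
            using ae
          proof eventually_elim
            case (elim y)
            show ?case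
            proof (intro allI impI)
              fix i assume "i \<le> j" "y \<in> ball x0 (\<rho> i)"
              then have "u y \<le> m + l i" using elim by blast
              then show "- (m + l j - u y) \<le> l i - l j" by linarith
            qed
          qed
          show "- (m + l j - u y) \<le> \<bar>u y\<bar> + (L - l j)" for y using m L by linarith
          show "ennreal (unit_ball_vol ?n / 2 * \<rho> j ^ DIM('a)) \<le> emeasure lebesgue ?E2" using E by (simp add: H_def)
        qed
        with ae have "AE y in lebesgue. \<forall>i\<le>Suc j. y \<in> ball x0 (\<rho> i) \<longrightarrow> m - (l i - l (Suc j)) \<le> u y \<and> u y \<le> m + l i"
        proof eventually_elim
          case (elim y)
          show ?case
          proof (intro allI impI)
            fix i assume i: "i \<le> Suc j" "y \<in> ball x0 (\<rho> i)"
            show "m - (l i - l (Suc j)) \<le> u y \<and> u y \<le> m + l i"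
            proof (cases "i = Suc j")
              case True
              have "ball x0 (\<rho> (Suc j)) \<subseteq> ball x0 (\<rho> j)" using r by (intro subset_ball) (simp add: \<rho>_def field_simps)
              then have "m - (l j - l j) \<le> u y" using elim(1) i True by blast
              then show ?thesis using elim(2) i True by auto
            next
              case False
              then have j: "i \<le> j" using i by simp
              then have "m - (l i - l j) \<le> u y \<and> u y \<le> m + l i" using i elim(1) by auto
              then show ?thesis using lle by auto
            qed
          qed
        qed
        then show ?thesis using m lle unfolding P_def by (intro exI[of _ m]) auto
      qed
    qed
    then obtain m where m: "\<And>j. P j (m j)" "\<And>j. m j \<le> m (Suc j)" "\<And>j. m (Suc j) + l (Suc j) \<le> m j + l j"
      by blast
    have inc: "m i \<le> m j" if "i \<le> j" for i j using that by (rule lift_Suc_mono_le[of m, OF m(2)])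
    have dec: "m j + l j \<le> m i + l i" if "i \<le> j" for i j
      using that by (rule lift_Suc_antimono_le[of "\<lambda>j. m j + l j", OF m(3)])
    have cross: "m i \<le> m j + l j" for i j
    proof (cases "i \<le> j")
      case True then show ?thesis using inc[OF True] l0[of j] by simp
    next
      case False then have "j \<le> i" by simp
      then show ?thesis using dec[of j i] l0[of i] by simp
    qed
    \<comment> \<open>Every left endpoint lies below every right endpoint, so the supremum belongs
      to all intervals.\<close>
    define a where "a = (SUP j. m j)"
    have bdd: "bdd_above (range m)" using cross[of _ 0] by (intro bdd_aboveI2)
    have am: "m j \<le> a" "a \<le> m j + l j" for j
      unfolding a_def using bdd cross by (auto intro!: cSUP_upper cSUP_least)
    have "\<bar>a\<bar> \<le> L / 2"
      using am[of 0] m(1)[of 0] unfolding P_def by (auto simp: abs_le_iff)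
    moreover have "AE x in lebesgue. x \<in> ball x0 d \<longrightarrow> \<bar>u x - a\<bar> \<le> 4 powr \<alpha> * L * (d / r) powr \<alpha>"
      if d: "0 < d" "d \<le> r" for d
    proof -
      have "(\<lambda>j. r * (1/4) ^ j) \<longlonglongrightarrow> r * 0" by (intro tendsto_mult tendsto_const LIMSEQ_realpow_zero) auto
      then have "eventually (\<lambda>j. r * (1/4) ^ j < d) sequentially" using d by (intro order_tendstoD) auto
      then obtain j where "r * (1/4) ^ j < d" by (auto simp: eventually_sequentially)
      then have ex: "\<rho> j < d" by (simp add: \<rho>_def power_divide)
      \<comment> \<open>Then \<open>d\<close> lies between two consecutive radii. The invariant is
        read off at the larger one while \<open>(d / r) powr \<alpha>\<close> is compared with the
        smaller one; this is the origin of the factor \<open>4 powr \<alpha>\<close>.\<close>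
      define N where "N = (LEAST j. \<rho> j < d)"
      have N: "\<rho> N < d" unfolding N_def using ex by (rule LeastI)
      have "N \<noteq> 0" using N d by (intro notI) (simp add: \<rho>_def)
      then obtain j where j: "N = Suc j" by (cases N) auto
      have dj: "d \<le> \<rho> j" using not_less_Least[of j "\<lambda>j. \<rho> j < d"] j unfolding N_def by simp
      have le: "l j \<le> 4 powr \<alpha> * L * (d / r) powr \<alpha>"
      proof -
        have "l j = L * 4 powr \<alpha> * q ^ Suc j" by (simp add: l_def q_def powr_minus)
        also have "q ^ Suc j \<le> (d / r) powr \<alpha>"
          unfolding q4 using N r \<alpha>0 unfolding j \<rho>_def by (intro powr_mono2) (auto simp: field_simps)
        then have "L * 4 powr \<alpha> * q ^ Suc j \<le> L * 4 powr \<alpha> * (d / r) powr \<alpha>"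
          using L by (intro mult_left_mono) auto
        finally show ?thesis by (simp add: mult_ac)
      qed
      have "AE y in lebesgue. \<forall>i\<le>j. y \<in> ball x0 (\<rho> i) \<longrightarrow> m j - (l i - l j) \<le> u y \<and> u y \<le> m j + l i"
        using m(1)[of j] by (simp add: P_def)
      then show ?thesis
      proof eventually_elim
        case (elim y)
        show ?case
        proof
          assume "y \<in> ball x0 d"
          then have "y \<in> ball x0 (\<rho> j)" using dj by auto
          then have "m j - (l j - l j) \<le> u y \<and> u y \<le> m j + l j" using elim by blast
          then show "\<bar>u y - a\<bar> \<le> 4 powr \<alpha> * L * (d / r) powr \<alpha>"
            using am[of j] le by auto
        qed
      qed
    qed
    ultimately show "\<exists>a. decays \<alpha> L u x0 r a"
      by blast
  qed
qed

end

section \<open>Essential oscillation, local boundedness and the tail\<close>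

lemma ess_osc_le:
  fixes u :: "'a::euclidean_space \<Rightarrow> real"
  assumes [measurable]: "u \<in> borel_measurable lebesgue"
    and ae: "AE x in lebesgue. x \<in> ball c \<rho> \<longrightarrow> \<bar>u x - a\<bar> \<le> h"
  shows "ess_osc u (ball c \<rho>) \<le> ereal (2 * h)"
proof -
  let ?M = "restrict_space lebesgue (ball c \<rho>)"
  have um[measurable]: "u \<in> borel_measurable ?M" by (rule measurable_restrict_space1) measurable
  have ae': "AE x in ?M. \<bar>u x - a\<bar> \<le> h"
    using ae by (subst AE_restrict_space_iff) auto
  have 1: "esssup ?M (\<lambda>x. ereal (u x)) \<le> ereal (a + h)"
  proof (rule esssup_I)
    show "AE x in ?M. ereal (u x) \<le> ereal (a + h)" using ae' by eventually_elim auto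
  qed measurable
  have 2: "esssup ?M (\<lambda>x. - ereal (u x)) \<le> ereal (h - a)"
  proof (rule esssup_I)
    show "AE x in ?M. - ereal (u x) \<le> ereal (h - a)" using ae' by eventually_elim auto
  qed measurable
  have "ess_osc u (ball c \<rho>) = esssup ?M (\<lambda>x. ereal (u x)) + esssup ?M (\<lambda>x. - ereal (u x))"
    by (simp add: ess_osc_def minus_ereal_def)
  also have "\<dots> \<le> ereal (a + h) + ereal (h - a)" by (rule add_mono[OF 1 2])
  finally show ?thesis by simp
qed

lemma AE_ball_exists:
  assumes "AE x in lebesgue. x \<in> ball (c::'a::euclidean_space) \<rho> \<longrightarrow> P x" "0 < \<rho>"
  shows "\<exists>x\<in>ball c \<rho>. P x"
proof (rule ccontr)
  assume "\<not> ?thesis"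
  then have "AE x in lebesgue. x \<notin> ball c \<rho>" using assms(1) by (auto elim: eventually_mono)
  then have "emeasure lebesgue (ball c \<rho>) = 0"
    by (subst (asm) AE_iff_measurable[of "ball c \<rho>"]) auto
  moreover have "0 < unit_ball_vol (real DIM('a)) * \<rho> ^ DIM('a)"
    using assms(2) unit_ball_vol_real_pos[of "DIM('a)"] by simp
  ultimately show False using assms(2)
    by (simp add: emeasure_ball del: mult_less_0_iff zero_less_mult_iff)
qed

context frac_kernel
begin

text \<open>Integral smallness becomes the pointwise bound by applying \<open>de_giorgi\<close> to
  \<open>2 * u / L\<close> and \<open>- 2 * u / L\<close> on the ball of radius
  \<open>2 * r\<close>, whose half is the ball of radius \<open>r\<close>. The constant
  \<open>\<epsilon>\<close> is inherited and merely fixes \<open>H\<close>; only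
  \<open>\<delta>\<close> has to adapt.\<close>

lemma oscillation_decay_lp:
  obtains \<alpha> \<epsilon> \<delta> where "0 < \<alpha>" "\<alpha> < s * p / (p - 1)" "0 < \<epsilon>" "0 < \<delta>"
    "\<And>(K::'a::euclidean_space \<Rightarrow> 'a \<Rightarrow> real) \<Omega> u x0 r L.
     admissible_kernel s p lam Lam K \<Longrightarrow> local_solution K \<Omega> u \<Longrightarrow> 0 < r \<Longrightarrow> ball x0 (2 * r) \<subseteq> \<Omega> \<Longrightarrow> 0 < L
     \<Longrightarrow> ball_int (\<lambda>x. \<bar>u x\<bar> powr p) x0 (2 * r) \<le> ennreal (\<delta> * L powr p * r ^ DIM('a))
     \<Longrightarrow> tail_int (\<lambda>y. \<bar>u y\<bar> powr (p - 1)) x0 r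
          \<le> ennreal (\<epsilon> * L powr (p - 1) * r powr (- (s * p)))
     \<Longrightarrow> \<exists>a. decays \<alpha> L u x0 r a"
proof -
  obtain \<alpha> \<epsilon> where g: "0 < \<alpha>" "\<alpha> < s * p / (p - 1)" "0 < \<epsilon>" and osc:
    "\<And>(K::'a \<Rightarrow> 'a \<Rightarrow> real) \<Omega> u x0 r L.
     admissible_kernel s p lam Lam K \<Longrightarrow> local_solution K \<Omega> u \<Longrightarrow> 0 < r \<Longrightarrow> ball x0 r \<subseteq> \<Omega> \<Longrightarrow> 0 < L
     \<Longrightarrow> (AE x in lebesgue. x \<in> ball x0 r \<longrightarrow> \<bar>u x\<bar> \<le> L / 2)
     \<Longrightarrow> tail_int (\<lambda>y. \<bar>u y\<bar> powr (p - 1)) x0 r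
          \<le> ennreal (\<epsilon> * L powr (p - 1) * r powr (- (s * p)))
     \<Longrightarrow> \<exists>a. decays \<alpha> L u x0 r a"
  proof (rule oscillation_decay[where 'a='a], goal_cases)
    case (1 \<alpha> \<epsilon>)
    show ?case by (rule 1(1)[OF 1(2-4)]) (rule 1(5))
  qed
  define H where "H = 2 powr (p - 1) * 2 powr (s * p) * \<epsilon>"
  have H: "0 \<le> H" using g by (simp add: H_def)
  obtain \<nu> where \<nu>: "0 < \<nu>" "\<And>(K::'a \<Rightarrow> 'a \<Rightarrow> real) \<Omega> v x0 R.
     admissible_kernel s p lam Lam K \<Longrightarrow> local_solution K \<Omega> v \<Longrightarrow> 0 < R \<Longrightarrow> ball x0 R \<subseteq> \<Omega>
     \<Longrightarrow> tail_int (\<lambda>y. max 0 (v y) powr (p - 1)) x0 (R / 2)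
          \<le> ennreal (H * R powr (- (s * p)))
     \<Longrightarrow> ball_int (\<lambda>x. max 0 (v x) powr p) x0 R \<le> ennreal (\<nu> * R ^ DIM('a))
     \<Longrightarrow> (AE x in lebesgue. x \<in> ball x0 (R / 2) \<longrightarrow> v x \<le> 1)"
  proof (rule de_giorgi[OF H, where 'a='a], goal_cases)
    case (1 \<nu>)
    show ?case by (rule 1(1)[OF 1(2)]) (rule 1(3))
  qed
  define \<delta> where "\<delta> = \<nu> * 2 ^ DIM('a) / 2 powr p"
  have \<delta>: "0 < \<delta>" using \<nu>(1) by (simp add: \<delta>_def)
  show ?thesis
  proof (rule that[OF g \<delta>])
    fix K :: "'a \<Rightarrow> 'a \<Rightarrow> real" and \<Omega> :: "'a set" and u :: "'a \<Rightarrow> real" and x0 :: 'a and r L :: real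
    assume K: "admissible_kernel s p lam Lam K" and u: "local_solution K \<Omega> u"
      and r: "0 < r" and B: "ball x0 (2 * r) \<subseteq> \<Omega>" and L: "0 < L"
      and lp: "ball_int (\<lambda>x. \<bar>u x\<bar> powr p) x0 (2 * r) \<le> ennreal (\<delta> * L powr p * r ^ DIM('a))"
      and tl: "tail_int (\<lambda>y. \<bar>u y\<bar> powr (p - 1)) x0 r
          \<le> ennreal (\<epsilon> * L powr (p - 1) * r powr (- (s * p)))"
    have um[measurable]: "u \<in> borel_measurable lebesgue" using u by (simp add: local_solution_def)
    have bound: "AE x in lebesgue. x \<in> ball x0 r \<longrightarrow> 2 * \<sigma> / L * u x \<le> 1" if \<sigma>: "\<bar>\<sigma>\<bar> = 1" for \<sigma> :: real
    proof -
      define v where "v x = 2 * \<sigma> / L * u x" for x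
      have v: "local_solution K \<Omega> v"
        using local_solution_affine[OF u, of "2 * \<sigma> / L" 0] by (simp add: v_def[abs_def])
      have vq: "max 0 (v y) powr q \<le> (2 / L) powr q * \<bar>u y\<bar> powr q" if "0 \<le> q" for q y
      proof -
        have "max 0 (v y) powr q \<le> \<bar>v y\<bar> powr q" using that by (rule max_powr_le)
        also have "\<bar>v y\<bar> = 2 / L * \<bar>u y\<bar>" using \<sigma> L by (simp add: v_def abs_mult)
        also have "(2 / L * \<bar>u y\<bar>) powr q = (2 / L) powr q * \<bar>u y\<bar> powr q" by (rule powr_mult)
        finally show ?thesis .
      qed
      have "AE x in lebesgue. x \<in> ball x0 (2 * r / 2) \<longrightarrow> v x \<le> 1"
      proof (rule \<nu>(2)[OF K v _ B])
        have "tail_int (\<lambda>y. max 0 (v y) powr (p - 1)) x0 r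
          \<le> ennreal ((2 / L) powr (p - 1) * (\<epsilon> * L powr (p - 1) * r powr (- (s * p))))"
        proof (rule nn_integral_on_le[OF tl])
          have "max 0 (v y) powr (p - 1) * rker (s * p) (y - x0) \<le> (2 / L) powr (p - 1) * (\<bar>u y\<bar> powr (p - 1) * rker (s * p) (y - x0))" for y
            using mult_right_mono[OF vq[of "p - 1" y] rker_nonneg[of "s * p" "y - x0"]] p_gt by (simp add: mult.assoc)
          then show "AE y in lebesgue. y \<in> - ball x0 r \<longrightarrow> max 0 (v y) powr (p - 1) * rker (s * p) (y - x0)
            \<le> (2 / L) powr (p - 1) * (\<bar>u y\<bar> powr (p - 1) * rker (s * p) (y - x0))"
            by simp
        qed auto
        also have "(2 / L) powr (p - 1) * (\<epsilon> * L powr (p - 1) * r powr (- (s * p))) = H * (2 * r) powr (- (s * p))"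
        proof -
          have "(2 * r) powr (- (s * p)) = 2 powr (- (s * p)) * r powr (- (s * p))" by (rule powr_mult)
          moreover have "2 powr (s * p) * 2 powr (- (s * p)) = (1::real)" by (simp add: powr_minus)
          moreover have "(2 / L) powr (p - 1) = 2 powr (p - 1) / L powr (p - 1)" using L by (simp add: powr_divide)
          ultimately show ?thesis using L by (simp add: H_def)
        qed
        finally show "tail_int (\<lambda>y. max 0 (v y) powr (p - 1)) x0 (2 * r / 2)
          \<le> ennreal (H * (2 * r) powr (- (s * p)))" by simp
      next
        have "ball_int (\<lambda>x. max 0 (v x) powr p) x0 (2 * r) \<le> ennreal ((2 / L) powr p * (\<delta> * L powr p * r ^ DIM('a)))"
          by (rule nn_integral_on_le[OF lp]) (use vq p_gt in auto)
        also have "(2 / L) powr p * (\<delta> * L powr p * r ^ DIM('a)) = \<nu> * (2 * r) ^ DIM('a)"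
        proof -
          have "(2 / L) powr p = 2 powr p / L powr p" using L by (simp add: powr_divide)
          then show ?thesis using L by (simp add: \<delta>_def power_mult_distrib)
        qed
        finally show "ball_int (\<lambda>x. max 0 (v x) powr p) x0 (2 * r) \<le> ennreal (\<nu> * (2 * r) ^ DIM('a))" .
      qed (use r in simp)
      then show ?thesis by (simp add: v_def)
    qed
    have b1: "AE x in lebesgue. x \<in> ball x0 r \<longrightarrow> 2 * 1 / L * u x \<le> 1" by (rule bound) simp
    have b2: "AE x in lebesgue. x \<in> ball x0 r \<longrightarrow> 2 * (- 1) / L * u x \<le> 1" by (rule bound) simp
    have "AE x in lebesgue. x \<in> ball x0 r \<longrightarrow> \<bar>u x\<bar> \<le> L / 2"
      using b1 b2
    proof eventually_elim
      case (elim x)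
      then show ?case using L by (auto simp: abs_le_iff field_simps)
    qed
    moreover have "ball x0 r \<subseteq> \<Omega>" using B r subset_ball[of r "2 * r" x0] by auto
    ultimately show "\<exists>a. decays \<alpha> L u x0 r a"
      using K u r L tl by (intro osc) auto
  qed
qed

text \<open>Splitting by \<open>\<bar>u\<bar> powr (p - 1) \<le> 1 + \<bar>u\<bar> powr p\<close>
  separates the kernel integral from the global norm. This shows that the tail is finite and, as the
  bound does not depend on the centre, gives one oscillation constant for all balls of a given
  radius.\<close>

lemma tail_integral_bound:
  "\<exists>C>0. \<forall>(u::'a::euclidean_space \<Rightarrow> real) x0 r. u \<in> frac_sobolev s p \<and> 0 < r \<longrightarrow>
     tail_int (\<lambda>y. \<bar>u y\<bar> powr (p - 1)) x0 r
      \<le> ennreal (C * r powr (- (s * p)) + r powr (- (real DIM('a) + s * p)) * (\<integral>x. \<bar>u x\<bar> powr p \<partial>lebesgue))"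
proof -
  obtain Cf where Cf: "Cf > 0" "\<And>(x0::'a) r. 0 < r \<Longrightarrow>
    far_int (\<lambda>y. rker (s * p) (y - x0)) x0 r \<le> ennreal (Cf * r powr (-(s * p)))"
    using rker_integral_far[OF sp_pos] by blast
  have "tail_int (\<lambda>y. \<bar>u y\<bar> powr (p - 1)) x0 r
      \<le> ennreal (Cf * r powr (- (s * p)) + r powr (- (real DIM('a) + s * p)) * (\<integral>x. \<bar>u x\<bar> powr p \<partial>lebesgue))"
    if u: "u \<in> frac_sobolev s p" and r: "0 < r" for u :: "'a \<Rightarrow> real" and x0 r
  proof -
    let ?q = "real DIM('a) + s * p"
    have [measurable]: "u \<in> borel_measurable lebesgue" and ui: "integrable lebesgue (\<lambda>x. \<bar>u x\<bar> powr p)"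
      using u by (auto simp: frac_sobolev_def)
    have "tail_int (\<lambda>y. \<bar>u y\<bar> powr (p - 1)) x0 r
      \<le> (\<integral>\<^sup>+ y. ennreal (rker (s * p) (y - x0)) * indicator (- ball x0 r) y + ennreal (r powr (- ?q)) * ennreal (\<bar>u y\<bar> powr p) \<partial>lebesgue)"
    proof (rule nn_integral_mono)
      fix y
      show "ennreal (\<bar>u y\<bar> powr (p - 1) * rker (s * p) (y - x0)) * indicator (- ball x0 r) y
        \<le> ennreal (rker (s * p) (y - x0)) * indicator (- ball x0 r) y + ennreal (r powr (- ?q)) * ennreal (\<bar>u y\<bar> powr p)"
      proof (cases "y \<in> ball x0 r")
        case False
        have k: "rker (s * p) (y - x0) \<le> r powr (- ?q)"
          using False r sp_pos by (intro rker_antimono) (auto simp: dist_norm norm_minus_commute)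
        have w: "\<bar>u y\<bar> powr (p - 1) \<le> 1 + \<bar>u y\<bar> powr p"
        proof (cases "\<bar>u y\<bar> \<le> 1")
          case True
          then have "\<bar>u y\<bar> powr (p - 1) \<le> 1" using p_gt by (intro powr_le1) auto
          then show ?thesis by (simp add: add_increasing2)
        next
          case False
          then have "\<bar>u y\<bar> powr (p - 1) \<le> \<bar>u y\<bar> powr p" by (intro powr_mono) auto
          then show ?thesis by simp
        qed
        have "\<bar>u y\<bar> powr (p - 1) * rker (s * p) (y - x0) \<le> (1 + \<bar>u y\<bar> powr p) * rker (s * p) (y - x0)"
          by (intro mult_right_mono w) simp
        also have "\<dots> \<le> rker (s * p) (y - x0) + r powr (- ?q) * \<bar>u y\<bar> powr p"
          using mult_right_mono[OF k, of "\<bar>u y\<bar> powr p"] by (simp add: algebra_simps)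
        finally show ?thesis using False
          by (simp add: ennreal_mult'[symmetric] ennreal_plus[symmetric] ennreal_leI del: ennreal_plus)
      qed simp
    qed
    also have "\<dots> = far_int (\<lambda>y. rker (s * p) (y - x0)) x0 r
        + ennreal (r powr (- ?q)) * (\<integral>\<^sup>+ y. ennreal (\<bar>u y\<bar> powr p) \<partial>lebesgue)"
      by (subst nn_integral_add, measurable, subst nn_integral_cmult, measurable)
    also have "(\<integral>\<^sup>+ y. ennreal (\<bar>u y\<bar> powr p) \<partial>lebesgue) = ennreal (\<integral>x. \<bar>u x\<bar> powr p \<partial>lebesgue)"
      by (rule nn_integral_eq_integral[OF ui]) simp
    also have "far_int (\<lambda>y. rker (s * p) (y - x0)) x0 r + ennreal (r powr (- ?q)) * ennreal (\<integral>x. \<bar>u x\<bar> powr p \<partial>lebesgue)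
      \<le> ennreal (Cf * r powr (- (s * p))) + ennreal (r powr (- ?q)) * ennreal (\<integral>x. \<bar>u x\<bar> powr p \<partial>lebesgue)"
      by (intro add_right_mono Cf(2) r)
    also have "\<dots> = ennreal (Cf * r powr (- (s * p)) + r powr (- ?q) * (\<integral>x. \<bar>u x\<bar> powr p \<partial>lebesgue))"
      using Cf(1) by (simp add: ennreal_mult'[symmetric] ennreal_plus[symmetric] del: ennreal_plus)
    finally show ?thesis .
  qed
  then show ?thesis using Cf(1) by blast
qed

text \<open>\<open>tail\<close> is built on a Bochner integral, which would be 0 for a divergent
  tail. The finiteness just obtained makes it agree with the extended integral of the
  estimates.\<close>

lemma tail_eq:
  fixes u :: "'a::euclidean_space \<Rightarrow> real"
  assumes u: "u \<in> frac_sobolev s p" and r: "0 < r"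
  shows "tail_int (\<lambda>y. \<bar>u y\<bar> powr (p - 1)) x0 r
    = ennreal (r powr (- (s * p)) * tail s p u x0 r powr (p - 1))"
proof -
  have [measurable]: "u \<in> borel_measurable lebesgue" using u by (auto simp: frac_sobolev_def)
  let ?f = "\<lambda>y. indicator (- ball x0 r) y * (\<bar>u y\<bar> powr (p - 1) * rker (s * p) (y - x0))"
  have eq: "tail_int (\<lambda>y. \<bar>u y\<bar> powr (p - 1)) x0 r
    = (\<integral>\<^sup>+ y. ennreal (?f y) \<partial>lebesgue)"
    by (intro nn_integral_cong) (auto simp: indicator_def)
  obtain C where "\<And>(u::'a \<Rightarrow> real) x0 r. u \<in> frac_sobolev s p \<Longrightarrow> 0 < r \<Longrightarrow>
     tail_int (\<lambda>y. \<bar>u y\<bar> powr (p - 1)) x0 r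
      \<le> ennreal (C * r powr (- (s * p)) + r powr (- (real DIM('a) + s * p)) * (\<integral>x. \<bar>u x\<bar> powr p \<partial>lebesgue))"
    using tail_integral_bound[where 'a='a] by blast
  from this[OF u r, of x0] have fin: "(\<integral>\<^sup>+ y. ennreal (?f y) \<partial>lebesgue) < \<infinity>"
    unfolding eq by (rule le_less_trans) simp
  have int: "integrable lebesgue ?f"
    using fin by (intro integrableI_nonneg) auto
  define I where "I = (\<integral>y. ?f y \<partial>lebesgue)"
  have I0: "0 \<le> I" unfolding I_def by (intro Bochner_Integration.integral_nonneg) simp
  have "tail s p u x0 r = (r powr (s * p) * I) powr (1 / (p - 1))"
    unfolding tail_def set_lebesgue_integral_def I_def rker_def Compl_eq_Diff_UNIV by simp
  then have "tail s p u x0 r powr (p - 1) = r powr (s * p) * I"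
    using p_gt I0 by (simp add: powr_powr)
  then have "r powr (- (s * p)) * tail s p u x0 r powr (p - 1) = I"
    using r by (simp add: powr_minus mult.assoc[symmetric])
  then show ?thesis
    unfolding eq using nn_integral_eq_integral[OF int] by (simp add: I_def)
qed

end

section \<open>The continuous representative and the theorem\<close>

text \<open>The constant \<open>L\<close> may depend on the radius but not on the centre; this
  uniformity turns decay at each point into a modulus of continuity. All radii are required because
  compact sets may come arbitrarily close to the boundary.\<close>

lemma holder_representative:
  fixes u :: "'a::euclidean_space \<Rightarrow> real"
  assumes \<Omega>: "open \<Omega>" and \<alpha>: "0 < \<alpha>"
    and h: "\<And>R. 0 < R \<Longrightarrow> \<exists>L>0. \<forall>x. ball x (2 * R) \<subseteq> \<Omega> \<longrightarrow> (\<exists>a. decays \<alpha> L u x R a)"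
  shows "\<exists>v. (AE x in lebesgue. u x = v x) \<and> locally_holder_on \<Omega> \<alpha> v"
proof -
  \<comment> \<open>The essential limit of \<open>u\<close> at \<open>x\<close>, unique because
    balls have positive measure.\<close>
  define good where "good x a \<longleftrightarrow> (\<forall>e>0. \<exists>d>0. AE y in lebesgue. y \<in> ball x d \<longrightarrow> \<bar>u y - a\<bar> \<le> e)" for x a
  have uniq: "a = b" if g: "good x a" "good x b" for x a b
  proof (rule ccontr)
    assume "a \<noteq> b"
    define t where "t = \<bar>a - b\<bar>"
    have e: "0 < t / 3" using \<open>a \<noteq> b\<close> by (simp add: t_def)
    obtain d1 where d1: "0 < d1" "AE y in lebesgue. y \<in> ball x d1 \<longrightarrow> \<bar>u y - a\<bar> \<le> t / 3"
      using g(1)[unfolded good_def, rule_format, OF e] by blast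
    obtain d2 where d2: "0 < d2" "AE y in lebesgue. y \<in> ball x d2 \<longrightarrow> \<bar>u y - b\<bar> \<le> t / 3"
      using g(2)[unfolded good_def, rule_format, OF e] by blast
    have ae: "AE y in lebesgue. y \<in> ball x (min d1 d2) \<longrightarrow> \<bar>u y - a\<bar> \<le> t / 3 \<and> \<bar>u y - b\<bar> \<le> t / 3"
      using d1(2) d2(2) by eventually_elim auto
    have "0 < min d1 d2" using d1(1) d2(1) by simp
    from AE_ball_exists[OF ae this] obtain y where "\<bar>u y - a\<bar> \<le> t / 3" "\<bar>u y - b\<bar> \<le> t / 3"
      by blast
    moreover have "t \<le> \<bar>u y - a\<bar> + \<bar>u y - b\<bar>" unfolding t_def by linarith
    ultimately show False using e by linarith
  qed
  \<comment> \<open>Keeping \<open>u\<close> outside the open set reduces equality almost everywhere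
    to the compact subsets exhausting it.\<close>
  define v where "v x = (if x \<in> \<Omega> then (SOME a. good x a) else u x)" for x
  have est: "\<exists>L>0. \<forall>x. ball x (2 * R) \<subseteq> \<Omega> \<longrightarrow> decays \<alpha> L u x R (v x)" if R: "0 < R" for R
  proof -
    obtain L where L: "0 < L" and hL: "\<And>x. ball x (2 * R) \<subseteq> \<Omega> \<Longrightarrow> (\<exists>a. decays \<alpha> L u x R a)"
      using h[OF R] by blast
    have "decays \<alpha> L u x R (v x)"
      if x: "ball x (2 * R) \<subseteq> \<Omega>" for x
    proof -
      obtain a where a: "\<bar>a\<bar> \<le> L / 2" "\<And>\<rho>. 0 < \<rho> \<Longrightarrow> \<rho> \<le> R \<Longrightarrow>
            (AE y in lebesgue. y \<in> ball x \<rho> \<longrightarrow> \<bar>u y - a\<bar> \<le> 4 powr \<alpha> * L * (\<rho> / R) powr \<alpha>)"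
        using hL[OF x] by blast
      have "good x a"
        unfolding good_def
      proof (intro allI impI)
        fix e :: real assume e: "0 < e"
        define q where "q = min 1 ((e / (4 powr \<alpha> * L)) powr (1 / \<alpha>))"
        have q: "0 < q" "q \<le> 1" using e L by (auto simp: q_def)
        have "q powr \<alpha> \<le> ((e / (4 powr \<alpha> * L)) powr (1 / \<alpha>)) powr \<alpha>"
          using q \<alpha> by (intro powr_mono2) (auto simp: q_def)
        also have "\<dots> = e / (4 powr \<alpha> * L)" using \<alpha> e L by (simp add: powr_powr)
        finally have "4 powr \<alpha> * L * q powr \<alpha> \<le> 4 powr \<alpha> * L * (e / (4 powr \<alpha> * L))"
          using L by (intro mult_left_mono) auto
        also have "\<dots> = e" using L by simp
        finally have qe: "4 powr \<alpha> * L * q powr \<alpha> \<le> e" .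
        have "AE y in lebesgue. y \<in> ball x (q * R) \<longrightarrow> \<bar>u y - a\<bar> \<le> 4 powr \<alpha> * L * (q * R / R) powr \<alpha>"
          using q R by (intro a(2)) (auto simp: mult_le_cancel_right1)
        then have "AE y in lebesgue. y \<in> ball x (q * R) \<longrightarrow> \<bar>u y - a\<bar> \<le> e"
          by eventually_elim (use qe R in auto)
        then show "\<exists>d>0. AE y in lebesgue. y \<in> ball x d \<longrightarrow> \<bar>u y - a\<bar> \<le> e"
          using q R by (intro exI[of _ "q * R"]) auto
      qed
      moreover have "x \<in> \<Omega>" using x R by (auto simp: subset_iff)
      ultimately have "v x = a" using uniq someI[of "good x" a] by (auto simp: v_def)
      then show ?thesis using a by auto
    qed
    then show ?thesis using L by blast
  qed
  define M where "M R L = 2 * (4 powr \<alpha> * L) * (2 / R) powr \<alpha>" for R L :: real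
  have pair: "\<bar>v x - v y\<bar> \<le> M R L * norm (x - y) powr \<alpha>"
    if R: "0 < R" and L: "0 < L" and
      est: "\<And>x. ball x (2 * R) \<subseteq> \<Omega> \<Longrightarrow> decays \<alpha> L u x R (v x)"
      and xy: "ball x (2 * R) \<subseteq> \<Omega>" "ball y (2 * R) \<subseteq> \<Omega>" for R L x y
  proof (cases "x = y")
    case False
    define d where "d = norm (x - y)"
    have d: "0 < d" using False by (simp add: d_def)
    have Md: "M R L * d powr \<alpha> = 2 * (4 powr \<alpha> * L) * (2 * d / R) powr \<alpha>"
      using powr_mult[of "2 / R" d \<alpha>] by (simp add: M_def)
    show ?thesis
    \<comment> \<open>Nearby points are compared through a point of the ball around \<open>y\<close>
      that lies in both ranges of decay. For distant ones the bound \<open>L / 2\<close> on each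
      value is enough, since \<open>2 * d / R\<close> exceeds 1.\<close>
    proof (cases "2 * d \<le> R")
      case True
      have 1: "AE z in lebesgue. z \<in> ball x (2 * d) \<longrightarrow> \<bar>u z - v x\<bar> \<le> 4 powr \<alpha> * L * (2 * d / R) powr \<alpha>"
        using est[OF xy(1)] d True by auto
      have 2: "AE z in lebesgue. z \<in> ball y d \<longrightarrow> \<bar>u z - v y\<bar> \<le> 4 powr \<alpha> * L * (d / R) powr \<alpha>"
        using est[OF xy(2)] d True by auto
      have ae: "AE z in lebesgue. z \<in> ball y d \<longrightarrow> \<bar>u z - v x\<bar> \<le> 4 powr \<alpha> * L * (2 * d / R) powr \<alpha> \<and> \<bar>u z - v y\<bar> \<le> 4 powr \<alpha> * L * (d / R) powr \<alpha>"
        using 1 2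
      proof eventually_elim
        case (elim z)
        have "z \<in> ball x (2 * d)" if "z \<in> ball y d"
          using that dist_triangle[of x z y] by (simp add: d_def dist_norm)
        then show ?case using elim by blast
      qed
      from AE_ball_exists[OF ae d] obtain z where z: "\<bar>u z - v x\<bar> \<le> 4 powr \<alpha> * L * (2 * d / R) powr \<alpha>" "\<bar>u z - v y\<bar> \<le> 4 powr \<alpha> * L * (d / R) powr \<alpha>"
        by blast
      have "4 powr \<alpha> * L * (d / R) powr \<alpha> \<le> 4 powr \<alpha> * L * (2 * d / R) powr \<alpha>"
        using L d R \<alpha> by (intro mult_left_mono powr_mono2) (auto simp: field_simps)
      then have "\<bar>v x - v y\<bar> \<le> 2 * (4 powr \<alpha> * L) * (2 * d / R) powr \<alpha>" using z by linarith
      then show ?thesis using Md by (simp add: d_def)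
    next
      case False
      have "\<bar>v x\<bar> \<le> L / 2" "\<bar>v y\<bar> \<le> L / 2" using est[OF xy(1)] est[OF xy(2)] by auto
      then have "\<bar>v x - v y\<bar> \<le> L" by linarith
      also have "\<dots> \<le> 2 * (4 powr \<alpha> * L) * (2 * d / R) powr \<alpha>"
      proof -
        have "1 \<le> (2 * d / R) powr \<alpha>" using False R \<alpha> by (intro ge_one_powr_ge_zero) (auto simp: field_simps)
        moreover have "1 \<le> 4 powr \<alpha>" using \<alpha> by (intro ge_one_powr_ge_zero) auto
        then have "L \<le> 4 powr \<alpha> * L" using L by simp
        ultimately show ?thesis
          using mult_mono[of L "2 * (4 powr \<alpha> * L)" 1 "(2 * d / R) powr \<alpha>"] L by simp
      qed
      finally show ?thesis using Md by (simp add: d_def)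
    qed
  qed simp
  have hol: "locally_holder_on \<Omega> \<alpha> v"
    unfolding locally_holder_on_def
  proof (intro allI impI, elim conjE)
    fix C assume C: "compact C" "C \<subseteq> \<Omega>"
    obtain e where e: "0 < e" "(\<Union>x\<in>C. ball x e) \<subseteq> \<Omega>"
      using compact_subset_open_imp_ball_epsilon_subset[OF C(1) \<Omega> C(2)] by blast
    then have R: "0 < e / 2" by simp
    obtain L where L: "0 < L" and est': "\<And>x. ball x (2 * (e / 2)) \<subseteq> \<Omega> \<Longrightarrow> decays \<alpha> L u x (e / 2) (v x)"
      using est[OF R] by blast
    have "\<bar>v x - v y\<bar> \<le> M (e / 2) L * norm (x - y) powr \<alpha>" if "x \<in> C" "y \<in> C" for x y
      using that e by (intro pair[OF R L est']) auto
    then show "\<exists>M. \<forall>x\<in>C. \<forall>y\<in>C. \<bar>v x - v y\<bar> \<le> M * norm (x - y) powr \<alpha>" by blast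
  qed
  have aeC: "AE y in lebesgue. y \<in> C \<longrightarrow> u y = v y" if C: "compact C" "C \<subseteq> \<Omega>" for C
  proof -
    obtain e where e: "0 < e" "(\<Union>x\<in>C. ball x e) \<subseteq> \<Omega>"
      using compact_subset_open_imp_ball_epsilon_subset[OF C(1) \<Omega> C(2)] by blast
    define R where "R = e / 2"
    have R: "0 < R" using e by (simp add: R_def)
    have CB: "ball x (2 * R) \<subseteq> \<Omega>" if "x \<in> C" for x using that e by (auto simp: R_def)
    obtain L where L: "0 < L" and est': "\<And>x. ball x (2 * R) \<subseteq> \<Omega> \<Longrightarrow> decays \<alpha> L u x R (v x)"
      using est[OF R] by blast
    have M0: "0 \<le> M R L" using L R by (simp add: M_def)
    \<comment> \<open>At each scale finitely many balls cover the compact set, so only finitely many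
      null sets arise. The error \<open>b n\<close> combines the decay at a centre with the
      continuity of \<open>v\<close>, and countably many scales make it vanish.\<close>
    define \<delta> where "\<delta> n = R / real (Suc n)" for n
    have \<delta>: "0 < \<delta> n" "\<delta> n \<le> R" for n using R by (auto simp: \<delta>_def field_simps)
    define b where "b n = 4 powr \<alpha> * L * (\<delta> n / R) powr \<alpha> + M R L * \<delta> n powr \<alpha>" for n
    have "AE y in lebesgue. y \<in> C \<longrightarrow> \<bar>u y - v y\<bar> \<le> b n" for n
    proof -
      have cov: "C \<subseteq> (\<Union>x\<in>C. ball x (\<delta> n))" using \<delta>(1)[of n] by auto
      obtain D where D: "D \<subseteq> C" "finite D" "C \<subseteq> (\<Union>x\<in>D. ball x (\<delta> n))"
        by (rule compactE_image[OF C(1) _ cov]) auto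
      have "AE y in lebesgue. \<forall>x\<in>D. y \<in> ball x (\<delta> n) \<longrightarrow> \<bar>u y - v x\<bar> \<le> 4 powr \<alpha> * L * (\<delta> n / R) powr \<alpha>"
        using D \<delta>[of n] est' CB by (intro eventually_ball_finite) blast+
      then show ?thesis
      proof eventually_elim
        case (elim y)
        show ?case
        proof
          assume y: "y \<in> C"
          then obtain x where x: "x \<in> D" "y \<in> ball x (\<delta> n)" using D by blast
          have "\<bar>u y - v x\<bar> \<le> 4 powr \<alpha> * L * (\<delta> n / R) powr \<alpha>" using elim x by blast
          moreover have "\<bar>v x - v y\<bar> \<le> M R L * norm (x - y) powr \<alpha>"
            by (rule pair[OF R L est']) (use x y D CB in auto)
          moreover have "M R L * norm (x - y) powr \<alpha> \<le> M R L * \<delta> n powr \<alpha>"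
            using x \<alpha> M0 by (intro mult_left_mono powr_mono2) (auto simp: dist_norm)
          ultimately show "\<bar>u y - v y\<bar> \<le> b n" unfolding b_def by linarith
        qed
      qed
    qed
    then have ae: "AE y in lebesgue. \<forall>n. y \<in> C \<longrightarrow> \<bar>u y - v y\<bar> \<le> b n" unfolding AE_all_countable by blast
    have b0: "b \<longlonglongrightarrow> 0"
    proof -
      have 1: "\<delta> \<longlonglongrightarrow> 0" unfolding \<delta>_def[abs_def] by (intro LIMSEQ_Suc lim_const_over_n)
      have "(\<lambda>n. \<delta> n / R) \<longlonglongrightarrow> 0 / R" by (intro tendsto_divide 1 tendsto_const) (use R in simp)
      then have 2: "(\<lambda>n. \<delta> n / R) \<longlonglongrightarrow> 0" by simp
      have "(\<lambda>n. 4 powr \<alpha> * L * (\<delta> n / R) powr \<alpha> + M R L * \<delta> n powr \<alpha>) \<longlonglongrightarrow> 4 powr \<alpha> * L * 0 + M R L * 0"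
      proof (intro tendsto_add tendsto_mult tendsto_const)
        show "(\<lambda>n. (\<delta> n / R) powr \<alpha>) \<longlonglongrightarrow> 0"
          by (rule tendsto_zero_powrI[OF 2 tendsto_const _ \<alpha>]) (use \<delta> R in \<open>auto intro!: always_eventually divide_nonneg_pos less_imp_le\<close>)
        show "(\<lambda>n. \<delta> n powr \<alpha>) \<longlonglongrightarrow> 0"
          by (rule tendsto_zero_powrI[OF 1 tendsto_const _ \<alpha>]) (use \<delta> in \<open>auto intro!: always_eventually less_imp_le\<close>)
      qed
      then show ?thesis by (simp add: b_def[abs_def])
    qed
    from ae show ?thesis
    proof eventually_elim
      case (elim y)
      show ?case
      proof
        assume "y \<in> C"
        then have "\<bar>u y - v y\<bar> \<le> 0" using elim by (intro LIMSEQ_le_const[OF b0]) auto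
        then show "u y = v y" by simp
      qed
    qed
  qed
  obtain C :: "nat \<Rightarrow> 'a set" where C: "\<And>n. compact (C n)" "\<And>n. C n \<subseteq> \<Omega>" "\<Union>(range C) = \<Omega>"
  proof (rule open_Union_compact_subsets[OF \<Omega>], goal_cases)
    case (1 C)
    show ?case by (rule 1(1)[OF 1(2,3,5)])
  qed
  have "AE y in lebesgue. \<forall>n. y \<in> C n \<longrightarrow> u y = v y"
    unfolding AE_all_countable using aeC[OF C(1,2)] by blast
  then have "AE y in lebesgue. u y = v y"
  proof eventually_elim
    case (elim y)
    show ?case
    proof (cases "y \<in> \<Omega>")
      case True
      then show ?thesis using elim C(3) by blast
    qed (simp add: v_def)
  qed
  then show ?thesis using hol by blast
qed

section \<open>Choosing the size \<open>L\<close> from the data\<close>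

lemma le_powr_of_root_le:
  fixes x q L :: real
  assumes "0 \<le> x" "0 < q" "x powr (1 / q) \<le> L"
  shows "x \<le> L powr q"
proof -
  have "x = (x powr (1 / q)) powr q" using assms by (simp add: powr_powr)
  also have "\<dots> \<le> L powr q" using assms by (intro powr_mono2) auto
  finally show ?thesis .
qed

theorem theorem1p2:
  fixes s p lam Lam :: real
  assumes "0 < s" "s < 1" "1 < p" "1 \<le> lam" "lam \<le> Lam"
  shows "\<exists>\<alpha> c. 0 < \<alpha> \<and> \<alpha> < s * p / (p - 1) \<and> 0 < c \<and>
    (\<forall>(K :: 'a::euclidean_space \<Rightarrow> 'a \<Rightarrow> real) \<Omega> g u.
       admissible_kernel s p lam Lam K \<and> open \<Omega> \<and> bounded \<Omega> \<and> g \<in> frac_sobolev s p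
       \<and> weak_solution s p K \<Omega> g u \<longrightarrow>
         (\<exists>v. (AE x in lebesgue. u x = v x) \<and> locally_holder_on \<Omega> \<alpha> v)
       \<and> (\<forall>x0 r \<rho>. 0 < r \<and> ball x0 (2 * r) \<subseteq> \<Omega> \<and> 0 < \<rho> \<and> \<rho> \<le> r \<longrightarrow>
            ess_osc u (ball x0 \<rho>) \<le> ereal (c * (\<rho> / r) powr \<alpha> *
              (tail s p u x0 r
               + ((1 / measure lebesgue (ball x0 (2 * r)))
                  * (\<integral>x\<in>ball x0 (2 * r). \<bar>u x\<bar> powr p \<partial>lebesgue)) powr (1 / p)))))"
proof -
  interpret frac_kernel s p lam Lam
    using assms by unfold_locales auto
  let ?n = "real DIM('a)"
  obtain \<alpha> \<epsilon> \<delta> where \<alpha>: "0 < \<alpha>" "\<alpha> < s * p / (p - 1)" and \<epsilon>: "0 < \<epsilon>" and \<delta>: "0 < \<delta>" and decay: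
    "\<And>(K::'a \<Rightarrow> 'a \<Rightarrow> real) \<Omega> u x0 r L.
     admissible_kernel s p lam Lam K \<Longrightarrow> local_solution K \<Omega> u \<Longrightarrow> 0 < r \<Longrightarrow> ball x0 (2 * r) \<subseteq> \<Omega> \<Longrightarrow> 0 < L
     \<Longrightarrow> ball_int (\<lambda>x. \<bar>u x\<bar> powr p) x0 (2 * r) \<le> ennreal (\<delta> * L powr p * r ^ DIM('a))
     \<Longrightarrow> tail_int (\<lambda>y. \<bar>u y\<bar> powr (p - 1)) x0 r
          \<le> ennreal (\<epsilon> * L powr (p - 1) * r powr (- (s * p)))
     \<Longrightarrow> \<exists>a. decays \<alpha> L u x0 r a"
  proof (rule oscillation_decay_lp[where 'a='a], goal_cases)
    case (1 \<alpha> \<epsilon> \<delta>)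
    show ?case by (rule 1(1)[OF 1(2-5)]) (rule 1(6))
  qed
  obtain Ct where Ct: "0 < Ct" "\<And>(u::'a \<Rightarrow> real) x0 r. u \<in> frac_sobolev s p \<Longrightarrow> 0 < r \<Longrightarrow>
     tail_int (\<lambda>y. \<bar>u y\<bar> powr (p - 1)) x0 r
      \<le> ennreal (Ct * r powr (- (s * p)) + r powr (- (?n + s * p)) * (\<integral>x. \<bar>u x\<bar> powr p \<partial>lebesgue))"
    using tail_integral_bound[where 'a='a] by blast
  define \<omega> where "\<omega> = unit_ball_vol ?n"
  have \<omega>: "0 < \<omega>" unfolding \<omega>_def by (rule unit_ball_vol_real_pos)
  \<comment> \<open>The two entries invert the smallness conditions for the tail and for the mean,
    so any \<open>L\<close> above \<open>c0\<close> times their sum meets both.\<close>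
  define c0 where "c0 = max (\<epsilon> powr (- 1 / (p - 1))) ((\<omega> * 2 ^ DIM('a) / \<delta>) powr (1 / p))"
  have c0: "0 < c0" using \<epsilon> by (simp add: c0_def less_max_iff_disj)
  define c where "c = 2 * 4 powr \<alpha> * c0"
  have c: "0 < c" using c0 by (simp add: c_def)
  have rep: "\<exists>v. (AE x in lebesgue. u x = v x) \<and> locally_holder_on \<Omega> \<alpha> v"
    if K: "admissible_kernel s p lam Lam K" and \<Omega>: "open \<Omega>" and sol: "weak_solution s p K \<Omega> g u"
    for K :: "'a \<Rightarrow> 'a \<Rightarrow> real" and \<Omega> g u
  proof (rule holder_representative[OF \<Omega> \<alpha>(1)])
    fix R :: real assume R: "0 < R"
    have u: "u \<in> frac_sobolev s p" using sol by (simp add: weak_solution_def)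
    have ui: "integrable lebesgue (\<lambda>x. \<bar>u x\<bar> powr p)" using u by (simp add: frac_sobolev_def)
    define U where "U = (\<integral>x. \<bar>u x\<bar> powr p \<partial>lebesgue)"
    have U: "0 \<le> U" unfolding U_def by (intro Bochner_Integration.integral_nonneg) simp
    define J where "J = Ct * R powr (- (s * p)) + R powr (- (?n + s * p)) * U"
    have J: "0 \<le> J" using Ct(1) U by (simp add: J_def)
    \<comment> \<open>Built from global quantities of \<open>u\<close>, hence common to all centres
      for fixed \<open>R\<close>. The summand 1 keeps it positive when \<open>u\<close> vanishes
      almost everywhere.\<close>
    define L where "L = 1 + (J * R powr (s * p) / \<epsilon>) powr (1 / (p - 1)) + (U / (\<delta> * R ^ DIM('a))) powr (1 / p)"
    have L: "0 < L" by (simp add: L_def add_pos_nonneg)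
    have "J * R powr (s * p) / \<epsilon> \<le> L powr (p - 1)"
      using J \<epsilon> p_gt by (intro le_powr_of_root_le) (auto simp: L_def add_increasing add_increasing2)
    then have "J * R powr (s * p) \<le> \<epsilon> * L powr (p - 1)" using \<epsilon> by (simp add: field_simps)
    then have "J * R powr (s * p) * R powr (- (s * p)) \<le> \<epsilon> * L powr (p - 1) * R powr (- (s * p))"
      by (rule mult_right_mono) simp
    moreover have "R powr (s * p) * R powr (- (s * p)) = 1" using R by (simp add: powr_minus)
    ultimately have LJ: "J \<le> \<epsilon> * L powr (p - 1) * R powr (- (s * p))" by (simp add: mult.assoc)
    have "U / (\<delta> * R ^ DIM('a)) \<le> L powr p"
      using U \<delta> R p_gt by (intro le_powr_of_root_le) (auto simp: L_def add_increasing add_increasing2)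
    then have LU: "U \<le> \<delta> * L powr p * R ^ DIM('a)" using \<delta> R by (simp add: field_simps)
    have "\<exists>a. decays \<alpha> L u x R a"
      if x: "ball x (2 * R) \<subseteq> \<Omega>" for x
    proof (rule decay[OF K weak_solution_local[OF sol] R x L])
      have "ball_int (\<lambda>x. \<bar>u x\<bar> powr p) x0 (2 * R) \<le> (\<integral>\<^sup>+ x. ennreal (\<bar>u x\<bar> powr p) \<partial>lebesgue)" for x0
        by (intro nn_integral_mono) (auto simp: indicator_def)
      also have "(\<integral>\<^sup>+ x. ennreal (\<bar>u x\<bar> powr p) \<partial>lebesgue) = ennreal U"
        unfolding U_def by (rule nn_integral_eq_integral[OF ui]) simp
      also have "ennreal U \<le> ennreal (\<delta> * L powr p * R ^ DIM('a))" by (rule ennreal_leI[OF LU])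
      finally show "ball_int (\<lambda>y. \<bar>u y\<bar> powr p) x (2 * R) \<le> ennreal (\<delta> * L powr p * R ^ DIM('a))" .
      have "tail_int (\<lambda>y. \<bar>u y\<bar> powr (p - 1)) x R \<le> ennreal J"
        unfolding J_def U_def by (rule Ct(2)[OF u R])
      also have "\<dots> \<le> ennreal (\<epsilon> * L powr (p - 1) * R powr (- (s * p)))" by (rule ennreal_leI[OF LJ])
      finally show "tail_int (\<lambda>y. \<bar>u y\<bar> powr (p - 1)) x R
          \<le> ennreal (\<epsilon> * L powr (p - 1) * R powr (- (s * p)))" .
    qed
    then show "\<exists>L>0. \<forall>x. ball x (2 * R) \<subseteq> \<Omega> \<longrightarrow> (\<exists>a. decays \<alpha> L u x R a)"
      using L by blast
  qed
  have osc: "ess_osc u (ball x0 \<rho>) \<le> ereal (c * (\<rho> / r) powr \<alpha> *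
              (tail s p u x0 r
               + ((1 / measure lebesgue (ball x0 (2 * r)))
                  * (\<integral>x\<in>ball x0 (2 * r). \<bar>u x\<bar> powr p \<partial>lebesgue)) powr (1 / p)))"
    if K: "admissible_kernel s p lam Lam K" and sol: "weak_solution s p K \<Omega> g u"
      and r: "0 < r" and B: "ball x0 (2 * r) \<subseteq> \<Omega>" and \<rho>: "0 < \<rho>" "\<rho> \<le> r"
    for K :: "'a \<Rightarrow> 'a \<Rightarrow> real" and \<Omega> g u x0 r \<rho>
  proof -
    have u: "u \<in> frac_sobolev s p" using sol by (simp add: weak_solution_def)
    have um[measurable]: "u \<in> borel_measurable lebesgue" and ui: "integrable lebesgue (\<lambda>x. \<bar>u x\<bar> powr p)"
      using u by (auto simp: frac_sobolev_def)
    define t where "t = tail s p u x0 r"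
    define A where "A = (\<integral>x\<in>ball x0 (2 * r). \<bar>u x\<bar> powr p \<partial>lebesgue)"
    define V where "V = measure lebesgue (ball x0 (2 * r))"
    define m where "m = ((1 / V) * A) powr (1 / p)"
    have V: "V = \<omega> * 2 ^ DIM('a) * r ^ DIM('a)"
      using r by (simp add: V_def content_ball \<omega>_def power_mult_distrib mult.assoc)
    have V0: "0 < V" using V \<omega> r by simp
    have A0: "0 \<le> A" unfolding A_def set_lebesgue_integral_def by (intro Bochner_Integration.integral_nonneg) simp
    have t0: "0 \<le> t" by (simp add: t_def tail_def)
    have m0: "0 \<le> m" by (simp add: m_def)
    have mA: "A = V * m powr p" using V0 A0 p_gt by (simp add: m_def powr_powr)
    have A_nn: "ball_int (\<lambda>x. \<bar>u x\<bar> powr p) x0 (2 * r) = ennreal A"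
    proof -
      have "integrable lebesgue (\<lambda>x. indicator (ball x0 (2 * r)) x * \<bar>u x\<bar> powr p)"
        using integrable_mult_indicator[OF _ ui, of "ball x0 (2 * r)"] by simp
      then have "(\<integral>\<^sup>+ x. ennreal (indicator (ball x0 (2 * r)) x * \<bar>u x\<bar> powr p) \<partial>lebesgue) = ennreal (\<integral>x. indicator (ball x0 (2 * r)) x * \<bar>u x\<bar> powr p \<partial>lebesgue)"
        by (rule nn_integral_eq_integral) simp
      moreover have "ball_int (\<lambda>x. \<bar>u x\<bar> powr p) x0 (2 * r) = (\<integral>\<^sup>+ x. ennreal (indicator (ball x0 (2 * r)) x * \<bar>u x\<bar> powr p) \<partial>lebesgue)"
        by (intro nn_integral_cong) (auto simp: indicator_def)
      ultimately show ?thesis by (simp add: A_def set_lebesgue_integral_def)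
    qed
    define k where "k = 2 * 4 powr \<alpha> * (\<rho> / r) powr \<alpha>"
    have k: "0 < k" using \<rho> r by (simp add: k_def)
    have "ess_osc u (ball x0 \<rho>) \<le> ereal (c * (\<rho> / r) powr \<alpha> * (t + m)) + ereal e" if e: "0 < e" for e
    proof -
      \<comment> \<open>\<open>t + m\<close> may be 0 while the decay lemma asks for a positive
        size; the perturbation contributes exactly \<open>e\<close> to the final bound, and
        \<open>e\<close> is arbitrary.\<close>
      define L where "L = c0 * (t + m) + e / k"
      have L: "0 < L" using c0 t0 m0 e k by (simp add: L_def add_nonneg_pos)
      have "c0 * t \<le> L" "c0 * m \<le> L"
        using c0 t0 m0 e k by (auto simp: L_def distrib_left intro!: add_increasing2)
      have Lt: "t powr (p - 1) \<le> \<epsilon> * L powr (p - 1)"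
      proof -
        have "(t powr (p - 1) / \<epsilon>) powr (1 / (p - 1)) = t * \<epsilon> powr (- 1 / (p - 1))"
          using t0 \<epsilon> p_gt by (simp add: powr_divide powr_powr powr_minus field_simps)
        also have "\<dots> \<le> c0 * t" using t0 by (subst mult.commute, intro mult_right_mono) (auto simp: c0_def)
        also have "\<dots> \<le> L" by fact
        finally have "t powr (p - 1) / \<epsilon> \<le> L powr (p - 1)"
          using \<epsilon> p_gt by (intro le_powr_of_root_le) auto
        then show ?thesis using \<epsilon> by (simp add: field_simps)
      qed
      have Lm: "A \<le> \<delta> * L powr p * r ^ DIM('a)"
      proof -
        have "(\<omega> * 2 ^ DIM('a) / \<delta> * m powr p) powr (1 / p) = (\<omega> * 2 ^ DIM('a) / \<delta>) powr (1 / p) * m"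
          using m0 \<omega> \<delta> p_gt by (subst powr_mult) (auto simp: powr_powr)
        also have "\<dots> \<le> c0 * m" using m0 by (intro mult_right_mono) (auto simp: c0_def)
        also have "\<dots> \<le> L" by fact
        finally have "\<omega> * 2 ^ DIM('a) / \<delta> * m powr p \<le> L powr p"
          using \<delta> \<omega> p_gt by (intro le_powr_of_root_le) auto
        then have "\<omega> * 2 ^ DIM('a) * m powr p \<le> \<delta> * L powr p" using \<delta> by (simp add: field_simps)
        then have "\<omega> * 2 ^ DIM('a) * m powr p * r ^ DIM('a) \<le> \<delta> * L powr p * r ^ DIM('a)"
          using r by (intro mult_right_mono) auto
        then show ?thesis unfolding mA V by (simp add: mult_ac)
      qed
      have "\<exists>a. decays \<alpha> L u x0 r a"
      proof (rule decay[OF K weak_solution_local[OF sol] r B L])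
        show "ball_int (\<lambda>x. \<bar>u x\<bar> powr p) x0 (2 * r) \<le> ennreal (\<delta> * L powr p * r ^ DIM('a))"
          unfolding A_nn by (rule ennreal_leI[OF Lm])
        have "r powr (- (s * p)) * t powr (p - 1) \<le> r powr (- (s * p)) * (\<epsilon> * L powr (p - 1))"
          by (intro mult_left_mono Lt) simp
        then show "tail_int (\<lambda>y. \<bar>u y\<bar> powr (p - 1)) x0 r
          \<le> ennreal (\<epsilon> * L powr (p - 1) * r powr (- (s * p)))"
          unfolding tail_eq[OF u r] t_def[symmetric] by (intro ennreal_leI) (simp add: mult_ac)
      qed
      then obtain a where a: "AE x in lebesgue. x \<in> ball x0 \<rho> \<longrightarrow> \<bar>u x - a\<bar> \<le> 4 powr \<alpha> * L * (\<rho> / r) powr \<alpha>"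
        using \<rho> by blast
      have "ess_osc u (ball x0 \<rho>) \<le> ereal (2 * (4 powr \<alpha> * L * (\<rho> / r) powr \<alpha>))"
        by (rule ess_osc_le[OF um a])
      also have "2 * (4 powr \<alpha> * L * (\<rho> / r) powr \<alpha>) = k * L" by (simp add: k_def)
      also have "k * L = c * (\<rho> / r) powr \<alpha> * (t + m) + e"
        using k by (simp add: L_def distrib_left) (simp add: k_def c_def)
      finally show ?thesis by simp
    qed
    then have "ess_osc u (ball x0 \<rho>) \<le> ereal (c * (\<rho> / r) powr \<alpha> * (t + m))"
      by (rule ereal_le_epsilon2)
    then show ?thesis by (simp add: t_def m_def V_def A_def)
  qed
  show ?thesis
  proof (rule exI[of _ \<alpha>], rule exI[of _ c], intro conjI allI impI)
    show "0 < \<alpha>" "\<alpha> < s * p / (p - 1)" "0 < c" by fact+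
  qed (use rep osc in blast)+
qed

end
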